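(* Let $\mathcal{D}=\mathcal{D}_{n,n,q}$. Suppose $W$ is a subspace of $V(n^2,q)$ of dimension $n^2-n$ such that $W$ does not contain an element of $\mathcal{D}$. Suppose $(\mathcal{D},U,W)$ and $(\mathcal{D},U',W)$ are two BEL-configurations. Then $\mathcal{S}(\mathcal{D},U',W)$ is equivalent to $\mathcal{S}(\mathcal{D},U,W)$ or to the dual of $\mathcal{S}(\mathcal{D},U,W)$ if and only if there exists some $\phi\in\mathrm{Stab}(\tilde{\mathcal{B}}(W))\leq\mathrm{\Gamma L}(n^2,q)$ such that $U'=U^{\phi}$.
   Context: Put $r=n$ and represent $V(rn,q)=V(n^2,q)$ as $(\mathbb{F}_{q^n})^n$, regarded as an $\mathbb{F}_q$-space. For integers $r\ge1$, $\mathcal{D}_{r,n,q}$ is the $n$-spread consisting of all one-dimensional $\mathbb{F}_{q^n}$-subspaces of $(\mathbb{F}_{q^n})^r$. For a subset $A$ of $V(n^2,q)$, $\mathcal{B}(A)$ is the set of elements of $\mathcal{D}$ containing a nonzero vector of $A$, and $\tilde{\mathcal{B}}(A)$ is the set of all nonzero vectors lying in elements of $\mathcal{B}(A)$. $\mathrm{\Gamma L}(n^2,q)$ is the group of all bijective $\mathbb{F}_q$-semilinear maps of $V(n^2,q)$, and $\mathrm{Stab}(\tilde{\mathcal{B}}(W))$ is the setwise stabilizer of $\tilde{\mathcal{B}}(W)$ in it; $U^\phi$ is the image of $U$ under $\phi$. A BEL-configuration $(\mathcal{D},U,W)$ in $V(n^2,q)$ consists of $\mathcal{D}$ and $\mathbb{F}_q$-subspaces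 $U$ of dimension $n$ and $W$ of dimension $n^2-n$ with $\mathcal{B}(U)\cap\mathcal{B}(W)=\emptyset$. The spread $\mathcal{S}(\mathcal{D},U,W)$: embed $V(n^2,q)$ in $V(n^2+n,q)=\{(v_0,v_1,\ldots,v_n):v_i\in\mathbb{F}_{q^n}\}$ as the subspace $v_0=0$, let $\mathcal{B}(z)$ denote the element of $\mathcal{D}_{n+1,n,q}$ containing $z\neq0$, and choose $v\in V(n^2+n,q)\setminus V(n^2,q)$. Then $$\mathcal{S}(\mathcal{D},U,W)=\left\{\frac{\langle\mathcal{B}(z),W\rangle}{W}:0\ne z\in\langle v,U\rangle\right\},$$ which is known to be a semifield spread of $V(n^2+n,q)/W\cong V(2n,q)$ (considered up to equivalence). Two $n$-spreads of $2n$-dimensional $\mathbb{F}_q$-spaces are equivalent if a bijective $\mathbb{F}_q$-semilinear map takes one to the other. The dual of an $n$-spread $\mathcal{S}$ of $V(2n,q)=(\mathbb{F}_{q^n})^2$ is $\mathcal{S}^\epsilon=\{T^\epsilon:T\in\mathcal{S}\}$, where $T^\epsilon=\{v:b_\epsilon(u,v)=0\ \forall u\in T\}$ and $b_\epsilon((a,b),(c,d))=\mathrm{tr}(ad-bc)$, with $\mathrm{tr}$ the trace from $\mathbb{F}_{q^n}$ to $\mathbb{F}_q$; another choice of nondegenerate form gives an equivalent spread. *)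

theory Defs
  imports "HOL-Analysis.Analysis" "HOL-Library.Set_Algebras"
begin

text \<open>
  Conventions: the type \<open>'k\<close> is the field with \<open>q\<close> elements, the type \<open>'l\<close> is its extension of
  degree \<open>n\<close>, and \<open>\<iota> :: 'k \<Rightarrow> 'l\<close> is the field embedding.  The space \<open>'l ^ 'r\<close>, with \<open>CARD('r) = r\<close>,
  is \<open>V(rn,q)\<close>; notions over the large field use the library's \<^locale>\<open>vector_space\<close> interpretation
  \<open>vec\<close>, notions over the small field use scalar multiplication through \<open>\<iota>\<close>.
\<close>

definition field_hom :: "('a::field \<Rightarrow> 'b::field) \<Rightarrow> bool" where
  "field_hom f \<longleftrightarrow> f 1 = 1 \<and> (\<forall>x y. f (x + y) = f x + f y) \<and> (\<forall>x y. f (x * y) = f x * f y)"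

definition field_aut :: "('a::field \<Rightarrow> 'a) \<Rightarrow> bool" where
  "field_aut f \<longleftrightarrow> field_hom f \<and> bij f"

definition kscale :: "('k::field \<Rightarrow> 'l::field) \<Rightarrow> 'k \<Rightarrow> 'l ^ 'r \<Rightarrow> 'l ^ 'r" where
  "kscale \<iota> k x = \<iota> k *s x"

lemma vector_space_kscale:
  assumes "field_hom \<iota>"
  shows "vector_space (kscale \<iota>)"
  using assms unfolding field_hom_def
  by unfold_locales (simp_all add: kscale_def vec.scale_right_distrib vec.scale_left_distrib)

abbreviation ksubspace :: "('k::field \<Rightarrow> 'l::field) \<Rightarrow> ('l ^ 'r) set \<Rightarrow> bool" where
  "ksubspace \<iota> \<equiv> module.subspace (kscale \<iota>)"

abbreviation kspan :: "('k::field \<Rightarrow> 'l::field) \<Rightarrow> ('l ^ 'r) set \<Rightarrow> ('l ^ 'r) set" where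
  "kspan \<iota> \<equiv> module.span (kscale \<iota>)"

abbreviation kdim :: "('k::field \<Rightarrow> 'l::field) \<Rightarrow> ('l ^ 'r) set \<Rightarrow> nat" where
  "kdim \<iota> \<equiv> vector_space.dim (kscale \<iota>)"

definition desarg_spread :: "('l::field ^ 'r) set set" where
  "desarg_spread = {T. vec.subspace T \<and> vec.dim T = 1}"

definition spread_elem :: "'l::field ^ 'r \<Rightarrow> ('l ^ 'r) set" where
  "spread_elem z = (THE T. T \<in> desarg_spread \<and> z \<in> T)"

definition B :: "('l::field ^ 'r) set \<Rightarrow> ('l ^ 'r) set set" where
  "B A = {T \<in> desarg_spread. \<exists>x\<in>A. x \<noteq> 0 \<and> x \<in> T}"

definition B_tilde :: "('l::field ^ 'r) set \<Rightarrow> ('l ^ 'r) set" where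
  "B_tilde A = {x. x \<noteq> 0 \<and> (\<exists>T\<in>B A. x \<in> T)}"

definition BEL_configuration ::
    "('k::field \<Rightarrow> 'l::field) \<Rightarrow> ('l ^ 'n) set \<Rightarrow> ('l ^ 'n) set \<Rightarrow> bool" where
  "BEL_configuration \<iota> U W \<longleftrightarrow>
     ksubspace \<iota> U \<and> kdim \<iota> U = CARD('n) \<and>
     ksubspace \<iota> W \<and> kdim \<iota> W = CARD('n)^2 - CARD('n) \<and>
     B U \<inter> B W = {}"

text \<open>
  Semilinear bijections between spaces given by a carrier set and a scalar multiplication.
  Addition is that of the ambient type, which for cosets is the elementwise sum of sets.
\<close>

definition semilinear_bij ::
    "('k \<Rightarrow> 'k) \<Rightarrow> ('k \<Rightarrow> 'u \<Rightarrow> 'u) \<Rightarrow> 'u::plus set \<Rightarrow> ('k \<Rightarrow> 'v \<Rightarrow> 'v) \<Rightarrow> 'v::plus set \<Rightarrow>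
     ('u \<Rightarrow> 'v) \<Rightarrow> bool" where
  "semilinear_bij \<sigma> s X t Y f \<longleftrightarrow>
     bij_betw f X Y \<and>
     (\<forall>x\<in>X. \<forall>y\<in>X. f (x + y) = f x + f y) \<and>
     (\<forall>k. \<forall>x\<in>X. f (s k x) = t (\<sigma> k) (f x))"

definition spreads_equivalent ::
    "('k::field \<Rightarrow> 'u \<Rightarrow> 'u) \<Rightarrow> 'u::plus set \<Rightarrow> 'u set set \<Rightarrow>
     ('k \<Rightarrow> 'v \<Rightarrow> 'v) \<Rightarrow> 'v::plus set \<Rightarrow> 'v set set \<Rightarrow> bool" where
  "spreads_equivalent s X S t Y S' \<longleftrightarrow>
     (\<exists>\<sigma> f. field_aut \<sigma> \<and> semilinear_bij \<sigma> s X t Y f \<and> (\<lambda>T. f ` T) ` S = S')"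

definition Gamma_L :: "('k::field \<Rightarrow> 'l::field) \<Rightarrow> ('l ^ 'r \<Rightarrow> 'l ^ 'r) set" where
  "Gamma_L \<iota> = {\<phi>. \<exists>\<sigma>. field_aut \<sigma> \<and> semilinear_bij \<sigma> (kscale \<iota>) UNIV (kscale \<iota>) UNIV \<phi>}"

definition Stab :: "('k::field \<Rightarrow> 'l::field) \<Rightarrow> ('l ^ 'r) set \<Rightarrow> ('l ^ 'r \<Rightarrow> 'l ^ 'r) set" where
  "Stab \<iota> A = {\<phi> \<in> Gamma_L \<iota>. \<phi> ` A = A}"

text \<open>
  The coordinates of the \<open>(n+1)\<close>-tuples \<open>(v\<^sub>0,v\<^sub>1,\<dots>,v\<^sub>n)\<close> are indexed by \<open>'n option\<close>, with \<open>None\<close>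
  for \<open>v\<^sub>0\<close>.
\<close>

definition emb :: "'l::field ^ 'n \<Rightarrow> 'l ^ ('n option)" where
  "emb u = (\<chi> i. case i of None \<Rightarrow> 0 | Some j \<Rightarrow> u $ j)"

definition quot_space :: "('l::field ^ 'r) set \<Rightarrow> ('l ^ 'r) set set" where
  "quot_space W = range (\<lambda>x. x +o W)"

text \<open>
  Adding \<open>W\<close> makes \<open>k (x + W) = k x + W\<close> hold also for \<open>k = 0\<close>.
\<close>

definition quot_scale ::
    "('k::field \<Rightarrow> 'l::field) \<Rightarrow> ('l ^ 'r) set \<Rightarrow> 'k \<Rightarrow> ('l ^ 'r) set \<Rightarrow> ('l ^ 'r) set" where
  "quot_scale \<iota> W k X = kscale \<iota> k ` X + W"

definition BEL_spread ::
    "('k::field \<Rightarrow> 'l::field) \<Rightarrow> ('l ^ 'n) set \<Rightarrow> ('l ^ 'n) set \<Rightarrow> 'l ^ ('n option) \<Rightarrow>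
     ('l ^ ('n option)) set set set" where
  "BEL_spread \<iota> U W v =
     {(\<lambda>x. x +o emb ` W) ` kspan \<iota> (spread_elem z \<union> emb ` W) | z.
        z \<noteq> 0 \<and> z \<in> kspan \<iota> (insert v (emb ` U))}"

text \<open>
  The trace from the field with \<open>q ^ n\<close> elements to its subfield with \<open>q\<close> elements, as an element of the
  large field.
\<close>

definition field_trace :: "nat \<Rightarrow> nat \<Rightarrow> 'l::field \<Rightarrow> 'l" where
  "field_trace q n x = (\<Sum>i<n. x ^ (q ^ i))"

definition b_eps :: "nat \<Rightarrow> nat \<Rightarrow> 'l::field ^ 2 \<Rightarrow> 'l ^ 2 \<Rightarrow> 'l" where
  "b_eps q n u v = field_trace q n (u $ 1 * v $ 2 - u $ 2 * v $ 1)"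

definition dual_spread :: "nat \<Rightarrow> nat \<Rightarrow> ('l::field ^ 2) set set \<Rightarrow> ('l ^ 2) set set" where
  "dual_spread q n S = (\<lambda>T. {v. \<forall>u\<in>T. b_eps q n u v = 0}) ` S"

end

theory Submission
  imports Defs "HOL-Computational_Algebra.Polynomial"
begin

text \<open>
  Write \<open>F\<close> for the small field, with \<open>q\<close> elements, and \<open>L\<close> for the large one.  For \<open>x\<close> in \<open>L\<^sup>n\<close> consider the
  \<open>F\<close>-linear map \<open>l \<mapsto> l x + W\<close> from \<open>L\<close> to \<open>L\<^sup>n / W\<close>.  Both of these spaces have dimension \<open>n\<close> over \<open>F\<close>, so
  after a choice of bases the map is an \<open>n\<close> by \<open>n\<close> matrix over \<open>F\<close>, called \<open>mat_of x\<close>.  As \<open>W\<close> contains no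
  element of the Desarguesian spread, \<open>mat_of\<close> is injective, and counting shows that it is a linear
  isomorphism from \<open>L\<^sup>n\<close> to the matrix space (\<open>mat_of_bij\<close>).  It turns the set of vectors covered by \<open>B W\<close>
  into the set of nonzero singular matrices (\<open>B_tilde_mat_of\<close>) and \<open>U\<close> into an additive spread set: a
  subspace \<open>C\<close> whose nonzero elements are nonsingular.  The quotient space that carries the BEL spread becomes
  \<open>F\<^sup>n \<times> F\<^sup>n\<close>, and the spread itself becomes the set of the graphs of the elements of \<open>C\<close> together with
  \<open>0 \<times> F\<^sup>n\<close>, whatever the vector \<open>v\<close> (\<open>quot_iso_BEL_spread\<close>).

  The theorem thus becomes a statement about matrices, which rests on three facts.

  The spreads of \<open>C'\<close> and \<open>C\<close> are equivalent if and only if \<open>C = P C'\<^sup>\<sigma> Q\<close> for nonsingular \<open>P\<close>, \<open>Q\<close> and a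
  field automorphism \<open>\<sigma>\<close>.  An equivalence that respects the element \<open>0 \<times> F\<^sup>n\<close> at infinity is easily read off
  as such a triple.  An arbitrary one can be made to respect it, because the shears generate enough
  automorphisms (\<open>spreads_equivalent_imp_spread_set_equivalent\<close>).

  The dual of the spread of \<open>C\<close> is the spread of the transposed matrices.  This is immediate for
  the form \<open>x\<cdot>y' - y\<cdot>x'\<close>; the trace form differs from it by a linear bijection
  (\<open>dual_spread_equivalent\<close>).

  The semilinear bijections of the matrix space that preserve nonsingularity are \<open>X \<mapsto> P X\<^sup>\<sigma> Q\<close> and
  \<open>X \<mapsto> P (X\<^sup>\<sigma>)\<^sup>T Q\<close> (\<open>semilinear_nonsingularity_preserver\<close>).  Over a finite field there is a counting
  argument.  Such a map permutes the hyperplanes and preserves the number of nonsingular matrices in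
  each.  The hyperplane orthogonal to \<open>M \<noteq> 0\<close> contains the least number of nonsingular matrices exactly
  if \<open>M\<close> has rank one (\<open>rank_one_iff_hyperplane_count\<close>).  Hence the adjoint map preserves rank one, and the
  maximal spaces of matrices of rank at most one, which are \<open>x \<otimes> F\<^sup>n\<close> and \<open>F\<^sup>n \<otimes> y\<close>, determine its form
  (\<open>semilinear_rank_one_preserver\<close>).

  Together: some element of the stabilizer of the covered vectors maps \<open>U\<close> to \<open>U'\<close> if and only if the spread set of \<open>U'\<close> is
  equivalent to that of \<open>U\<close> or to its transpose, which means that the spreads, or the
  spread of \<open>U'\<close> and the dual of the spread of \<open>U\<close>, are equivalent.
\<close>

section \<open>Pairing matrices\<close>

lemma invertible_iff_kernel:
  fixes A :: "'a::field^'n^'n"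
  shows "invertible A \<longleftrightarrow> (\<forall>x. A *v x = 0 \<longrightarrow> x = 0)"
  by (simp add: invertible_left_inverse matrix_left_invertible_ker)

lemma invertible_transpose:
  fixes A :: "'a::field^'n^'n"
  assumes "invertible A"
  shows "invertible (transpose A)"
proof -
  obtain A' where "A ** A' = mat 1" "A' ** A = mat 1" using assms by (auto simp: invertible_def)
  then have "transpose A' ** transpose A = mat 1" "transpose A ** transpose A' = mat 1"
    by (simp_all flip: matrix_transpose_mul)
  then show ?thesis by (auto simp: invertible_def)
qed

definition dot :: "'a::comm_semiring_1^'n \<Rightarrow> 'a^'n \<Rightarrow> 'a" where
  "dot x y = (\<Sum>i\<in>UNIV. x $ i * y $ i)"

definition pairing :: "'a::comm_semiring_1^'n^'n \<Rightarrow> 'a^'n^'n \<Rightarrow> 'a" where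
  "pairing M X = (\<Sum>i\<in>UNIV. dot (M $ i) (X $ i))"

definition outer :: "'a::comm_semiring_1^'n \<Rightarrow> 'a^'n \<Rightarrow> 'a^'n^'n" where
  "outer x y = (\<chi> i j. x $ i * y $ j)"

definition rank_one :: "'a::field^'n^'n \<Rightarrow> bool" where
  "rank_one X \<longleftrightarrow> (\<exists>x y. x \<noteq> 0 \<and> y \<noteq> 0 \<and> X = outer x y)"

lemma dot_commute: "dot x y = dot y x"
  by (simp add: dot_def mult.commute)

lemma dot_add_right: "dot x (y + z) = dot x y + dot x z"
  by (simp add: dot_def sum.distrib distrib_left)

lemma dot_diff_right: "dot x (y - z) = dot x y - dot x (z :: 'a::field^'n)"
  by (simp add: dot_def sum_subtractf right_diff_distrib)

lemma dot_scale_right: "dot x (c *s y) = c * dot x y"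
  by (simp add: dot_def sum_distrib_left mult_ac)

lemma dot_axis: "dot x (axis i 1) = x $ i"
proof -
  have "dot x (axis i 1) = (\<Sum>j\<in>UNIV. if j = i then x $ i else 0)"
    unfolding dot_def by (rule sum.cong) (auto simp: axis_def)
  then show ?thesis by simp
qed

lemma dot_eq_zero_iff: "(\<forall>y. dot x y = 0) \<longleftrightarrow> x = (0 :: 'a::field^'n)"
proof
  assume "\<forall>y. dot x y = 0"
  then show "x = 0" by (metis dot_axis vec_eq_iff zero_index)
qed (simp add: dot_def)

lemma matrix_vector_dot: "(A *v x) $ i = dot (A $ i) x"
  by (simp add: matrix_vector_mult_def dot_def)

lemma dot_matrix_left: "dot (A *v x) y = dot x (transpose A *v y)"
  for A :: "'a::field^'n^'m"
proof -
  have "dot (A *v x) y = (\<Sum>i\<in>UNIV. \<Sum>j\<in>UNIV. A $ i $ j * x $ j * y $ i)"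
    by (simp add: dot_def matrix_vector_mult_def sum_distrib_right)
  also have "\<dots> = (\<Sum>j\<in>UNIV. \<Sum>i\<in>UNIV. A $ i $ j * x $ j * y $ i)"
    by (rule sum.swap)
  also have "\<dots> = dot x (transpose A *v y)"
    by (simp add: dot_def matrix_vector_mult_def transpose_def sum_distrib_left mult_ac)
  finally show ?thesis .
qed

lemma pairing_trace: "pairing M X = trace (transpose M ** X)"
proof -
  have "pairing M X = (\<Sum>i\<in>UNIV. \<Sum>j\<in>UNIV. M $ i $ j * X $ i $ j)"
    by (simp add: pairing_def dot_def)
  also have "\<dots> = (\<Sum>j\<in>UNIV. \<Sum>i\<in>UNIV. M $ i $ j * X $ i $ j)"
    by (rule sum.swap)
  finally show ?thesis by (simp add: trace_def matrix_matrix_mult_def transpose_def)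
qed

lemma pairing_sandwich:
  fixes M :: "'a::field^'n^'n"
  shows "pairing (P ** M ** Q) X = pairing M (transpose P ** X ** transpose Q)"
proof -
  have "pairing (P ** M ** Q) X = trace (transpose Q ** (transpose M ** (transpose P ** X)))"
    by (simp add: pairing_trace matrix_transpose_mul matrix_mul_assoc)
  also have "\<dots> = trace ((transpose M ** (transpose P ** X)) ** transpose Q)"
    by (rule trace_mul_sym)
  finally show ?thesis by (simp add: pairing_trace matrix_mul_assoc)
qed

lemma pairing_transpose: "pairing (transpose M) X = pairing M (transpose X)"
proof -
  have "pairing (transpose M) X = (\<Sum>i\<in>UNIV. \<Sum>j\<in>UNIV. M $ j $ i * X $ i $ j)"
    by (simp add: pairing_def dot_def transpose_def)
  also have "\<dots> = (\<Sum>j\<in>UNIV. \<Sum>i\<in>UNIV. M $ j $ i * X $ i $ j)"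
    by (rule sum.swap)
  finally show ?thesis by (simp add: pairing_def dot_def transpose_def)
qed

lemma pairing_outer: "pairing (outer x y) X = dot x (X *v y)"
  by (simp add: pairing_def outer_def dot_def matrix_vector_mult_def sum_distrib_left mult_ac)

lemma pairing_remove_row:
  "pairing M X = dot (M $ i) (X $ i) + (\<Sum>k\<in>UNIV - {i}. dot (M $ k) (X $ k))"
  by (simp add: pairing_def sum.remove)

section \<open>Counting nonsingular matrices in hyperplanes\<close>

text \<open>The general linear group is transitive on nonzero vectors.\<close>
lemma exists_invertible_to_axis:
  fixes x :: "'a::field^'n"
  assumes "x \<noteq> 0"
  shows "\<exists>E :: 'a^'n^'n. invertible E \<and> E *v x = axis i 1"
proof -
  obtain p where p: "x $ p \<noteq> 0"
    using assms by (auto simp: vec_eq_iff)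
  define \<tau> where "\<tau> = Transposition.transpose i p"
  \<comment> \<open>row \<open>i\<close> sends \<open>z\<close> to \<open>z $ p / x $ p\<close>; every other row is orthogonal to \<open>x\<close>\<close>
  define E :: "'a^'n^'n" where
    "E = (\<chi> k. if k = i then (1 / x $ p) *s axis p 1
              else axis (\<tau> k) 1 - (x $ \<tau> k / x $ p) *s axis p 1)"
  have E: "(E *v z) $ k = (if k = i then z $ p / x $ p else z $ \<tau> k - x $ \<tau> k / x $ p * z $ p)" for z k
    unfolding matrix_vector_dot E_def
    by (simp add: dot_commute[of _ z] dot_diff_right dot_scale_right dot_axis)
  have "E *v x = axis i 1"
    using p by (auto simp: vec_eq_iff E axis_def)
  moreover have "z = 0" if "E *v z = 0" for z
  proof -
    have zp: "z $ p = 0" using E[of z i] that p by simp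
    have "z $ k = 0" for k
    proof (cases "\<tau> k = i")
      case True
      then have "k = p" by (auto simp: \<tau>_def Transposition.transpose_def split: if_splits)
      then show ?thesis using zp by simp
    next
      case False
      have "\<tau> (\<tau> k) = k" by (simp add: \<tau>_def)
      then show ?thesis using E[of z "\<tau> k"] that zp False by simp
    qed
    then show ?thesis by (simp add: vec_eq_iff)
  qed
  ultimately show ?thesis by (auto simp: invertible_iff_kernel)
qed

text \<open>
  Every hyperplane of the matrix space has the form \<open>pairing M X = 0\<close>.  Semilinear bijections permute
  hyperplanes, and those that preserve nonsingularity preserve this number.
\<close>
definition hyperplane_count :: "'a::field^'n^'n \<Rightarrow> nat" where
  "hyperplane_count M = card {X. invertible X \<and> pairing M X = 0}"

text \<open>
  Write \<open>E x = e\<^sub>i\<close> and \<open>D y = e\<^sub>i\<close> with \<open>E\<close>, \<open>D\<close> nonsingular.  Then \<open>X \<mapsto> E\<^sup>T X D\<close> carries the hyperplane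
  \<open>e\<^sub>i\<cdot>X e\<^sub>i = 0\<close> to \<open>x\<cdot>X y = 0\<close> and permutes the nonsingular matrices.
\<close>
lemma hyperplane_count_outer_axis:
  fixes x y :: "'a::{field,finite}^'n"
  assumes "x \<noteq> 0" "y \<noteq> 0"
  shows "hyperplane_count (outer x y) = hyperplane_count (outer (axis i 1) (axis i 1) :: 'a^'n^'n)"
proof -
  obtain E where E: "invertible E" "E *v x = axis i 1"
    using exists_invertible_to_axis[OF assms(1)] by blast
  obtain D where D: "invertible D" "D *v y = axis i 1"
    using exists_invertible_to_axis[OF assms(2)] by blast
  define h where "h X = transpose E ** X ** D" for X :: "'a^'n^'n"
  obtain E' where E': "E ** E' = mat 1" "E' ** E = mat 1" using E(1) by (auto simp: invertible_def)
  obtain D' where D': "D ** D' = mat 1" "D' ** D = mat 1" using D(1) by (auto simp: invertible_def)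
  have tE: "transpose E ** transpose E' = mat 1" "transpose E' ** transpose E = mat 1"
    using E' by (simp_all flip: matrix_transpose_mul)
  define h' where "h' X = transpose E' ** X ** D'" for X :: "'a^'n^'n"
  have inv: "invertible (transpose E)" "invertible (transpose E')" "invertible D" "invertible D'"
    using tE D' by (auto simp: invertible_def)
  have hh': "h (h' X) = X" for X
  proof -
    have "h (h' X) = (transpose E ** transpose E') ** X ** (D' ** D)"
      by (simp add: h_def h'_def matrix_mul_assoc)
    then show ?thesis by (simp add: tE D')
  qed
  have h'h: "h' (h X) = X" for X
  proof -
    have "h' (h X) = (transpose E' ** transpose E) ** X ** (D ** D')"
      by (simp add: h_def h'_def matrix_mul_assoc)
    then show ?thesis by (simp add: tE D')
  qed
  have pair: "pairing (outer x y) (h X) = pairing (outer (axis i 1) (axis i 1)) X" for X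
  proof -
    have "dot x (h X *v y) = dot (E *v x) (X *v (D *v y))"
      by (simp add: h_def dot_matrix_left matrix_vector_mul_assoc matrix_mul_assoc)
    then show ?thesis using E D by (simp add: pairing_outer)
  qed
  have "bij_betw h {X. invertible X \<and> pairing (outer (axis i 1) (axis i 1)) X = 0}
                   {X. invertible X \<and> pairing (outer x y) X = 0}"
  proof (rule bij_betw_byWitness[where f' = h'])
    show "h ` {X. invertible X \<and> pairing (outer (axis i 1) (axis i 1)) X = 0}
        \<subseteq> {X. invertible X \<and> pairing (outer x y) X = 0}"
      by (auto simp: pair) (simp add: h_def inv invertible_mult)
    show "h' ` {X. invertible X \<and> pairing (outer x y) X = 0}
        \<subseteq> {X. invertible X \<and> pairing (outer (axis i 1) (axis i 1)) X = 0}"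
      by (auto simp: hh' simp flip: pair) (simp add: h'_def inv invertible_mult)
  qed (simp_all add: hh' h'h)
  then show ?thesis unfolding hyperplane_count_def by (rule bij_betw_same_card[symmetric])
qed

lemma hyperplane_count_rank_one:
  fixes A M :: "'a::{field,finite}^'n^'n"
  assumes "rank_one A" "rank_one M"
  shows "hyperplane_count A = hyperplane_count M"
proof -
  have "hyperplane_count C = hyperplane_count (outer (axis undefined 1) (axis undefined 1) :: 'a^'n^'n)"
    if "rank_one C" for C :: "'a^'n^'n"
    using that hyperplane_count_outer_axis unfolding rank_one_def by blast
  then show ?thesis using assms by simp
qed

text \<open>
  This provides the matrix that makes the inequality below strict.  The rows of \<open>X\<close> other than row \<open>i\<close>
  form a basis of the hyperplane orthogonal to \<open>M $ i\<close>.  If the sum vanished for all such bases, then,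
  comparing a basis with the one obtained by adding one of its vectors to another, \<open>M $ j\<close> would be
  orthogonal to all of them and so parallel to \<open>M $ i\<close>.
\<close>
lemma exists_admissible_nonzero_pairing:
  fixes M :: "'a::field^'n^'n"
  assumes j: "j \<noteq> i" and Mi: "M $ i \<noteq> 0" and nonpar: "\<And>c. M $ j \<noteq> c *s M $ i"
  shows "\<exists>X. invertible X \<and> (\<forall>k. k \<noteq> i \<longrightarrow> dot (M $ i) (X $ k) = 0) \<and>
           (\<Sum>k\<in>UNIV - {i}. dot (M $ k) (X $ k)) \<noteq> 0"
proof (rule ccontr)
  define b where "b = M $ i"
  define adm where "adm X \<longleftrightarrow> invertible X \<and> (\<forall>k. k \<noteq> i \<longrightarrow> dot b (X $ k) = 0)" for X :: "'a^'n^'n"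
  define s where "s X = (\<Sum>k\<in>UNIV - {i}. dot (M $ k) (X $ k))" for X :: "'a^'n^'n"
  assume "\<not> ?thesis"
  then have zero: "s X = 0" if "adm X" for X
    using that unfolding adm_def s_def b_def by blast
  obtain X where X: "invertible X" "X *v b = axis i 1"
    using exists_invertible_to_axis[of b i] Mi by (auto simp: b_def)
  have Xb: "dot b (X $ k) = (if k = i then 1 else 0)" for k
  proof -
    have "dot (X $ k) b = axis i 1 $ k" using X(2) by (simp flip: matrix_vector_dot)
    then show ?thesis by (simp add: dot_commute axis_def)
  qed
  have admX: "adm X" using X Xb by (simp add: adm_def)
  define row_add where "row_add Y k l = (\<chi> m. if m = k then Y $ k + Y $ l else Y $ m)"
    for Y :: "'a^'n^'n" and k l
  have adm_add: "adm (row_add Y k l)" if "adm Y" "k \<noteq> i" "l \<noteq> i" "k \<noteq> l" for Y k l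
  proof -
    have "z = 0" if z: "row_add Y k l *v z = 0" for z
    proof -
      have r: "dot (row_add Y k l $ m) z = 0" for m
        using z by (simp flip: matrix_vector_dot)
      have l: "dot (Y $ l) z = 0"
        using r[of l] \<open>k \<noteq> l\<close> by (simp add: row_add_def)
      have "dot (Y $ m) z = 0" for m
        using r[of m] l by (cases "m = k") (simp_all add: row_add_def dot_commute[of _ z] dot_add_right)
      then have "Y *v z = 0" by (simp add: vec_eq_iff matrix_vector_dot)
      then show "z = 0" using \<open>adm Y\<close> by (simp add: adm_def invertible_iff_kernel)
    qed
    then have "invertible (row_add Y k l)" by (simp add: invertible_iff_kernel)
    moreover have "dot b (row_add Y k l $ m) = 0" if "m \<noteq> i" for m
      using that \<open>adm Y\<close> \<open>k \<noteq> i\<close> \<open>l \<noteq> i\<close> by (cases "m = k") (simp_all add: adm_def row_add_def dot_add_right)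
    ultimately show ?thesis by (simp add: adm_def)
  qed
  have s_add: "s (row_add Y k l) = s Y + dot (M $ k) (Y $ l)" if "k \<noteq> i" for Y k l
  proof -
    have "s (row_add Y k l) = (\<Sum>m\<in>UNIV - {i}. dot (M $ m) (Y $ m) + (if m = k then dot (M $ k) (Y $ l) else 0))"
      unfolding s_def by (rule sum.cong) (auto simp: row_add_def dot_add_right)
    then show ?thesis using that by (simp add: s_def sum.distrib)
  qed
  \<comment> \<open>adding row \<open>l\<close> to row \<open>k\<close> does not change the sum, which is always zero\<close>
  have off: "dot (M $ k) (Y $ l) = 0" if "adm Y" "k \<noteq> i" "l \<noteq> i" "k \<noteq> l" for Y k l
    using zero[OF adm_add[OF that]] zero[OF that(1)] s_add[OF that(2), of Y l] by simp
  have Mj: "dot (M $ j) (X $ k) = 0" if k: "k \<noteq> i" for k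
  proof (cases "k = j")
    case False
    then show ?thesis using off[OF admX j k] by simp
  next
    case [simp]: True
    show ?thesis
    proof (cases "\<exists>l. l \<noteq> i \<and> l \<noteq> j")
      case True
      then obtain l where l: "l \<noteq> i" "l \<noteq> j" by blast
      \<comment> \<open>row \<open>l\<close> of \<open>row_add X l j\<close> is the sum of rows \<open>l\<close> and \<open>j\<close> of \<open>X\<close>\<close>
      have "dot (M $ j) (row_add X l j $ l) = 0"
        using off[OF adm_add[OF admX l(1) j l(2)] j l(1)] l by simp
      moreover have "dot (M $ j) (X $ l) = 0"
        using off[OF admX j l(1)] l by simp
      ultimately show ?thesis by (simp add: row_add_def dot_add_right)
    next
      case False
      then have "UNIV - {i} = {j}" using j by auto
      then show ?thesis using zero[OF admX] by (simp add: s_def)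
    qed
  qed
  have "X *v (M $ j - dot (M $ j) (X $ i) *s b) = 0"
  proof -
    have "dot (X $ k) (M $ j - dot (M $ j) (X $ i) *s b) = 0" for k
      using Mj[of k] Xb[of k]
      by (cases "k = i") (simp_all add: dot_diff_right dot_scale_right dot_commute[of "X $ _"])
    then show ?thesis by (simp add: vec_eq_iff matrix_vector_dot)
  qed
  then have "M $ j = dot (M $ j) (X $ i) *s b"
    using X(1) unfolding invertible_iff_kernel by (metis eq_iff_diff_eq_0)
  then show False using nonpar by (simp add: b_def)
qed

text \<open>
  The rank-one matrix on the left is \<open>M\<close> with all rows except row \<open>i\<close> replaced by zero.  Its hyperplane is
  mapped injectively into the hyperplane of \<open>M\<close>: if \<open>X\<close> is nonsingular and row \<open>i\<close> of \<open>X\<close> is orthogonal to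
  \<open>b = M $ i\<close>, some other row of \<open>X\<close> is not, and subtracting a multiple of that row from row \<open>i\<close> corrects
  the value of the pairing.  The correction depends on the other rows only, so it can be undone.  A
  matrix whose rows other than \<open>i\<close> are all orthogonal to \<open>b\<close> is never hit.
\<close>
lemma hyperplane_count_row_less:
  fixes M :: "'a::{field,finite}^'n^'n"
  assumes j: "j \<noteq> i" and Mi: "M $ i \<noteq> 0" and nonpar: "\<And>c. M $ j \<noteq> c *s M $ i"
  shows "hyperplane_count (outer (axis i 1) (M $ i)) < hyperplane_count M"
proof -
  define b where "b = M $ i"
  define s where "s X = (\<Sum>k\<in>UNIV - {i}. dot (M $ k) (X $ k))" for X :: "'a^'n^'n"
  define r where "r X = (SOME k. k \<noteq> i \<and> dot b (X $ k) \<noteq> 0)" for X :: "'a^'n^'n"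
  define F where "F X = (\<chi> k. if k = i then X $ i - (s X / dot b (X $ r X)) *s X $ r X else X $ k)"
    for X :: "'a^'n^'n"
  define S where "S = {X. invertible X \<and> pairing (outer (axis i 1) b) X = 0}"
  define T where "T = {X. invertible X \<and> pairing M X = 0}"
  have S_iff: "X \<in> S \<longleftrightarrow> invertible X \<and> dot b (X $ i) = 0" for X
    by (simp add: S_def pairing_outer dot_commute[of "axis i 1"] dot_axis)
       (simp add: matrix_vector_dot dot_commute)
  have T_iff: "X \<in> T \<longleftrightarrow> invertible X \<and> dot b (X $ i) + s X = 0" for X
    by (simp add: T_def pairing_remove_row[of M X i] s_def b_def)
  have ex_r: "r X \<noteq> i \<and> dot b (X $ r X) \<noteq> 0" if "X \<in> S" for X
  proof -
    have "\<exists>k. k \<noteq> i \<and> dot b (X $ k) \<noteq> 0"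
    proof (rule ccontr)
      assume "\<not> ?thesis"
      then have "dot (X $ k) b = 0" for k
        using that by (cases "k = i") (auto simp: S_iff dot_commute)
      then have "X *v b = 0" by (simp add: vec_eq_iff matrix_vector_dot)
      then show False using that Mi by (auto simp: S_iff invertible_iff_kernel b_def)
    qed
    then show ?thesis unfolding r_def by (rule someI_ex)
  qed
  have F_other: "F X $ k = X $ k" if "k \<noteq> i" for X k using that by (simp add: F_def)
  have sF: "s (F X) = s X" for X
    unfolding s_def by (rule sum.cong) (auto simp: F_other)
  have rF: "r (F X) = r X" for X
    unfolding r_def using F_other by metis
  have F_inv: "invertible (F X)" if "X \<in> S" for X
  proof -
    have "z = 0" if z: "F X *v z = 0" for z
    proof -
      have d: "dot (F X $ m) z = 0" for m
        using z by (simp flip: matrix_vector_dot)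
      have o: "dot z (X $ m) = 0" if "m \<noteq> i" for m
        using d[of m] F_other[OF that] by (simp add: dot_commute)
      have "dot z (X $ i) = 0"
        using d[of i] o ex_r[OF \<open>X \<in> S\<close>]
        by (simp add: F_def dot_commute[of _ z] dot_diff_right dot_scale_right)
      with o have "dot z (X $ m) = 0" for m by (cases "m = i") auto
      then have "X *v z = 0" by (simp add: vec_eq_iff matrix_vector_dot dot_commute)
      then show "z = 0" using \<open>X \<in> S\<close> by (simp add: S_iff invertible_iff_kernel)
    qed
    then show ?thesis by (simp add: invertible_iff_kernel)
  qed
  have F_T: "F X \<in> T" if "X \<in> S" for X
    using that F_inv[OF that] ex_r[OF that] unfolding T_iff sF
    by (simp add: F_def dot_diff_right dot_scale_right S_iff)
  have "inj_on F S"
  proof (rule inj_onI)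
    fix X Y assume "X \<in> S" "Y \<in> S" and eq: "F X = F Y"
    have r: "r X = r Y" and s: "s X = s Y" using rF sF eq by metis+
    have other: "X $ k = Y $ k" if "k \<noteq> i" for k using F_other[OF that] eq by metis
    have "X $ r X = Y $ r Y" using other ex_r[OF \<open>X \<in> S\<close>] r by simp
    moreover have "F X $ i = F Y $ i" using eq by simp
    ultimately have "X $ i = Y $ i" using r s by (simp add: F_def)
    with other show "X = Y" by (metis vec_eq_iff)
  qed
  obtain X where X: "invertible X" "\<And>k. k \<noteq> i \<Longrightarrow> dot b (X $ k) = 0" "s X \<noteq> 0"
    using exists_admissible_nonzero_pairing[OF assms] unfolding s_def b_def by blast
  have bi: "dot b (X $ i) \<noteq> 0"
  proof
    assume "dot b (X $ i) = 0"
    then have "dot (X $ k) b = 0" for k using X(2) by (cases "k = i") (auto simp: dot_commute)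
    then have "X *v b = 0" by (simp add: vec_eq_iff matrix_vector_dot)
    then show False using X Mi by (auto simp: invertible_iff_kernel b_def)
  qed
  define c where "c = - s X / dot b (X $ i)"
  \<comment> \<open>rescaling row \<open>i\<close> puts \<open>X\<close> on the hyperplane of \<open>M\<close> and keeps the rows that the image of \<open>F\<close> excludes\<close>
  define Z where "Z = (\<chi> k. if k = i then c *s X $ i else X $ k)"
  have Z_other: "Z $ k = X $ k" if "k \<noteq> i" for k using that by (simp add: Z_def)
  have sZ: "s Z = s X" unfolding s_def by (rule sum.cong) (auto simp: Z_other)
  have "z = 0" if z: "Z *v z = 0" for z
  proof -
    have d: "dot (Z $ m) z = 0" for m using z by (simp flip: matrix_vector_dot)
    have "c \<noteq> 0" using bi X(3) by (simp add: c_def)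
    then have "dot (X $ m) z = 0" for m
      using d[of m] by (cases "m = i") (simp_all add: Z_def dot_commute[of _ z] dot_scale_right)
    then have "X *v z = 0" by (simp add: vec_eq_iff matrix_vector_dot)
    then show "z = 0" using X(1) by (simp add: invertible_iff_kernel)
  qed
  then have "invertible Z" by (simp add: invertible_iff_kernel)
  moreover have "dot b (Z $ i) = - s X"
  proof -
    have "dot b (Z $ i) = c * dot b (X $ i)" by (simp add: Z_def dot_scale_right)
    then show ?thesis using bi by (simp add: c_def)
  qed
  ultimately have "Z \<in> T" by (simp add: T_iff sZ)
  moreover have "Z \<notin> F ` S"
  proof
    assume "Z \<in> F ` S"
    then obtain Y where Y: "Y \<in> S" "Z = F Y" by blast
    have ry: "r Y \<noteq> i" "dot b (Y $ r Y) \<noteq> 0" using ex_r[OF Y(1)] by auto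
    then show False using Y(2) F_other[OF ry(1), of Y] Z_other[OF ry(1)] X(2)[OF ry(1)] by simp
  qed
  ultimately have "F ` S \<subset> T" using F_T by auto
  then have "card (F ` S) < card T" by (intro psubset_card_mono) auto
  then show ?thesis
    using card_image[OF \<open>inj_on F S\<close>] by (simp add: hyperplane_count_def S_def T_def b_def)
qed

text \<open>
  A nonzero matrix of larger rank has a nonzero row and another row not parallel to it, so by the
  inequality its count exceeds the common count of the rank-one matrices.
\<close>
lemma rank_one_iff_hyperplane_count:
  fixes M A :: "'a::{field,finite}^'n^'n"
  assumes "M \<noteq> 0" "rank_one A"
  shows "rank_one M \<longleftrightarrow> hyperplane_count M = hyperplane_count A"
proof
  assume "rank_one M"
  then show "hyperplane_count M = hyperplane_count A"
    using assms(2) by (rule hyperplane_count_rank_one)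
next
  assume eq: "hyperplane_count M = hyperplane_count A"
  obtain i where Mi: "M $ i \<noteq> 0"
    using assms(1) by (auto simp: vec_eq_iff)
  have ax: "axis i (1::'a) \<noteq> (0 :: 'a^'n)" by (simp add: axis_eq_0_iff)
  show "rank_one M"
  proof (cases "\<exists>j. j \<noteq> i \<and> (\<forall>c. M $ j \<noteq> c *s M $ i)")
    case True
    then obtain j where "j \<noteq> i" "\<And>c. M $ j \<noteq> c *s M $ i" by blast
    then have "hyperplane_count (outer (axis i 1) (M $ i)) < hyperplane_count M"
      using hyperplane_count_row_less Mi by blast
    moreover have "rank_one (outer (axis i 1) (M $ i))"
      using ax Mi unfolding rank_one_def by blast
    then have "hyperplane_count (outer (axis i 1) (M $ i)) = hyperplane_count A"
      using assms(2) by (rule hyperplane_count_rank_one)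
    ultimately show ?thesis using eq by simp
  next
    case False
    have "\<exists>c. M $ j = c *s M $ i" for j
      using False by (cases "j = i") (auto intro: exI[of _ 1])
    then obtain c where c: "\<And>j. M $ j = c j *s M $ i" by metis
    have "M = outer (\<chi> j. c j) (M $ i)"
      unfolding vec_eq_iff outer_def by (subst c) simp
    moreover have "(\<chi> j. c j) \<noteq> 0"
    proof
      assume "(\<chi> j. c j) = 0"
      then have "c i = 0" by (metis vec_lambda_beta zero_index)
      then show False using c[of i] Mi by simp
    qed
    ultimately show ?thesis using Mi unfolding rank_one_def by blast
  qed
qed

section \<open>Semilinear maps over a field\<close>

lemma field_hom_simps:
  assumes "field_hom \<sigma>"
  shows "\<sigma> 0 = 0" "\<sigma> 1 = 1" "\<sigma> (x + y) = \<sigma> x + \<sigma> y" "\<sigma> (x * y) = \<sigma> x * \<sigma> y"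
    "\<sigma> x = 0 \<longleftrightarrow> x = 0" "\<sigma> (sum h S) = (\<Sum>s\<in>S. \<sigma> (h s))"
proof -
  have add: "\<sigma> (x + y) = \<sigma> x + \<sigma> y" and mult: "\<sigma> (x * y) = \<sigma> x * \<sigma> y" and one: "\<sigma> 1 = 1" for x y
    using assms by (auto simp: field_hom_def)
  have zero: "\<sigma> 0 = 0"
    using add[of 0 0] add_cancel_right_right[of "\<sigma> 0" "\<sigma> 0"] by (simp only: add_0_left)
  show "\<sigma> 0 = 0" "\<sigma> 1 = 1" "\<sigma> (x + y) = \<sigma> x + \<sigma> y" "\<sigma> (x * y) = \<sigma> x * \<sigma> y"
    by (fact zero one add mult)+
  show "\<sigma> x = 0 \<longleftrightarrow> x = 0"
  proof
    assume "\<sigma> x = 0"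
    show "x = 0"
    proof (rule ccontr)
      assume "x \<noteq> 0"
      then have "\<sigma> x * \<sigma> (inverse x) = 1" by (simp add: one flip: mult)
      with \<open>\<sigma> x = 0\<close> show False by simp
    qed
  qed (simp add: zero)
  show "\<sigma> (sum h S) = (\<Sum>s\<in>S. \<sigma> (h s))"
    by (induction S rule: infinite_finite_induct) (simp_all add: zero add)
qed

lemma field_aut_simps:
  assumes "field_aut \<sigma>"
  shows "\<sigma> 0 = 0" "\<sigma> 1 = 1" "\<sigma> (x + y) = \<sigma> x + \<sigma> y" "\<sigma> (x * y) = \<sigma> x * \<sigma> y"
    "\<sigma> x = 0 \<longleftrightarrow> x = 0" "\<sigma> (sum h S) = (\<Sum>s\<in>S. \<sigma> (h s))"
    "\<sigma> (inv \<sigma> x) = x" "inv \<sigma> (\<sigma> x) = x"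
  using assms field_hom_simps[of \<sigma>]
  by (auto simp: field_aut_def bij_def surj_f_inv_f inv_f_f)

lemma field_aut_inv:
  assumes "field_aut \<sigma>"
  shows "field_aut (inv \<sigma>)"
proof -
  have b: "bij \<sigma>" using assms by (simp add: field_aut_def)
  note s = field_aut_simps[OF assms]
  have "inv \<sigma> (x + y) = inv \<sigma> x + inv \<sigma> y" for x y
    by (rule inv_f_eq[OF bij_is_inj[OF b]]) (simp add: s)
  moreover have "inv \<sigma> (x * y) = inv \<sigma> x * inv \<sigma> y" for x y
    by (rule inv_f_eq[OF bij_is_inj[OF b]]) (simp add: s)
  moreover have "inv \<sigma> 1 = 1" by (rule inv_f_eq[OF bij_is_inj[OF b]]) (simp add: s)
  ultimately show ?thesis using bij_imp_bij_inv[OF b] by (simp add: field_aut_def field_hom_def)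
qed

lemma field_aut_comp: "field_aut \<sigma> \<Longrightarrow> field_aut \<tau> \<Longrightarrow> field_aut (\<sigma> \<circ> \<tau>)"
  by (simp add: field_aut_def field_hom_def bij_comp)

lemma field_aut_id: "field_aut id"
  by (simp add: field_aut_def field_hom_def)

definition map_vector :: "('a \<Rightarrow> 'b) \<Rightarrow> 'a^'n \<Rightarrow> 'b^'n" where
  "map_vector \<sigma> x = (\<chi> i. \<sigma> (x $ i))"

lemma map_vector_nth [simp]: "map_vector \<sigma> x $ i = \<sigma> (x $ i)"
  by (simp add: map_vector_def)

context
  fixes \<sigma> :: "'a::field \<Rightarrow> 'a"
  assumes \<sigma>: "field_aut \<sigma>"
begin

lemma map_vector_simps:
  "map_vector \<sigma> (x + y) = map_vector \<sigma> x + map_vector \<sigma> y"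
  "map_vector \<sigma> (c *s x) = \<sigma> c *s map_vector \<sigma> x"
  "map_vector \<sigma> 0 = 0"
  by (simp_all add: vec_eq_iff field_aut_simps[OF \<sigma>])

lemma map_vector_inverse:
  "map_vector \<sigma> (map_vector (inv \<sigma>) x) = x" "map_vector (inv \<sigma>) (map_vector \<sigma> x) = x"
  by (simp_all add: vec_eq_iff field_aut_simps[OF \<sigma>])

lemma map_matrix_inverse:
  "map_matrix \<sigma> (map_matrix (inv \<sigma>) X) = X" "map_matrix (inv \<sigma>) (map_matrix \<sigma> X) = X"
  by (simp_all add: vec_eq_iff field_aut_simps[OF \<sigma>])

lemma map_matrix_add: "map_matrix \<sigma> (X + Y) = map_matrix \<sigma> X + map_matrix \<sigma> Y"
  by (simp add: vec_eq_iff field_aut_simps[OF \<sigma>])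

lemma map_matrix_mult: "map_matrix \<sigma> (X ** Y) = map_matrix \<sigma> X ** map_matrix \<sigma> Y"
  by (simp add: vec_eq_iff matrix_matrix_mult_def field_aut_simps[OF \<sigma>])

lemma map_matrix_vector_mult: "map_vector \<sigma> (X *v x) = map_matrix \<sigma> X *v map_vector \<sigma> x"
  by (simp add: vec_eq_iff matrix_vector_mult_def field_aut_simps[OF \<sigma>])

lemma map_matrix_transpose: "map_matrix \<sigma> (transpose X) = transpose (map_matrix \<sigma> X)"
  by (simp add: vec_eq_iff transpose_def)

lemma map_matrix_outer: "map_matrix \<sigma> (outer x y) = outer (map_vector \<sigma> x) (map_vector \<sigma> y)"
  by (simp add: vec_eq_iff outer_def field_aut_simps[OF \<sigma>])

lemma map_matrix_pairing: "\<sigma> (pairing X Y) = pairing (map_matrix \<sigma> X) (map_matrix \<sigma> Y)"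
  by (simp add: pairing_def dot_def field_aut_simps[OF \<sigma>])

lemma map_matrix_mat: "map_matrix \<sigma> (mat 1) = mat 1"
  by (simp add: vec_eq_iff mat_def field_aut_simps[OF \<sigma>])

lemma invertible_map_matrix:
  assumes "invertible X"
  shows "invertible (map_matrix \<sigma> X)"
proof -
  obtain Y where "X ** Y = mat 1" "Y ** X = mat 1" using assms by (auto simp: invertible_def)
  then have "map_matrix \<sigma> X ** map_matrix \<sigma> Y = mat 1" "map_matrix \<sigma> Y ** map_matrix \<sigma> X = mat 1"
    by (simp_all add: map_matrix_mat flip: map_matrix_mult)
  then show ?thesis by (auto simp: invertible_def)
qed

lemma semilinear_matrix:
  fixes g :: "'a^'n \<Rightarrow> 'a^'m"
  assumes add: "\<And>x y. g (x + y) = g x + g y"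
    and scale: "\<And>c x. g (c *s x) = \<sigma> c *s g x"
  obtains P where "\<And>x. g x = P *v map_vector \<sigma> x"
proof -
  define P where "P = (\<chi> i j. g (axis j 1) $ i)"
  have zero: "g 0 = 0" using add[of 0 0] by simp
  have sums: "g (sum h S) = (\<Sum>s\<in>S. g (h s))" for h :: "'n \<Rightarrow> 'a^'n" and S
    by (induction S rule: infinite_finite_induct) (simp_all add: zero add)
  have "g x = P *v map_vector \<sigma> x" for x
  proof -
    have "g x = g (\<Sum>j\<in>UNIV. x $ j *s axis j 1)" by (simp add: basis_expansion)
    also have "\<dots> = (\<Sum>j\<in>UNIV. \<sigma> (x $ j) *s g (axis j 1))" by (simp add: sums scale)
    also have "\<dots> = P *v map_vector \<sigma> x"
      by (simp add: vec_eq_iff matrix_vector_mult_def P_def mult.commute)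
    finally show ?thesis .
  qed
  then show thesis by (rule that)
qed

lemma invertible_semilinear:
  fixes g :: "'a^'n \<Rightarrow> 'a^'n"
  assumes "inj g" and g: "\<And>x. g x = P *v map_vector \<sigma> x"
  shows "invertible P"
proof -
  have "x = 0" if "P *v x = 0" for x
  proof -
    have "g (map_vector (inv \<sigma>) x) = g 0" using that by (simp add: g map_vector_inverse map_vector_simps)
    then have "map_vector (inv \<sigma>) x = 0" using \<open>inj g\<close> by (simp add: inj_eq)
    then show ?thesis by (metis map_vector_inverse(1) map_vector_simps(3))
  qed
  then show ?thesis by (simp add: invertible_iff_kernel)
qed

end

section \<open>Matrices of rank one\<close>

lemma outer_nth: "outer x y $ i $ j = x $ i * y $ j"
  by (simp add: outer_def)

lemma outer_simps:
  "outer (x + x') y = outer x y + outer x' y"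
  "outer x (y + y') = outer x y + outer x y'"
  "outer (c *s x) y = outer x (c *s y)"
  "outer 0 y = 0" "outer x 0 = 0"
  by (simp_all add: vec_eq_iff outer_nth algebra_simps)

lemma transpose_outer: "transpose (outer x y) = outer y x"
  by (simp add: vec_eq_iff outer_nth transpose_def mult.commute)

lemma outer_eq_0_iff: "outer x y = 0 \<longleftrightarrow> x = 0 \<or> y = (0 :: 'a::field^'n)"
  by (auto simp: vec_eq_iff outer_nth)

lemma outer_mult_vector: "outer x y *v z = dot y z *s x"
  by (simp add: vec_eq_iff outer_nth matrix_vector_mult_def dot_def sum_distrib_left mult_ac)

lemma outer_sandwich: "P ** outer x y ** Q = outer (P *v x) (transpose Q *v y)"
  for x y :: "'a::field^'n"
  by (simp add: vec_eq_iff outer_nth matrix_matrix_mult_def matrix_vector_mult_def transpose_def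
      sum_distrib_left sum_distrib_right sum_product mult_ac)

definition parallel :: "'a::field^'n \<Rightarrow> 'a^'n \<Rightarrow> bool" where
  "parallel x y \<longleftrightarrow> (\<exists>c. y = c *s x)"

lemma parallel_sym:
  assumes "parallel x y" "y \<noteq> 0"
  shows "parallel y x"
proof -
  obtain c where c: "y = c *s x" using assms by (auto simp: parallel_def)
  with assms have "c \<noteq> 0" by auto
  then have "x = inverse c *s y" using c by (simp add: vec_eq_iff)
  then show ?thesis by (auto simp: parallel_def)
qed

lemma parallel_trans: "parallel x y \<Longrightarrow> parallel y z \<Longrightarrow> parallel x z"
  by (auto simp: parallel_def vector_smult_assoc)

text \<open>
  A nonzero 2 by 2 minor of the matrix with rows \<open>x\<close> and \<open>y\<close> yields such a vector \<open>z\<close>, supported on the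
  two columns of the minor.
\<close>
lemma separate_nonparallel:
  fixes x y :: "'a::field^'n"
  assumes "\<not> parallel x y"
  shows "\<exists>z. dot x z = 0 \<and> dot y z \<noteq> 0"
proof (cases "x = 0")
  case True
  have "y \<noteq> 0" using assms by (auto simp: parallel_def intro: exI[of _ 0])
  then show ?thesis using dot_eq_zero_iff[of y] True by (auto simp: dot_def)
next
  case False
  then obtain p where p: "x $ p \<noteq> 0" by (auto simp: vec_eq_iff)
  have "y \<noteq> (y $ p / x $ p) *s x" using assms by (auto simp: parallel_def)
  then obtain m where m: "y $ m \<noteq> y $ p / x $ p * x $ m" by (auto simp: vec_eq_iff)
  define z where "z = x $ p *s axis m 1 - x $ m *s (axis p 1 :: 'a^'n)"
  have w: "dot w z = x $ p * w $ m - x $ m * w $ p" for w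
    by (simp add: z_def dot_diff_right dot_scale_right dot_axis)
  have "dot x z = 0" by (simp add: w)
  moreover have "dot y z \<noteq> 0" using m p by (simp add: w field_simps)
  ultimately show ?thesis by blast
qed

lemma outer_eq_parallel:
  fixes x x' y y' :: "'a::field^'n"
  assumes "outer x y = outer x' y'" "x \<noteq> 0" "y \<noteq> 0"
  shows "parallel x' x" "parallel y' y"
proof -
  have gen: "parallel x' x" if eq: "outer x y = outer x' y'" and y: "y \<noteq> 0" for x x' y y' :: "'a^'n"
  proof -
    obtain z where "dot y z \<noteq> 0" using dot_eq_zero_iff[of y] y by blast
    moreover have "dot y z *s x = dot y' z *s x'"
      using arg_cong[OF eq, of "\<lambda>A. A *v z"] by (simp add: outer_mult_vector)
    ultimately have "x = (dot y' z / dot y z) *s x'"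
      by (simp add: vec_eq_iff field_simps)
    then show ?thesis by (auto simp: parallel_def)
  qed
  show "parallel x' x" using gen assms by blast
  have "outer y x = outer y' x'" using assms(1) by (metis transpose_outer)
  then show "parallel y' y" using gen assms by blast
qed

lemma outer_right_cancel:
  fixes x x' y :: "'a::field^'n"
  assumes "outer x y = outer x' y" "y \<noteq> 0"
  shows "x = x'"
proof -
  obtain j where "y $ j \<noteq> 0" using assms by (auto simp: vec_eq_iff)
  moreover have "x $ i * y $ j = x' $ i * y $ j" for i using assms(1) by (metis outer_nth)
  ultimately show ?thesis by (simp add: vec_eq_iff)
qed

lemma outer_left_cancel:
  fixes x y y' :: "'a::field^'n"
  assumes "outer x y = outer x y'" "x \<noteq> 0"
  shows "y = y'"
proof (rule outer_right_cancel[OF _ assms(2)])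
  show "outer y x = outer y' x" using assms(1) by (metis transpose_outer)
qed

text \<open>
  Were neither pair parallel, the sum would have rank two: vectors that are orthogonal to one of
  \<open>y\<close>, \<open>y'\<close> but not to the other show that both \<open>x\<close> and \<open>x'\<close> are multiples of \<open>a\<close>.
\<close>
lemma sum_of_outers_rank_one:
  fixes x y x' y' a b :: "'a::field^'n"
  assumes sum: "outer x y + outer x' y' = outer a b"
    and nz: "x \<noteq> 0" "y \<noteq> 0"
  shows "parallel x x' \<or> parallel y y'"
proof (rule disjCI)
  assume np: "\<not> parallel y y'"
  have app: "dot y z *s x + dot y' z *s x' = dot b z *s a" for z
    using arg_cong[OF sum, of "\<lambda>A. A *v z"]
    by (simp add: matrix_vector_mult_add_rdistrib outer_mult_vector)
  obtain z where z: "dot y z = 0" "dot y' z \<noteq> 0" using separate_nonparallel[OF np] by blast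
  have "\<not> parallel y' y" using parallel_sym nz np by blast
  then obtain w where w: "dot y' w = 0" "dot y w \<noteq> 0" using separate_nonparallel by blast
  have "x' = (dot b z / dot y' z) *s a" using app[of z] z by (simp add: vec_eq_iff field_simps)
  then have "parallel a x'" by (auto simp: parallel_def)
  have "x = (dot b w / dot y w) *s a" using app[of w] w by (simp add: vec_eq_iff field_simps)
  then have "parallel a x" by (auto simp: parallel_def)
  then have "parallel x a" using parallel_sym nz by blast
  then show "parallel x x'" using \<open>parallel a x'\<close> parallel_trans by blast
qed

text \<open>
  Suppose that two members have nonparallel left factors.  Then their right factors are parallel.  The left
  factor of any other nonzero member is not parallel to both, so its right factor is parallel to theirs as
  well.
\<close>
lemma outer_family_common_factor:
  fixes h :: "'b::semigroup_add \<Rightarrow> 'a::field^'n^'n"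
  assumes add: "\<And>y z. h (y + z) = h y + h z"
    and out: "\<And>y. \<exists>a b. h y = outer a b"
  shows "(\<exists>a. \<forall>y. \<exists>b. h y = outer a b) \<or> (\<exists>b. \<forall>y. \<exists>a. h y = outer a b)"
proof (cases "\<forall>y. h y = 0")
  case True
  then show ?thesis using outer_simps(4) by metis
next
  case False
  then obtain y0 where "h y0 \<noteq> 0" by blast
  moreover obtain a0 b0 where h0: "h y0 = outer a0 b0" using out by blast
  ultimately have nz0: "a0 \<noteq> 0" "b0 \<noteq> 0" by (auto simp: outer_simps)
  have par: "parallel a a' \<or> parallel b b'"
    if "h y = outer a b" "h y' = outer a' b'" "a \<noteq> 0" "b \<noteq> 0" for y y' a a' b b'
    using sum_of_outers_rank_one[of a b a' b'] that out[of "y + y'"] add[of y y'] by metis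
  show ?thesis
  proof (cases "\<forall>y. \<exists>b. h y = outer a0 b")
    case True
    then show ?thesis by blast
  next
    case False
    then obtain y1 where y1: "\<And>b. h y1 \<noteq> outer a0 b" by blast
    obtain a1 b1 where h1: "h y1 = outer a1 b1" using out by blast
    have np: "\<not> parallel a0 a" if "h y1 = outer a b" for a b
    proof
      assume "parallel a0 a"
      then obtain c where "a = c *s a0" by (auto simp: parallel_def)
      then show False using y1[of "c *s b"] that by (simp add: outer_simps)
    qed
    obtain c where "b1 = c *s b0"
      using par[OF h0 h1 nz0] np[OF h1] by (auto simp: parallel_def)
    then have h1': "h y1 = outer (c *s a1) b0" using h1 by (simp add: outer_simps)
    have nz1: "c *s a1 \<noteq> 0" using y1[of 0] h1' by (auto simp del: vector_mul_eq_0 simp: outer_simps)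
    have "\<exists>a. h y = outer a b0" for y
    proof (cases "h y = 0")
      case True
      then show ?thesis using outer_simps(4) by metis
    next
      case False
      obtain a2 b2 where h2: "h y = outer a2 b2" using out by blast
      have "a2 \<noteq> 0" using False h2 by (auto simp: outer_simps)
      have "parallel b0 b2"
      proof (rule ccontr)
        assume "\<not> ?thesis"
        then have "parallel a0 a2" "parallel (c *s a1) a2"
          using par[OF h0 h2 nz0] par[OF h1' h2 nz1 nz0(2)] by auto
        then have "parallel a0 (c *s a1)"
          using parallel_sym \<open>a2 \<noteq> 0\<close> parallel_trans by blast
        then show False using np[OF h1'] by blast
      qed
      then obtain d where "b2 = d *s b0" by (auto simp: parallel_def)
      then have "h y = outer (d *s a2) b0" using h2 by (simp add: outer_simps)
      then show ?thesis by blast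
    qed
    then show ?thesis by blast
  qed
qed

section \<open>Semilinear maps that preserve rank one\<close>

text \<open>Matrices are nested vectors, for which \<open>*s\<close> does not denote scalar multiplication.\<close>
definition matrix_scale :: "'a::times \<Rightarrow> 'a^'n^'m \<Rightarrow> 'a^'n^'m" where
  "matrix_scale c X = (\<chi> i. c *s X $ i)"

lemma matrix_scale_nth [simp]: "matrix_scale c X $ i $ j = c * X $ i $ j"
  by (simp add: matrix_scale_def)

lemma matrix_scale_outer: "matrix_scale c (outer x y) = outer (c *s x) y"
  by (simp add: vec_eq_iff outer_nth mult_ac)

lemma matrix_expansion:
  fixes X :: "'a::field^'n^'n"
  shows "X = (\<Sum>i\<in>UNIV. \<Sum>j\<in>UNIV. matrix_scale (X $ i $ j) (outer (axis i 1) (axis j 1)))"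
proof -
  have "(\<Sum>i\<in>UNIV. \<Sum>j\<in>UNIV. matrix_scale (X $ i $ j) (outer (axis i 1) (axis j 1))) $ k $ l = X $ k $ l" for k l
  proof -
    have "(\<Sum>i\<in>UNIV. \<Sum>j\<in>UNIV. matrix_scale (X $ i $ j) (outer (axis i 1) (axis j 1))) $ k $ l
        = (\<Sum>i\<in>UNIV. \<Sum>j\<in>UNIV. if j = l then (if i = k then X $ k $ l else 0) else 0)"
      unfolding sum_component by (intro sum.cong refl) (auto simp: outer_nth axis_def)
    then show ?thesis by simp
  qed
  then show ?thesis by (simp add: vec_eq_iff)
qed

lemma additive_sum:
  fixes h :: "'b::comm_monoid_add \<Rightarrow> 'c::ab_group_add"
  assumes "\<And>x y. h (x + y) = h x + h y"
  shows "h 0 = 0" "h (sum F S) = (\<Sum>s\<in>S. h (F s))"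
proof -
  show z: "h 0 = 0"
    using assms[of 0 0] add_cancel_right_right[of "h 0" "h 0"] by (simp only: add_0_left)
  show "h (sum F S) = (\<Sum>s\<in>S. h (F s))"
    by (induction S rule: infinite_finite_induct) (simp_all add: z assms)
qed

lemma additive_eqI_outer:
  fixes f g :: "'a::field^'n^'n \<Rightarrow> 'c::ab_group_add"
  assumes "\<And>X Y. f (X + Y) = f X + f Y" "\<And>X Y. g (X + Y) = g X + g Y"
    and "\<And>x y. f (outer x y) = g (outer x y)"
  shows "f X = g X"
  by (subst (1 2) matrix_expansion)
     (simp add: additive_sum(2)[of f] additive_sum(2)[of g] assms matrix_scale_outer)

lemma sandwich_add: "P ** (X + Y) ** Q = P ** X ** Q + P ** Y ** (Q :: 'a::field^'n^'n)"
  by (simp add: vec_eq_iff matrix_matrix_mult_def algebra_simps sum.distrib sum_distrib_left)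

context
  fixes \<sigma> :: "'a::{field,finite} \<Rightarrow> 'a" and g :: "'a^'n^'n \<Rightarrow> 'a^'n^'n"
  assumes \<sigma>: "field_aut \<sigma>"
    and add: "\<And>X Y. g (X + Y) = g X + g Y"
    and scale: "\<And>c X. g (matrix_scale c X) = matrix_scale (\<sigma> c) (g X)"
    and inj: "inj g"
    and rank_one: "\<And>X. rank_one X \<Longrightarrow> rank_one (g X)"
begin

lemma preserver_outer: "\<exists>a b. g (outer x y) = outer a b"
proof (cases "outer x y = 0")
  case True
  then show ?thesis using additive_sum(1)[of g, OF add] outer_simps(4) by metis
next
  case False
  then have "x \<noteq> 0" "y \<noteq> 0" by (auto simp: outer_simps)
  then have "rank_one (g (outer x y))" by (intro rank_one) (auto simp: rank_one_def)
  then show ?thesis by (auto simp: rank_one_def)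
qed

lemma preserver_zero_iff: "g X = 0 \<longleftrightarrow> X = 0"
  using inj additive_sum(1)[of g, OF add] by (metis injD)

text \<open>
  Each space \<open>x \<otimes> V\<close> with \<open>x \<noteq> 0\<close> is mapped onto some \<open>a \<otimes> V\<close> or onto some \<open>V \<otimes> b\<close>.  If \<open>x1 \<otimes> V\<close> had an image
  of the first kind only and \<open>x2 \<otimes> V\<close> one of the second kind only, both images would contain the nonzero
  matrix \<open>a \<otimes> b\<close>; but \<open>x1 \<otimes> V\<close> and \<open>x2 \<otimes> V\<close> share a nonzero matrix only if they coincide.
\<close>
lemma preserver_left_or_right:
  "(\<forall>x. \<exists>a. \<forall>y. \<exists>b. g (outer x y) = outer a b) \<or> (\<forall>x. \<exists>b. \<forall>y. \<exists>a. g (outer x y) = outer a b)"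
proof (rule ccontr)
  assume "\<not> ?thesis"
  then obtain x1 x2 where x1: "\<not> (\<exists>b. \<forall>y. \<exists>a. g (outer x1 y) = outer a b)"
    and x2: "\<not> (\<exists>a. \<forall>y. \<exists>b. g (outer x2 y) = outer a b)" by blast
  have dich: "(\<exists>a. \<forall>y. \<exists>b. g (outer x y) = outer a b) \<or> (\<exists>b. \<forall>y. \<exists>a. g (outer x y) = outer a b)" for x
    by (rule outer_family_common_factor) (simp_all add: outer_simps add preserver_outer)
  obtain a where "\<forall>y. \<exists>b. g (outer x1 y) = outer a b" using dich x1 by blast
  then obtain \<beta> where \<beta>: "\<And>y. g (outer x1 y) = outer a (\<beta> y)" by metis
  obtain b where "\<forall>y. \<exists>a. g (outer x2 y) = outer a b" using dich x2 by blast
  then obtain \<alpha> where \<alpha>: "\<And>y. g (outer x2 y) = outer (\<alpha> y) b" by metis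
  have nz: "x1 \<noteq> 0" "x2 \<noteq> 0"
    using x1 x2 outer_simps(4,5) preserver_zero_iff by metis+
  have "\<beta> y = \<beta> y' \<Longrightarrow> y = y'" for y y'
    using \<beta> inj nz outer_left_cancel by (metis injD)
  then have "surj \<beta>" by (simp add: finite_UNIV_inj_surj injI)
  then obtain y1 where y1: "\<beta> y1 = b" by (metis surjD)
  have "\<alpha> y = \<alpha> y' \<Longrightarrow> y = y'" for y y'
    using \<alpha> inj nz outer_left_cancel by (metis injD)
  then have "surj \<alpha>" by (simp add: finite_UNIV_inj_surj injI)
  then obtain y2 where y2: "\<alpha> y2 = a" by (metis surjD)
  have eq: "outer x1 y1 = outer x2 y2" using \<alpha>[of y2] \<beta>[of y1] y1 y2 inj by (metis injD)
  have ax: "axis i (1::'a) \<noteq> (0 :: 'a^'n)" for i by (simp add: axis_eq_0_iff)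
  have "a \<noteq> 0" "b \<noteq> 0"
    using \<alpha>[of "axis undefined 1"] \<beta>[of "axis undefined 1"] nz ax preserver_zero_iff
      outer_eq_0_iff outer_simps(4,5) by metis+
  then have "outer x1 y1 \<noteq> 0" using \<beta>[of y1] y1 preserver_zero_iff outer_eq_0_iff by metis
  then have "y1 \<noteq> 0" by (auto simp: outer_simps)
  then obtain c where "x1 = c *s x2"
    using outer_eq_parallel(1)[OF eq] nz by (auto simp: parallel_def)
  then have "g (outer x1 y) = outer (\<alpha> (c *s y)) b" for y
    using \<alpha> by (simp add: outer_simps)
  then show False using x1 by blast
qed

text \<open>
  Here \<open>g (x \<otimes> y) = \<alpha> x \<otimes> \<beta> x y\<close>.  The work is to see that \<open>\<beta> x\<close> is, up to a scalar that can be moved to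
  \<open>\<alpha> x\<close>, the same map for all \<open>x\<close>.  Then \<open>g\<close> is a tensor product of two semilinear maps.
\<close>
lemma preserver_of_left_type:
  assumes left: "\<And>x. \<exists>a. \<forall>y. \<exists>b. g (outer x y) = outer a b"
  shows "\<exists>P Q. invertible P \<and> invertible Q \<and> (\<forall>X. g X = P ** map_matrix \<sigma> X ** Q)"
proof -
  obtain \<alpha> \<beta> where g: "\<And>x y. g (outer x y) = outer (\<alpha> x) (\<beta> x y)"
    using left by metis
  define x0 :: "'a^'n" where "x0 = axis undefined 1"
  have x0: "x0 \<noteq> 0" by (simp add: x0_def axis_eq_0_iff)
  have g_zero: "g (outer x y) = 0 \<longleftrightarrow> x = 0 \<or> y = 0" for x y
    by (simp add: preserver_zero_iff outer_eq_0_iff)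
  have \<alpha>_nz: "\<alpha> x \<noteq> 0" if "x \<noteq> 0" for x
    using g_zero[of x x0] g[of x x0] that x0 by (auto simp: outer_simps)
  have \<beta>_zero: "\<beta> x y = 0 \<longleftrightarrow> y = 0" if "x \<noteq> 0" for x y
    using g_zero[of x y] that \<alpha>_nz[OF that] by (simp add: g outer_eq_0_iff)
  define \<beta>0 where "\<beta>0 = \<beta> x0"
  have g0: "g (outer x0 y) = outer (\<alpha> x0) (\<beta>0 y)" for y by (simp add: g \<beta>0_def)
  have "\<beta>0 y = \<beta>0 y' \<Longrightarrow> y = y'" for y y'
    using g0 inj x0 outer_left_cancel by (metis injD)
  then have inj0: "inj \<beta>0" by (simp add: injI)
  then have surj0: "surj \<beta>0" by (simp add: finite_UNIV_inj_surj)
  have \<beta>0_zero: "\<beta>0 y = 0 \<longleftrightarrow> y = 0" for y using \<beta>_zero x0 by (simp add: \<beta>0_def)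
  have ex_a: "\<exists>a. \<forall>y. g (outer x y) = outer a (\<beta>0 y)" for x
  proof (cases "parallel x0 x")
    case True
    then obtain c where "x = c *s x0" by (auto simp: parallel_def)
    then have "g (outer x y) = outer (\<sigma> c *s \<alpha> x0) (\<beta>0 y)" for y
      using scale[of c "outer x0 y"] by (simp add: matrix_scale_outer g0)
    then show ?thesis by blast
  next
    case False
    then have "x \<noteq> 0" by (auto simp: parallel_def intro: exI[of _ 0])
    have np: "\<not> parallel (\<alpha> x0) (\<alpha> x)"
    proof
      assume "parallel (\<alpha> x0) (\<alpha> x)"
      then obtain c where c: "\<alpha> x = c *s \<alpha> x0" by (auto simp: parallel_def)
      obtain y' where "\<beta>0 y' = c *s \<beta> x x0" using surj0 by (metis surjD)
      then have "g (outer x x0) = g (outer x0 y')"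
        using g0[of y'] g[of x x0] by (simp add: c outer_simps)
      then have "outer x x0 = outer x0 y'" using inj by (metis injD)
      then show False using outer_eq_parallel(1) \<open>x \<noteq> 0\<close> x0 False by blast
    qed
    have "\<exists>c. \<beta> x y = c *s \<beta>0 y" for y
    proof (cases "y = 0")
      case True
      then show ?thesis using \<beta>_zero[OF \<open>x \<noteq> 0\<close>] by (auto intro: exI[of _ 0])
    next
      case False
      have "outer (\<alpha> x0) (\<beta>0 y) + outer (\<alpha> x) (\<beta> x y) = outer (\<alpha> (x0 + x)) (\<beta> (x0 + x) y)"
        using add[of "outer x0 y" "outer x y"] g[of "x0 + x" y]
        by (simp add: outer_simps(1) g[of x0] g[of x] \<beta>0_def)
      then show ?thesis
        using sum_of_outers_rank_one \<alpha>_nz[OF x0] \<beta>0_zero False np unfolding parallel_def by metis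
    qed
    then obtain c where c: "\<And>y. \<beta> x y = c y *s \<beta>0 y" by metis
    \<comment> \<open>comparing \<open>\<alpha> x0 + c y *s \<alpha> x\<close> with a multiple of \<open>A\<close>, tested on \<open>z\<close> and \<open>w\<close>, shows that \<open>c y\<close> does not depend on \<open>y\<close>\<close>
    obtain z where z: "dot (\<alpha> x0) z = 0" "dot (\<alpha> x) z \<noteq> 0"
      using separate_nonparallel[OF np] by blast
    have "\<not> parallel (\<alpha> x) (\<alpha> x0)" using np parallel_sym \<alpha>_nz[OF x0] by blast
    then obtain w where w: "dot (\<alpha> x) w = 0" "dot (\<alpha> x0) w \<noteq> 0"
      using separate_nonparallel by blast
    define A where "A = \<alpha> (x0 + x)"
    define K where "K = dot (\<alpha> x0) w / dot A w * dot A z / dot (\<alpha> x) z"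
    have cK: "c y = K" if y: "y \<noteq> 0" for y
    proof -
      have "outer (\<alpha> x0 + c y *s \<alpha> x) (\<beta>0 y) = outer A (\<beta> (x0 + x) y)"
        using add[of "outer x0 y" "outer x y"] g[of "x0 + x" y]
        by (simp add: A_def g0 g[of x] c outer_simps(1,3))
      moreover have nz: "\<alpha> x0 + c y *s \<alpha> x \<noteq> 0"
      proof
        assume "\<alpha> x0 + c y *s \<alpha> x = 0"
        then have "dot w (\<alpha> x0 + c y *s \<alpha> x) = 0" by (simp add: dot_def)
        then show False using w by (simp add: dot_add_right dot_scale_right dot_commute)
      qed
      ultimately obtain d where d: "\<alpha> x0 + c y *s \<alpha> x = d *s A"
        using outer_eq_parallel(1) \<beta>0_zero[of y] y unfolding parallel_def by blast
      have "dot (\<alpha> x0) v + c y * dot (\<alpha> x) v = d * dot A v" for v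
        using arg_cong[OF d, of "dot v"] by (simp add: dot_add_right dot_scale_right dot_commute)
      from this[of z] this[of w] have "c y * dot (\<alpha> x) z = d * dot A z" "dot (\<alpha> x0) w = d * dot A w"
        using z w by simp_all
      then show ?thesis using z w by (auto simp: K_def field_simps)
    qed
    have "g (outer x y) = outer (K *s \<alpha> x) (\<beta>0 y)" for y
    proof (cases "y = 0")
      case True
      then have "g (outer x y) = 0" "\<beta>0 y = 0" using g_zero \<beta>0_zero by simp_all
      then show ?thesis by (simp only: outer_simps(5))
    next
      case False
      then show ?thesis using cK by (simp add: g c outer_simps)
    qed
    then show ?thesis by blast
  qed
  then obtain a where a: "\<And>x y. g (outer x y) = outer (a x) (\<beta>0 y)" by metis
  have \<beta>0x0: "\<beta>0 x0 \<noteq> 0" using \<beta>0_zero x0 by simp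
  have ax0: "a x0 \<noteq> 0" using a[of x0 x0] g_zero x0 by (auto simp: outer_simps)
  have a_add: "a (x + x') = a x + a x'" for x x'
    using add[of "outer x x0" "outer x' x0"] outer_right_cancel[OF _ \<beta>0x0]
    by (simp add: a flip: outer_simps(1))
  have a_scale: "a (k *s x) = \<sigma> k *s a x" for k x
    using scale[of k "outer x x0"] outer_right_cancel[OF _ \<beta>0x0]
    by (simp add: a matrix_scale_outer)
  have b_add: "\<beta>0 (x + x') = \<beta>0 x + \<beta>0 x'" for x x'
    using add[of "outer x0 x" "outer x0 x'"] outer_left_cancel[OF _ ax0]
    by (simp add: a flip: outer_simps(2))
  have b_scale: "\<beta>0 (k *s x) = \<sigma> k *s \<beta>0 x" for k x
    using scale[of k "outer x0 x"] outer_left_cancel[OF _ ax0]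
    by (simp add: a matrix_scale_outer outer_simps)
  have "a x = a x' \<Longrightarrow> x = x'" for x x'
    using a[of x x0] a[of x' x0] inj x0 outer_right_cancel by (metis injD)
  then have inja: "inj a" by (simp add: injI)
  obtain P where P: "\<And>x. a x = P *v map_vector \<sigma> x"
    using semilinear_matrix[OF \<sigma> a_add a_scale] by blast
  obtain Q where Q: "\<And>x. \<beta>0 x = Q *v map_vector \<sigma> x"
    using semilinear_matrix[OF \<sigma> b_add b_scale] by blast
  have inv: "invertible P" "invertible (transpose Q)"
    using invertible_semilinear[OF \<sigma> inja P] invertible_semilinear[OF \<sigma> inj0 Q]
    by (simp_all add: invertible_transpose)
  have "g X = P ** map_matrix \<sigma> X ** transpose Q" for X
  proof (rule additive_eqI_outer[where f = g and g = "\<lambda>X. P ** map_matrix \<sigma> X ** transpose Q"])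
    show "P ** map_matrix \<sigma> (X + Y) ** transpose Q
        = P ** map_matrix \<sigma> X ** transpose Q + P ** map_matrix \<sigma> Y ** transpose Q" for X Y
      by (simp add: map_matrix_add[OF \<sigma>] sandwich_add)
  qed (simp_all add: add a map_matrix_outer[OF \<sigma>] outer_sandwich P Q)
  with inv show ?thesis by blast
qed

end

text \<open>
  Composing with transposition reduces maps with \<open>g (x \<otimes> V) = V \<otimes> b\<close> to those with
  \<open>g (x \<otimes> V) = a \<otimes> V\<close>.
\<close>
theorem semilinear_rank_one_preserver:
  fixes g :: "'a::{field,finite}^'n^'n \<Rightarrow> 'a^'n^'n"
  assumes \<sigma>: "field_aut \<sigma>"
    and add: "\<And>X Y. g (X + Y) = g X + g Y"
    and scale: "\<And>c X. g (matrix_scale c X) = matrix_scale (\<sigma> c) (g X)"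
    and inj: "inj g"
    and rank_one: "\<And>X. rank_one X \<Longrightarrow> rank_one (g X)"
  shows "\<exists>P Q. invertible P \<and> invertible Q \<and>
           ((\<forall>X. g X = P ** map_matrix \<sigma> X ** Q) \<or> (\<forall>X. g X = P ** transpose (map_matrix \<sigma> X) ** Q))"
proof -
  have "(\<forall>x. \<exists>a. \<forall>y. \<exists>b. g (outer x y) = outer a b) \<or>
        (\<forall>x. \<exists>b. \<forall>y. \<exists>a. g (outer x y) = outer a b)"
    by (rule preserver_left_or_right[OF \<sigma> add scale inj]) (rule rank_one)
  then show ?thesis
  proof (elim disjE)
    assume "\<forall>x. \<exists>a. \<forall>y. \<exists>b. g (outer x y) = outer a b"
    then have "\<exists>P Q. invertible P \<and> invertible Q \<and> (\<forall>X. g X = P ** map_matrix \<sigma> X ** Q)"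
      by (intro preserver_of_left_type[OF \<sigma> add scale inj rank_one]) auto
    then show ?thesis by blast
  next
    assume right: "\<forall>x. \<exists>b. \<forall>y. \<exists>a. g (outer x y) = outer a b"
    define h where "h X = transpose (g X)" for X
    have t_add: "transpose (X + Y) = transpose X + transpose Y" for X Y :: "'a^'n^'n"
      by (simp add: vec_eq_iff transpose_def)
    have t_scale: "transpose (matrix_scale c X) = matrix_scale c (transpose X)" for c and X :: "'a^'n^'n"
      by (simp add: vec_eq_iff transpose_def)
    have "\<exists>P Q. invertible P \<and> invertible Q \<and> (\<forall>X. h X = P ** map_matrix \<sigma> X ** Q)"
    proof (rule preserver_of_left_type[OF \<sigma>])
      show "inj h" using inj unfolding h_def inj_def by (metis transpose_transpose)
      show "rank_one (h X)" if "rank_one X" for X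
        using rank_one[OF that] unfolding h_def rank_one_def by (metis transpose_outer)
      show "\<exists>a. \<forall>y. \<exists>b. h (outer x y) = outer a b" for x
        using right[rule_format, of x] unfolding h_def by (metis transpose_outer)
    qed (simp_all add: h_def add scale t_add t_scale)
    then obtain P Q where PQ: "invertible P" "invertible Q" "\<And>X. h X = P ** map_matrix \<sigma> X ** Q" by blast
    have "g X = transpose Q ** transpose (map_matrix \<sigma> X) ** transpose P" for X
      using PQ(3)[of X] unfolding h_def
      by (metis matrix_mul_assoc matrix_transpose_mul transpose_transpose)
    then show ?thesis using PQ(1,2) invertible_transpose by blast
  qed
qed

section \<open>Semilinear maps that preserve nonsingularity\<close>

lemma pairing_add_left: "pairing (M + N) X = pairing M X + pairing N X"
  by (simp add: pairing_def dot_def sum.distrib distrib_right)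

lemma pairing_add_right: "pairing M (X + Y) = pairing M X + pairing M Y"
  by (simp add: pairing_def dot_def sum.distrib distrib_left)

lemma pairing_scale_left: "pairing (matrix_scale c M) X = c * pairing M X"
  by (simp add: pairing_def dot_def sum_distrib_left mult_ac)

lemma pairing_scale_right: "pairing M (matrix_scale c X) = c * pairing M X"
  by (simp add: pairing_def dot_def sum_distrib_left mult_ac)

lemma pairing_outer_axis: "pairing M (outer (axis i 1) (axis j 1)) = M $ i $ j"
proof -
  have "pairing M (outer (axis i 1) (axis j 1))
      = (\<Sum>k\<in>UNIV. \<Sum>l\<in>UNIV. if l = j then (if k = i then M $ i $ j else 0) else 0)"
    unfolding pairing_def dot_def by (intro sum.cong refl) (auto simp: outer_nth axis_def)
  then show ?thesis by simp
qed

lemma pairing_commute: "pairing M X = pairing X M"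
  by (simp add: pairing_def dot_def mult.commute)

lemma pairing_eqI:
  assumes "\<And>M. pairing M X = pairing M Y"
  shows "X = Y"
proof -
  have "X $ i $ j = Y $ i $ j" for i j
    using assms[of "outer (axis i 1) (axis j 1)"] pairing_outer_axis pairing_commute by metis
  then show ?thesis by (simp add: vec_eq_iff)
qed

text \<open>
  A finite-field form of Dieudonne's theorem on maps preserving singular matrices.  The adjoint \<open>g\<close> of \<open>f\<close>
  with respect to the pairing satisfies \<open>\<sigma> (pairing (g M) X) = pairing M (f X)\<close>, so \<open>f\<close> maps the hyperplane of
  \<open>g M\<close> to the hyperplane of \<open>M\<close>.  Hence \<open>g\<close> preserves hyperplane counts, so it preserves rank one and has the
  form given above; \<open>f\<close> is the adjoint of \<open>g\<close>.
\<close>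
theorem semilinear_nonsingularity_preserver:
  fixes f :: "'a::{field,finite}^'n^'n \<Rightarrow> 'a^'n^'n"
  assumes \<sigma>: "field_aut \<sigma>"
    and add: "\<And>X Y. f (X + Y) = f X + f Y"
    and scale: "\<And>c X. f (matrix_scale c X) = matrix_scale (\<sigma> c) (f X)"
    and bij: "bij f"
    and nonsing: "\<And>X. invertible (f X) \<longleftrightarrow> invertible X"
  shows "\<exists>P Q. invertible P \<and> invertible Q \<and>
           ((\<forall>X. f X = P ** map_matrix \<sigma> X ** Q) \<or> (\<forall>X. f X = P ** transpose (map_matrix \<sigma> X) ** Q))"
proof -
  note s = field_aut_simps[OF \<sigma>]
  have \<tau>: "field_aut (inv \<sigma>)" by (rule field_aut_inv[OF \<sigma>])
  note t = field_aut_simps[OF \<tau>]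
  define g where "g M = (\<chi> i j. inv \<sigma> (pairing M (f (outer (axis i 1) (axis j 1)))))" for M
  have g: "pairing (g M) X = inv \<sigma> (pairing M (f X))" for M X
  proof -
    have "f X = (\<Sum>i\<in>UNIV. \<Sum>j\<in>UNIV. matrix_scale (\<sigma> (X $ i $ j)) (f (outer (axis i 1) (axis j 1))))"
      by (subst matrix_expansion) (simp add: additive_sum(2)[of f, OF add] scale)
    then have "pairing M (f X) = (\<Sum>i\<in>UNIV. \<Sum>j\<in>UNIV. \<sigma> (X $ i $ j) * pairing M (f (outer (axis i 1) (axis j 1))))"
      by (simp add: additive_sum(2)[of "pairing M", OF pairing_add_right] pairing_scale_right)
    moreover have "g M $ i $ j = inv \<sigma> (pairing M (f (outer (axis i 1) (axis j 1))))" for i j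
      by (simp add: g_def)
    ultimately show ?thesis
      by (simp add: t s pairing_def[of "g M"] dot_def mult.commute)
  qed
  have g_add: "g (M + N) = g M + g N" for M N
    by (simp add: g_def vec_eq_iff pairing_add_left t)
  have g_scale: "g (matrix_scale c M) = matrix_scale (inv \<sigma> c) (g M)" for c M
    by (simp add: g_def vec_eq_iff pairing_scale_left t)
  have g_inj: "inj g"
  proof (rule injI)
    fix M N assume "g M = g N"
    then have "pairing M (f X) = pairing N (f X)" for X
      using g[of M X] g[of N X] s(7) by metis
    then have "pairing X M = pairing X N" for X
      using bij pairing_commute by (metis bij_pointE)
    then show "M = N" by (rule pairing_eqI)
  qed
  have count: "hyperplane_count (g M) = hyperplane_count M" for M
  proof -
    have "f ` {X. invertible X \<and> pairing (g M) X = 0} = {Y. invertible Y \<and> pairing M Y = 0}"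
    proof safe
      fix X assume "invertible X" "pairing (g M) X = 0"
      then show "invertible (f X)" "pairing M (f X) = 0" by (simp_all add: nonsing g t)
    next
      fix Y assume Y: "invertible Y" "pairing M Y = 0"
      obtain X where "Y = f X" using bij by (metis bij_pointE)
      with Y show "Y \<in> f ` {X. invertible X \<and> pairing (g M) X = 0}" by (auto simp: nonsing g t)
    qed
    then have "bij_betw f {X. invertible X \<and> pairing (g M) X = 0} {Y. invertible Y \<and> pairing M Y = 0}"
      using bij by (auto simp: bij_betw_def bij_def intro: inj_on_subset)
    then show ?thesis unfolding hyperplane_count_def by (rule bij_betw_same_card)
  qed
  have "rank_one (g M)" if "rank_one M" for M
  proof -
    have "M \<noteq> 0" using that by (auto simp: rank_one_def outer_eq_0_iff)
    then have "g M \<noteq> 0" using g_inj additive_sum(1)[of g, OF g_add] by (metis injD)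
    then show ?thesis using rank_one_iff_hyperplane_count[OF _ that] count by blast
  qed
  then obtain P Q where inv: "invertible P" "invertible Q" and
    "(\<forall>M. g M = P ** map_matrix (inv \<sigma>) M ** Q) \<or> (\<forall>M. g M = P ** transpose (map_matrix (inv \<sigma>) M) ** Q)"
    using semilinear_rank_one_preserver[OF \<tau> g_add g_scale g_inj] by blast
  define P' Q' where "P' = map_matrix \<sigma> (transpose P)" and "Q' = map_matrix \<sigma> (transpose Q)"
  have inv': "invertible P'" "invertible Q'"
    unfolding P'_def Q'_def using inv by (auto intro!: invertible_map_matrix[OF \<sigma>] invertible_transpose)
  have gs: "pairing M (f X) = \<sigma> (pairing (g M) X)" for M X by (simp add: g s)
  have sand: "\<sigma> (pairing (P ** N ** Q) X) = pairing (map_matrix \<sigma> N) (P' ** map_matrix \<sigma> X ** Q')" for N X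
    by (simp add: pairing_sandwich map_matrix_pairing[OF \<sigma>] map_matrix_mult[OF \<sigma>] P'_def Q'_def)
  from \<open>_ \<or> _\<close> show ?thesis
  proof
    assume "\<forall>M. g M = P ** map_matrix (inv \<sigma>) M ** Q"
    then have "pairing M (f X) = pairing M (P' ** map_matrix \<sigma> X ** Q')" for M X
      by (simp add: gs sand map_matrix_inverse[OF \<sigma>])
    then have "f X = P' ** map_matrix \<sigma> X ** Q'" for X by (rule pairing_eqI)
    then show ?thesis using inv' by blast
  next
    assume "\<forall>M. g M = P ** transpose (map_matrix (inv \<sigma>) M) ** Q"
    then have "pairing M (f X) = pairing M (transpose (P' ** map_matrix \<sigma> X ** Q'))" for M X
      by (simp add: gs sand map_matrix_inverse[OF \<sigma>] map_matrix_transpose[OF \<sigma>] pairing_transpose)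
    then have "f X = transpose (P' ** map_matrix \<sigma> X ** Q')" for X by (rule pairing_eqI)
    then have "f X = transpose Q' ** transpose (map_matrix \<sigma> X) ** transpose P'" for X
      by (simp add: matrix_transpose_mul matrix_mul_assoc)
    then show ?thesis using inv' invertible_transpose by blast
  qed
qed

section \<open>Equivalence of spreads\<close>

lemma semilinear_bij_comp:
  assumes "semilinear_bij \<sigma> s X t Y f" "semilinear_bij \<tau> t Y u Z g"
  shows "semilinear_bij (\<tau> \<circ> \<sigma>) s X u Z (g \<circ> f)"
proof -
  have "f x \<in> Y" if "x \<in> X" for x
    using assms(1) that by (auto simp: semilinear_bij_def bij_betw_def)
  then show ?thesis
    using assms unfolding semilinear_bij_def by (auto intro: bij_betw_trans)
qed

lemma semilinear_bij_inverse:
  assumes f: "semilinear_bij \<sigma> s X t Y f" and \<sigma>: "bij \<sigma>"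
    and add: "\<And>x y. x \<in> X \<Longrightarrow> y \<in> X \<Longrightarrow> x + y \<in> X"
    and scale: "\<And>k x. x \<in> X \<Longrightarrow> s k x \<in> X"
  shows "semilinear_bij (inv \<sigma>) t Y s X (inv_into X f)"
proof -
  have bij: "bij_betw f X Y" using f by (simp add: semilinear_bij_def)
  define g where "g = inv_into X f"
  have g: "g y \<in> X" "f (g y) = y" if "y \<in> Y" for y
    using that bij unfolding g_def by (auto simp: bij_betw_def inv_into_into f_inv_into_f)
  have gf: "g (f x) = x" if "x \<in> X" for x
    using that bij unfolding g_def by (auto simp: bij_betw_def)
  have "g (y + z) = g y + g z" if "y \<in> Y" "z \<in> Y" for y z
  proof -
    have "f (g y + g z) = y + z" using f g that by (simp add: semilinear_bij_def)
    then show ?thesis using gf add g that by metis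
  qed
  moreover have "g (t k y) = s (inv \<sigma> k) (g y)" if "y \<in> Y" for k y
  proof -
    have "f (s (inv \<sigma> k) (g y)) = t k y"
      using f g that \<sigma> by (simp add: semilinear_bij_def bij_is_surj surj_f_inv_f)
    then show ?thesis using gf scale g that by metis
  qed
  ultimately show ?thesis
    using bij_betw_inv_into[OF bij] by (simp add: semilinear_bij_def g_def)
qed

lemma spreads_equivalent_trans:
  assumes "spreads_equivalent s X S t Y S'" "spreads_equivalent t Y S' u Z S''"
  shows "spreads_equivalent s X S u Z S''"
proof -
  obtain \<sigma> f where f: "field_aut \<sigma>" "semilinear_bij \<sigma> s X t Y f" "(\<lambda>T. f ` T) ` S = S'"
    using assms(1) by (auto simp: spreads_equivalent_def)
  obtain \<tau> g where g: "field_aut \<tau>" "semilinear_bij \<tau> t Y u Z g" "(\<lambda>T. g ` T) ` S' = S''"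
    using assms(2) by (auto simp: spreads_equivalent_def)
  have "(\<lambda>T. (g \<circ> f) ` T) ` S = S''" 
    unfolding f(3)[symmetric] g(3)[symmetric] image_image by (simp add: image_comp)
  then show ?thesis
    unfolding spreads_equivalent_def
    using field_aut_comp[OF g(1) f(1)] semilinear_bij_comp[OF f(2) g(2)] by blast
qed

lemma spreads_equivalent_sym:
  assumes "spreads_equivalent s X S t Y S'"
    and "\<And>x y. x \<in> X \<Longrightarrow> y \<in> X \<Longrightarrow> x + y \<in> X" "\<And>k x. x \<in> X \<Longrightarrow> s k x \<in> X"
    and sub: "\<And>T. T \<in> S \<Longrightarrow> T \<subseteq> X"
  shows "spreads_equivalent t Y S' s X S"
proof -
  obtain \<sigma> f where f: "field_aut \<sigma>" "semilinear_bij \<sigma> s X t Y f" "(\<lambda>T. f ` T) ` S = S'"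
    using assms(1) by (auto simp: spreads_equivalent_def)
  have "inj_on f X" using f(2) by (auto simp: semilinear_bij_def bij_betw_def)
  then have "inv_into X f ` f ` T = T" if "T \<in> S" for T
    using sub[OF that] by (rule inv_into_image_cancel)
  then have "(\<lambda>T. inv_into X f ` T) ` S' = S"
    by (auto simp: image_image simp flip: f(3))
  moreover have "semilinear_bij (inv \<sigma>) t Y s X (inv_into X f)"
    using semilinear_bij_inverse[OF f(2)] f(1) assms(2,3) by (simp add: field_aut_def)
  ultimately show ?thesis
    unfolding spreads_equivalent_def using field_aut_inv[OF f(1)] by blast
qed

lemma matrix_mult_add_left: "(A + A') ** D = A ** D + A' ** (D :: 'a::field^'p^'n)"
  by (simp add: vec_eq_iff matrix_matrix_mult_def distrib_right sum.distrib)

section \<open>Semifield spreads and their spread sets\<close>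

definition pair_scale :: "'a::field \<Rightarrow> ('a^'n) \<times> ('a^'n) \<Rightarrow> ('a^'n) \<times> ('a^'n)" where
  "pair_scale c p = (c *s fst p, c *s snd p)"

definition vertical :: "(('a::field^'n) \<times> ('a^'n)) set" where
  "vertical = range (\<lambda>y. (0, y))"

definition graph :: "'a::field^'n^'n \<Rightarrow> (('a^'n) \<times> ('a^'n)) set" where
  "graph A = range (\<lambda>x. (x, A *v x))"

text \<open>
  The spread defined by a spread set \<open>C\<close>, for which \<open>vertical\<close> is the element at infinity.
\<close>
definition spread_of :: "('a::field^'n^'n) set \<Rightarrow> (('a^'n) \<times> ('a^'n)) set set" where
  "spread_of C = insert vertical (graph ` C)"

text \<open>
  For spread sets of semifields this relation amounts to isotopism of the semifields.
\<close>
definition spread_set_equivalent :: "('a::field^'n^'n) set \<Rightarrow> ('a^'n^'n) set \<Rightarrow> bool" where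
  "spread_set_equivalent C C' \<longleftrightarrow>
     (\<exists>\<sigma> P Q. field_aut \<sigma> \<and> invertible P \<and> invertible Q \<and> C' = (\<lambda>A. P ** map_matrix \<sigma> A ** Q) ` C)"

definition difference_closed :: "'b::ab_group_add set \<Rightarrow> bool" where
  "difference_closed C \<longleftrightarrow> 0 \<in> C \<and> (\<forall>x\<in>C. \<forall>y\<in>C. x - y \<in> C)"

lemma difference_closed_add:
  assumes "difference_closed C" "x \<in> C" "y \<in> C"
  shows "x + y \<in> C"
proof -
  have "0 - y \<in> C" using assms by (auto simp only: difference_closed_def)
  then have "x - (0 - y) \<in> C" using assms by (auto simp only: difference_closed_def)
  then show ?thesis by simp
qed

lemma graph_iff: "p \<in> graph A \<longleftrightarrow> snd p = A *v fst p"
  by (cases p) (auto simp: graph_def)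

lemma vertical_iff: "p \<in> vertical \<longleftrightarrow> fst p = 0"
  by (cases p) (auto simp: vertical_def)

lemma graph_inject: "graph A = graph A' \<longleftrightarrow> A = A'"
proof
  assume eq: "graph A = graph A'"
  have "A *v x = A' *v x" for x
  proof -
    have "(x, A *v x) \<in> graph A'" by (simp add: graph_iff flip: eq)
    then show ?thesis by (simp add: graph_iff)
  qed
  then show "A = A'" by (simp add: matrix_eq)
qed simp

lemma graph_neq_vertical: "graph A \<noteq> vertical"
proof
  assume eq: "graph A = vertical"
  have "(axis undefined 1, A *v axis undefined 1) \<in> vertical" by (simp add: graph_iff flip: eq)
  then show False by (simp add: vertical_iff axis_eq_0_iff)
qed

lemma spread_set_equivalent_sym:
  assumes "spread_set_equivalent C C'"
  shows "spread_set_equivalent C' C"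
proof -
  obtain \<sigma> P Q where \<sigma>: "field_aut \<sigma>" and "invertible P" "invertible Q"
    and C': "C' = (\<lambda>A. P ** map_matrix \<sigma> A ** Q) ` C"
    using assms by (auto simp: spread_set_equivalent_def)
  obtain P' where P': "P ** P' = mat 1" "P' ** P = mat 1" using \<open>invertible P\<close> by (auto simp: invertible_def)
  obtain Q' where Q': "Q ** Q' = mat 1" "Q' ** Q = mat 1" using \<open>invertible Q\<close> by (auto simp: invertible_def)
  define \<tau> where "\<tau> = inv \<sigma>"
  have \<tau>: "field_aut \<tau>" using field_aut_inv[OF \<sigma>] by (simp add: \<tau>_def)
  have "map_matrix \<tau> P' ** map_matrix \<tau> (P ** map_matrix \<sigma> A ** Q) ** map_matrix \<tau> Q' = A" for A
  proof -
    have "P' ** (P ** map_matrix \<sigma> A ** Q) ** Q' = (P' ** P) ** map_matrix \<sigma> A ** (Q ** Q')"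
      by (simp add: matrix_mul_assoc)
    also have "\<dots> = map_matrix \<sigma> A" by (simp add: P' Q')
    finally show ?thesis
      by (simp add: \<tau>_def map_matrix_inverse[OF \<sigma>] flip: map_matrix_mult[OF \<tau>[unfolded \<tau>_def]])
  qed
  then have "C = (\<lambda>A. map_matrix \<tau> P' ** map_matrix \<tau> A ** map_matrix \<tau> Q') ` C'"
    by (simp add: C' image_image)
  moreover have "invertible P'" "invertible Q'" using P' Q' by (auto simp: invertible_def)
  ultimately show ?thesis
    unfolding spread_set_equivalent_def using \<tau> invertible_map_matrix[OF \<tau>] by blast
qed

text \<open>
  The map \<open>(x, y) \<mapsto> (Q\<^sup>-\<^sup>1 x\<^sup>\<sigma>, P y\<^sup>\<sigma>)\<close> takes the graph of \<open>A\<close> to the graph of \<open>P A\<^sup>\<sigma> Q\<close>.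
\<close>
lemma spread_set_equivalent_imp_spreads_equivalent:
  assumes "spread_set_equivalent C' C"
  shows "spreads_equivalent pair_scale UNIV (spread_of C') pair_scale UNIV (spread_of C)"
proof -
  obtain \<sigma> P Q where \<sigma>: "field_aut \<sigma>" and inv: "invertible P" "invertible Q"
    and C: "C = (\<lambda>A. P ** map_matrix \<sigma> A ** Q) ` C'"
    using assms by (auto simp: spread_set_equivalent_def)
  obtain Q' where Q': "Q ** Q' = mat 1" "Q' ** Q = mat 1" using inv by (auto simp: invertible_def)
  obtain P' where P': "P ** P' = mat 1" "P' ** P = mat 1" using inv by (auto simp: invertible_def)
  define f where "f p = (Q' *v map_vector \<sigma> (fst p), P *v map_vector \<sigma> (snd p))" for p
  define g where "g p = (map_vector (inv \<sigma>) (Q *v fst p), map_vector (inv \<sigma>) (P' *v snd p))" for p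
  have fg: "f (g p) = p" and gf: "g (f p) = p" for p
    by (simp_all add: f_def g_def map_vector_inverse[OF \<sigma>] matrix_vector_mul_assoc P' Q')
  have bij: "bij f" by (rule o_bij[of g]) (simp_all add: fun_eq_iff fg gf)
  have "semilinear_bij \<sigma> pair_scale UNIV pair_scale UNIV f"
    using bij unfolding semilinear_bij_def
    by (simp add: f_def pair_scale_def map_vector_simps[OF \<sigma>] matrix_vector_right_distrib vec.scale
        matrix_vector_mult_scaleR vector_scalar_commute)
  moreover have "(\<lambda>T. f ` T) ` spread_of C' = spread_of C"
  proof -
    have img: "f ` T = {p. g p \<in> T}" for T
      by (auto simp: fg gf image_iff) (metis fg)
    have z: "map_vector (inv \<sigma>) x = 0 \<longleftrightarrow> x = 0" for x :: "'a^'n"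
      using map_vector_inverse[OF \<sigma>] map_vector_simps(3)[OF \<sigma>] map_vector_simps(3)[OF field_aut_inv[OF \<sigma>]] by metis
    have "f ` vertical = vertical"
      using inv(2) by (auto simp: img vertical_iff g_def z invertible_iff_kernel)
    moreover have "f ` graph A = graph (P ** map_matrix \<sigma> A ** Q)" for A
    proof -
      have "g p \<in> graph A \<longleftrightarrow> p \<in> graph (P ** map_matrix \<sigma> A ** Q)" for p
      proof -
        have "g p \<in> graph A \<longleftrightarrow> P' *v snd p = map_matrix \<sigma> A *v (Q *v fst p)"
          unfolding graph_iff g_def fst_conv snd_conv
          using map_vector_inverse[OF \<sigma>] map_matrix_vector_mult[OF \<sigma>] by metis
        also have "\<dots> \<longleftrightarrow> snd p = P *v (map_matrix \<sigma> A *v (Q *v fst p))"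
          using P' matrix_vector_mul_assoc matrix_vector_mul_lid by metis
        finally show ?thesis by (simp add: graph_iff matrix_vector_mul_assoc matrix_mul_assoc)
      qed
      then show ?thesis by (auto simp: img)
    qed
    ultimately show ?thesis by (simp add: spread_of_def C image_image)
  qed
  ultimately show ?thesis unfolding spreads_equivalent_def using \<sigma> by blast
qed

text \<open>
  Such a map is \<open>(x, y) \<mapsto> (\<alpha> x, \<gamma> x + \<beta> y)\<close> and takes the graph of \<open>A\<close> to the graph of
  \<open>\<gamma>\<alpha>\<^sup>-\<^sup>1 + \<beta>A\<alpha>\<^sup>-\<^sup>1\<close>.  Taking \<open>A = 0\<close> shows that \<open>\<gamma>\<alpha>\<^sup>-\<^sup>1\<close> lies in \<open>C\<close>, and \<open>C\<close> is closed under
  differences, so this summand can be dropped.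
\<close>
lemma spread_set_equivalentI_fixing_vertical:
  fixes f :: "('a::{field,finite}^'n) \<times> ('a^'n) \<Rightarrow> ('a^'n) \<times> ('a^'n)"
  assumes \<sigma>: "field_aut \<sigma>" and f: "semilinear_bij \<sigma> pair_scale UNIV pair_scale UNIV f"
    and img: "(\<lambda>T. f ` T) ` spread_of C' = spread_of C" and vert: "f ` vertical = vertical"
    and C: "difference_closed C" and C': "0 \<in> C'"
  shows "spread_set_equivalent C' C"
proof -
  have bij: "bij f" and add: "f (p + p') = f p + f p'" and scale: "f (pair_scale k p) = pair_scale (\<sigma> k) (f p)" for p p' k
    using f unfolding semilinear_bij_def by blast+
  have inj: "f p = f p' \<longleftrightarrow> p = p'" for p p' using bij by (meson bij_is_inj injD)
  define \<alpha> where "\<alpha> x = fst (f (x, 0))" for x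
  define \<gamma> where "\<gamma> x = snd (f (x, 0))" for x
  define \<beta> where "\<beta> y = snd (f (0, y))" for y
  have fst0: "fst (f (0, y)) = 0" for y
  proof -
    have "f (0, y) \<in> f ` vertical" by (simp add: vertical_iff)
    then show ?thesis by (simp add: vert vertical_iff)
  qed
  have f_eq: "f (x, y) = (\<alpha> x, \<gamma> x + \<beta> y)" for x y
    using add[of "(x, 0)" "(0, y)"] fst0[of y] by (simp add: \<alpha>_def \<gamma>_def \<beta>_def prod_eq_iff)
  have adds: "\<alpha> (x + x') = \<alpha> x + \<alpha> x'" "\<gamma> (x + x') = \<gamma> x + \<gamma> x'" "\<beta> (x + x') = \<beta> x + \<beta> x'" for x x'
    using add[of "(x, 0)" "(x', 0)"] add[of "(0, x)" "(0, x')"] by (simp_all add: \<alpha>_def \<gamma>_def \<beta>_def)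
  have scales: "\<alpha> (k *s x) = \<sigma> k *s \<alpha> x" "\<gamma> (k *s x) = \<sigma> k *s \<gamma> x" "\<beta> (k *s x) = \<sigma> k *s \<beta> x" for k x
    using scale[of k "(x, 0)"] scale[of k "(0, x)"] by (simp_all add: \<alpha>_def \<gamma>_def \<beta>_def pair_scale_def)
  obtain R where R: "\<And>x. \<alpha> x = R *v map_vector \<sigma> x" using semilinear_matrix[OF \<sigma> adds(1) scales(1)] by blast
  obtain G where G: "\<And>x. \<gamma> x = G *v map_vector \<sigma> x" using semilinear_matrix[OF \<sigma> adds(2) scales(2)] by blast
  obtain P where P: "\<And>x. \<beta> x = P *v map_vector \<sigma> x" using semilinear_matrix[OF \<sigma> adds(3) scales(3)] by blast
  have zeros: "\<alpha> 0 = 0" "\<gamma> 0 = 0" "\<beta> 0 = 0" by (simp_all add: R G P map_vector_simps[OF \<sigma>])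
  have "inj \<beta>"
  proof (rule injI)
    fix y y' assume "\<beta> y = \<beta> y'"
    then have "f (0, y) = f (0, y')" by (simp add: f_eq)
    then show "y = y'" by (simp add: inj)
  qed
  have \<alpha>0: "x = 0" if "\<alpha> x = 0" for x
  proof -
    have "f (x, 0) \<in> f ` vertical" using that by (simp add: vert vertical_iff f_eq)
    then show ?thesis by (auto simp: inj vertical_def)
  qed
  have "inj \<alpha>"
  proof (rule injI)
    fix x x' assume "\<alpha> x = \<alpha> x'"
    then have "\<alpha> (x - x') = 0" using adds(1)[of "x - x'" x'] by simp
    then show "x = x'" using \<alpha>0 by fastforce
  qed
  have inv: "invertible R" "invertible P"
    using invertible_semilinear[OF \<sigma> \<open>inj \<alpha>\<close> R] invertible_semilinear[OF \<sigma> \<open>inj \<beta>\<close> P] by blast+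
  obtain Q where Q: "R ** Q = mat 1" "Q ** R = mat 1" using inv by (auto simp: invertible_def)
  have "surj \<alpha>" using \<open>inj \<alpha>\<close> by (simp add: finite_UNIV_inj_surj)
  have graph: "f ` graph A = graph (G ** Q + P ** map_matrix \<sigma> A ** Q)" for A
  proof -
    have "f (x, A *v x) = (\<alpha> x, (G ** Q + P ** map_matrix \<sigma> A ** Q) *v \<alpha> x)" for x
    proof -
      have "(G ** Q + P ** map_matrix \<sigma> A ** Q) *v \<alpha> x
          = (G + P ** map_matrix \<sigma> A) *v ((Q ** R) *v map_vector \<sigma> x)"
        by (simp add: R matrix_vector_mul_assoc matrix_mul_assoc matrix_mult_add_left)
      then show ?thesis
        by (simp add: f_eq Q G P map_matrix_vector_mult[OF \<sigma>] matrix_vector_mult_add_rdistrib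
            matrix_vector_mul_assoc)
    qed
    then have "f ` graph A = (\<lambda>x. (x, (G ** Q + P ** map_matrix \<sigma> A ** Q) *v x)) ` range \<alpha>"
      by (simp add: graph_def image_image)
    then show ?thesis using \<open>surj \<alpha>\<close> by (simp add: graph_def)
  qed
  have C_eq: "A \<in> C \<longleftrightarrow> (\<exists>A'\<in>C'. A = G ** Q + P ** map_matrix \<sigma> A' ** Q)" for A
  proof -
    have "A \<in> C \<longleftrightarrow> graph A \<in> (\<lambda>T. f ` T) ` spread_of C'"
      unfolding img by (auto simp: spread_of_def graph_inject graph_neq_vertical)
    also have "(\<lambda>T. f ` T) ` spread_of C'
        = insert vertical ((\<lambda>A'. graph (G ** Q + P ** map_matrix \<sigma> A' ** Q)) ` C')"
      unfolding spread_of_def image_insert vert image_image graph ..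
    also have "graph A \<in> \<dots> \<longleftrightarrow> (\<exists>A'\<in>C'. A = G ** Q + P ** map_matrix \<sigma> A' ** Q)"
      by (auto simp: graph_inject graph_neq_vertical)
    finally show ?thesis .
  qed
  have map0: "map_matrix \<sigma> 0 = (0 :: 'a^'n^'n)" by (simp add: vec_eq_iff field_aut_simps[OF \<sigma>])
  have "G ** Q \<in> C" using C' by (auto simp: C_eq map0 intro!: bexI[of _ 0])
  have "C = (\<lambda>A. P ** map_matrix \<sigma> A ** Q) ` C'"
  proof (intro equalityI subsetI)
    fix A assume "A \<in> C"
    then have "G ** Q + A \<in> C" using difference_closed_add[OF C \<open>G ** Q \<in> C\<close>] by blast
    then show "A \<in> (\<lambda>A. P ** map_matrix \<sigma> A ** Q) ` C'" by (auto simp: C_eq)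
  next
    fix A assume "A \<in> (\<lambda>A. P ** map_matrix \<sigma> A ** Q) ` C'"
    then have "G ** Q + A \<in> C" by (auto simp: C_eq)
    then have "(G ** Q + A) - G ** Q \<in> C" using C \<open>G ** Q \<in> C\<close> by (simp only: difference_closed_def)
    then show "A \<in> C" by simp
  qed
  moreover have "invertible Q" using Q by (auto simp: invertible_def)
  ultimately show ?thesis unfolding spread_set_equivalent_def using \<sigma> inv by blast
qed

text \<open>
  If \<open>C\<close> is closed under differences, the shears with matrix in \<open>C\<close> fix the element at infinity of \<open>spread_of C\<close> and permute its other elements
  transitively.
\<close>
definition shear :: "'a::field^'n^'n \<Rightarrow> ('a^'n) \<times> ('a^'n) \<Rightarrow> ('a^'n) \<times> ('a^'n)" where
  "shear A p = (fst p, snd p + A *v fst p)"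

lemma shear_inverse: "shear A (shear (- A) p) = p" "shear (- A) (shear A p) = p"
proof -
  have "- A *v x = - (A *v x)" for x
    by (simp add: vec_eq_iff matrix_vector_mult_def sum_negf)
  then show "shear A (shear (- A) p) = p" "shear (- A) (shear A p) = p"
    by (simp_all add: shear_def)
qed

lemma shear_semilinear: "semilinear_bij id pair_scale UNIV pair_scale UNIV (shear A)"
proof -
  have "bij (shear A)" by (rule o_bij[of "shear (- A)"]) (simp_all add: fun_eq_iff shear_inverse)
  then show ?thesis
    by (simp add: semilinear_bij_def shear_def pair_scale_def matrix_vector_right_distrib vec.scale
        vec.scale_right_distrib)
qed

lemma shear_image_iff: "p \<in> shear A ` T \<longleftrightarrow> shear (- A) p \<in> T"
proof
  assume "p \<in> shear A ` T"
  then show "shear (- A) p \<in> T" by (auto simp: shear_inverse)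
next
  assume "shear (- A) p \<in> T"
  then have "shear A (shear (- A) p) \<in> shear A ` T" by (rule imageI)
  then show "p \<in> shear A ` T" by (simp add: shear_inverse)
qed

lemma shear_vertical: "shear A ` vertical = vertical"
  by (rule set_eqI) (simp only: shear_image_iff vertical_iff shear_def fst_conv)

lemma shear_graph:
  fixes A X :: "'a::field^'n^'n"
  shows "shear A ` graph X = graph (X + A)"
proof (rule set_eqI)
  fix p :: "('a^'n) \<times> ('a^'n)"
  have "- A *v fst p = - (A *v fst p)"
    by (simp add: vec_eq_iff matrix_vector_mult_def sum_negf)
  then show "p \<in> shear A ` graph X \<longleftrightarrow> p \<in> graph (X + A)"
    unfolding shear_image_iff graph_iff
    by (simp add: shear_def matrix_vector_mult_add_rdistrib diff_eq_eq)
qed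

lemma shear_spread_of:
  assumes C: "difference_closed C" "A \<in> C"
  shows "(\<lambda>T. shear A ` T) ` spread_of C = spread_of C"
proof -
  have "(\<lambda>X. X + A) ` C = C"
  proof (intro equalityI subsetI)
    fix Y assume "Y \<in> C"
    then have "Y - A \<in> C" using C unfolding difference_closed_def by blast
    then have "(Y - A) + A \<in> (\<lambda>X. X + A) ` C" by (rule imageI)
    then show "Y \<in> (\<lambda>X. X + A) ` C" by simp
  next
    fix Y assume "Y \<in> (\<lambda>X. X + A) ` C"
    then show "Y \<in> C" using difference_closed_add C by blast
  qed
  then have "graph ` C = graph ` (\<lambda>X. X + A) ` C" by simp
  then have "graph ` C = (\<lambda>X. graph (X + A)) ` C" by (simp only: image_image)
  from this[symmetric] show ?thesis
    by (simp only: spread_of_def image_insert shear_vertical shear_graph image_image)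
qed

text \<open>
  If \<open>f\<close> moves the element at infinity to \<open>graph X0\<close>, it can be corrected.  A shear of the target takes
  \<open>graph X0\<close> to some other \<open>graph X1\<close>.  Conjugating by \<open>f\<close> a shear of the source, which fixes its own element at
  infinity, gives an automorphism of the target that fixes \<open>graph X0\<close> and takes \<open>graph X1\<close> to infinity.
  This works for Desarguesian spreads too.
\<close>
theorem spreads_equivalent_imp_spread_set_equivalent:
  fixes C C' :: "('a::{field,finite}^'n^'n) set"
  assumes eq: "spreads_equivalent pair_scale UNIV (spread_of C') pair_scale UNIV (spread_of C)"
    and C: "difference_closed C" "C \<noteq> {0}" and C': "difference_closed C'"
  shows "spread_set_equivalent C' C"
proof -
  obtain \<sigma> f where \<sigma>: "field_aut \<sigma>" and f: "semilinear_bij \<sigma> pair_scale UNIV pair_scale UNIV f"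
    and img: "(\<lambda>T. f ` T) ` spread_of C' = spread_of C"
    using eq by (auto simp: spreads_equivalent_def)
  have 0: "0 \<in> C'" using C' by (simp add: difference_closed_def)
  have bij: "bij f" using f by (simp add: semilinear_bij_def)
  have inv_f: "inv f ` f ` T = T" for T
    using bij by (simp add: bij_is_inj)
  show ?thesis
  proof (cases "f ` vertical = vertical")
    case True
    then show ?thesis by (rule spread_set_equivalentI_fixing_vertical[OF \<sigma> f img _ C(1) 0])
  next
    case False
    have "vertical \<in> spread_of C'" by (simp add: spread_of_def)
    then have "f ` vertical \<in> spread_of C" unfolding img[symmetric] by (rule imageI)
    then obtain X0 where X0: "X0 \<in> C" "f ` vertical = graph X0"
      using False unfolding spread_of_def by blast
    have "\<exists>X1\<in>C. X1 \<noteq> X0"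
    proof (cases "X0 = 0")
      case True
      then show ?thesis using C(2) X0(1) by blast
    next
      case False
      then have "0 \<noteq> X0" by simp
      moreover have "0 \<in> C" using C(1) by (simp add: difference_closed_def)
      ultimately show ?thesis by blast
    qed
    then obtain X1 where X1: "X1 \<in> C" "X1 \<noteq> X0" by blast
    have pre: "\<exists>Y\<in>C'. f ` graph Y = T" if T: "T \<in> spread_of C" "T \<noteq> graph X0" for T
    proof -
      obtain S where S: "S \<in> spread_of C'" "T = f ` S" using T(1) unfolding img[symmetric] by blast
      with T(2) X0(2) have "S \<noteq> vertical" by blast
      with S show ?thesis unfolding spread_of_def by blast
    qed
    obtain Y1 where Y1: "Y1 \<in> C'" "f ` graph Y1 = graph X1"
      using pre[of "graph X1"] X1 unfolding spread_of_def graph_inject by blast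
    obtain Y2 where Y2: "Y2 \<in> C'" "f ` graph Y2 = vertical"
      using pre[of vertical] graph_neq_vertical[of X0] unfolding spread_of_def by blast
    \<comment> \<open>the elements \<open>vertical\<close>, \<open>graph X0\<close>, \<open>graph X1\<close>, \<open>graph Y1\<close>, \<open>graph Y2\<close>, \<open>vertical\<close> are mapped in turn\<close>
    define F where "F = f \<circ> (shear (Y2 - Y1) \<circ> (inv f \<circ> (shear (X1 - X0) \<circ> f)))"
    have inv: "semilinear_bij (inv \<sigma>) pair_scale UNIV pair_scale UNIV (inv f)"
      using semilinear_bij_inverse[OF f] \<sigma> by (simp add: field_aut_def)
    have "\<sigma> \<circ> (id \<circ> (inv \<sigma> \<circ> (id \<circ> \<sigma>))) = \<sigma>"
      by (simp add: fun_eq_iff field_aut_simps[OF \<sigma>])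
    moreover have "semilinear_bij (\<sigma> \<circ> (id \<circ> (inv \<sigma> \<circ> (id \<circ> \<sigma>)))) pair_scale UNIV pair_scale UNIV F"
      unfolding F_def
      by (rule semilinear_bij_comp[OF semilinear_bij_comp[OF semilinear_bij_comp[OF
            semilinear_bij_comp[OF f shear_semilinear] inv] shear_semilinear] f])
    ultimately have F: "semilinear_bij \<sigma> pair_scale UNIV pair_scale UNIV F" by (simp only:)
    have "X1 - X0 \<in> C" "Y2 - Y1 \<in> C'"
      using C(1) C' X0(1) X1(1) Y1(1) Y2(1) unfolding difference_closed_def by blast+
    then have s: "(\<lambda>T. shear (X1 - X0) ` T) ` spread_of C = spread_of C"
        "(\<lambda>T. shear (Y2 - Y1) ` T) ` spread_of C' = spread_of C'"
      using shear_spread_of[OF C(1)] shear_spread_of[OF C'] by blast+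
    have "(\<lambda>T. inv f ` T) ` spread_of C = spread_of C'"
      unfolding img[symmetric] image_image[of "\<lambda>T. inv f ` T"] inv_f by simp
    then have chain: "(\<lambda>T. f ` T) ` (\<lambda>T. shear (Y2 - Y1) ` T) ` (\<lambda>T. inv f ` T) ` (\<lambda>T. shear (X1 - X0) ` T) `
        (\<lambda>T. f ` T) ` spread_of C' = spread_of C"
      by (simp only: s img)
    have "(\<lambda>T. F ` T) ` spread_of C' = spread_of C"
      using chain unfolding F_def image_comp[symmetric] image_image .
    moreover have "F ` vertical = vertical"
    proof -
      have "F ` vertical = f ` shear (Y2 - Y1) ` inv f ` shear (X1 - X0) ` graph X0"
        unfolding F_def image_comp[symmetric] X0(2) ..
      also have "shear (X1 - X0) ` graph X0 = f ` graph Y1" by (simp add: shear_graph Y1)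
      also have "f ` shear (Y2 - Y1) ` inv f ` f ` graph Y1 = vertical"
        by (simp only: inv_f shear_graph Y2(2)) (simp add: Y2(2))
      finally show ?thesis .
    qed
    ultimately show ?thesis by (rule spread_set_equivalentI_fixing_vertical[OF \<sigma> F _ _ C(1) 0])
  qed
qed

section \<open>The trace form\<close>

lemma one_less_card_field: "1 < CARD('a::{field,finite})"
proof -
  have "card {0, 1 :: 'a} \<le> CARD('a)" by (rule card_mono) auto
  then show ?thesis by simp
qed

lemma finite_field_power_card:
  fixes x :: "'k::{field,finite}"
  shows "x ^ CARD('k) = x"
proof (cases "x = 0")
  case False
  have "x * (\<Prod>y\<in>UNIV-{0}. x * y) = x * x ^ (CARD('k) - 1) * \<Prod>(UNIV-{0})"
    by (simp add: prod.distrib mult_ac)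
  also have "x * x ^ (CARD('k) - 1) = x ^ CARD('k)"
    by (metis One_nat_def Suc_pred power_Suc zero_less_card_finite)
  also have "(\<Prod>y\<in>UNIV-{0}. x * y) = (\<Prod>y\<in>UNIV-{0}. y)"
    by (rule prod.reindex_bij_witness[of _ "\<lambda>y. y / x" "\<lambda>y. x * y"]) (use False in auto)
  finally show ?thesis by simp
qed simp

text \<open>
  With \<open>q\<close> elements in the field, \<open>(X + 1)\<^sup>q - X\<^sup>q - 1\<close> vanishes at every element and has degree less than \<open>q\<close>,
  so its coefficients are zero.  This gives additivity of \<open>x \<mapsto> x\<^sup>q\<close> on extension fields without
  writing \<open>q\<close> as a prime power.
\<close>
lemma choose_card_field_eq_0:
  assumes "0 < i" "i < CARD('k)"
  shows "of_nat (CARD('k) choose i) = (0 :: 'k::{field,finite})"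
proof -
  define q where "q = CARD('k)"
  have "q > 1" using assms by (simp add: q_def)
  define p where "p = (\<Sum>j\<in>{1..<q}. monom (of_nat (q choose j) :: 'k) j)"
  have "poly p x = 0" for x
  proof -
    have split: "{..q} = insert 0 (insert q {1..<q})" by auto
    have "x + 1 = (x + 1) ^ q" by (simp add: q_def finite_field_power_card)
    also have "\<dots> = (\<Sum>j\<le>q. of_nat (q choose j) * x ^ j)" by (simp add: binomial_ring)
    also have "\<dots> = 1 + (x ^ q + poly p x)"
      unfolding split using \<open>q > 1\<close> by (simp add: p_def poly_sum poly_monom)
    also have "x ^ q = x" by (simp add: q_def finite_field_power_card)
    finally show ?thesis by simp
  qed
  moreover have "degree p < q"
    unfolding p_def using \<open>q > 1\<close>
    by (intro degree_sum_less) (auto intro: le_less_trans[OF degree_monom_le])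
  ultimately have "p = 0"
    using card_poly_roots_bound[of p] by (cases "p = 0") (auto simp: q_def)
  moreover have "coeff p i = of_nat (q choose i)"
    using assms by (simp add: p_def coeff_sum q_def)
  ultimately show ?thesis by (simp add: q_def)
qed

context
  fixes \<iota> :: "'k::{field,finite} \<Rightarrow> 'l::{field,finite}" and n :: nat
  assumes \<iota>: "field_hom \<iota>" and card_l: "CARD('l) = CARD('k) ^ n"
begin

lemma field_hom_inj: "inj \<iota>"
proof (rule injI)
  fix x y assume "\<iota> x = \<iota> y"
  moreover have "\<iota> x = \<iota> (x - y) + \<iota> y" by (simp flip: field_hom_simps(3)[OF \<iota>])
  ultimately have "\<iota> (x - y) = 0" by simp
  then show "x = y" by (simp add: field_hom_simps[OF \<iota>])
qed

lemma field_hom_of_nat: "\<iota> (of_nat m) = of_nat m"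
  by (induction m) (simp_all add: field_hom_simps[OF \<iota>])

lemma field_hom_power: "\<iota> (x ^ m) = \<iota> x ^ m"
  by (induction m) (simp_all add: field_hom_simps[OF \<iota>])

lemma frobenius_add: "(x + y :: 'l) ^ CARD('k) = x ^ CARD('k) + y ^ CARD('k)"
proof -
  define q where "q = CARD('k)"
  have "q > 1" using one_less_card_field[where 'a = 'k] by (simp add: q_def)
  have "of_nat (q choose j) = (0 :: 'l)" if "j \<in> {1..<q}" for j
    using that choose_card_field_eq_0[where 'k = 'k, of j] field_hom_of_nat[of "q choose j"]
    by (simp add: q_def field_hom_simps[OF \<iota>])
  moreover have split: "{..q} = insert 0 (insert q {1..<q})" by auto
  ultimately show ?thesis
    unfolding q_def[symmetric] binomial_ring split using \<open>q > 1\<close> by (simp add: add.commute)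
qed

lemma frobenius_power_add: "(x + y :: 'l) ^ (CARD('k) ^ i) = x ^ (CARD('k) ^ i) + y ^ (CARD('k) ^ i)"
  by (induction i arbitrary: x y) (simp_all add: power_mult frobenius_add)

lemma small_field_power: "\<iota> x ^ (CARD('k) ^ i) = \<iota> x"
  by (induction i) (simp_all add: power_mult finite_field_power_card flip: field_hom_power)

text \<open>
  The polynomial \<open>X\<^sup>q - X\<close> has at most \<open>q\<close> roots, and the \<open>q\<close> elements of the small field are roots.
\<close>
lemma fixed_by_frobenius_in_range:
  assumes "x ^ CARD('k) = x"
  shows "x \<in> range \<iota>"
proof -
  define q where "q = CARD('k)"
  have "q > 1" using one_less_card_field[where 'a = 'k] by (simp add: q_def)
  define p :: "'l poly" where "p = monom 1 q - monom 1 1"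
  have "coeff p q = 1" using \<open>q > 1\<close> by (simp add: p_def)
  then have "p \<noteq> 0" by auto
  have "degree p \<le> q"
    unfolding p_def using \<open>q > 1\<close> by (intro degree_diff_le order.trans[OF degree_monom_le]) auto
  then have "card {x. poly p x = 0} \<le> q" using card_poly_roots_bound[OF \<open>p \<noteq> 0\<close>] by simp
  also have "q = card (range \<iota>)" by (simp add: q_def card_image field_hom_inj)
  finally have "card {x. poly p x = 0} \<le> card (range \<iota>)" .
  moreover have "range \<iota> \<subseteq> {x. poly p x = 0}"
    using small_field_power[of _ 1] by (auto simp: p_def poly_monom q_def)
  ultimately have "range \<iota> = {x. poly p x = 0}" by (intro card_seteq) auto
  then show ?thesis using assms by (simp add: p_def poly_monom q_def)
qed

lemma field_trace_add: "field_trace CARD('k) n (x + y :: 'l) = field_trace CARD('k) n x + field_trace CARD('k) n y"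
  by (simp add: field_trace_def frobenius_power_add sum.distrib)

lemma field_trace_scale: "field_trace CARD('k) n (\<iota> k * (x :: 'l)) = \<iota> k * field_trace CARD('k) n x"
  by (simp add: field_trace_def power_mult_distrib small_field_power sum_distrib_left)

lemma field_trace_in_range: "field_trace CARD('k) n (x :: 'l) \<in> range \<iota>"
proof (rule fixed_by_frobenius_in_range)
  have sums: "(sum h S) ^ CARD('k) = (\<Sum>s\<in>S. h s ^ CARD('k))" for h :: "nat \<Rightarrow> 'l" and S
    by (induction S rule: infinite_finite_induct) (simp_all add: frobenius_add)
  have "field_trace CARD('k) n x ^ CARD('k) + x = (\<Sum>i<n. x ^ (CARD('k) ^ Suc i)) + x"
    by (simp add: field_trace_def sums mult.commute flip: power_mult)
  also have "\<dots> = (\<Sum>i<Suc n. x ^ (CARD('k) ^ i))"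
    by (subst sum.lessThan_Suc_shift) (simp add: add.commute)
  also have "\<dots> = field_trace CARD('k) n x + x ^ CARD('l)" by (simp add: field_trace_def card_l)
  finally show "field_trace CARD('k) n x ^ CARD('k) = field_trace CARD('k) n x" by (simp add: finite_field_power_card)
qed

text \<open>
  The trace is a nonzero polynomial function of degree less than the size of the field.
\<close>
lemma field_trace_nonzero: "\<exists>x :: 'l. field_trace CARD('k) n x \<noteq> 0"
proof (rule ccontr)
  assume "\<not> ?thesis"
  then have zero: "field_trace CARD('k) n x = 0" for x :: 'l by blast
  define q where "q = CARD('k)"
  have q: "q > 1" using one_less_card_field[where 'a = 'k] by (simp add: q_def)
  have "n \<noteq> 0" using one_less_card_field[where 'a = 'l] by (cases "n = 0") (auto simp: card_l)
  define p :: "'l poly" where "p = (\<Sum>i<n. monom 1 (q ^ i))"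
  have "coeff p 1 = (\<Sum>i<n. if i = 0 then 1 else 0)"
    unfolding p_def coeff_sum by (intro sum.cong refl) (use q in \<open>auto simp: coeff_monom\<close>)
  then have "coeff p 1 = 1" using \<open>n \<noteq> 0\<close> by simp
  then have "p \<noteq> 0" by auto
  have "degree p < q ^ n"
    unfolding p_def using q
    by (intro degree_sum_less) (auto intro!: le_less_trans[OF degree_monom_le] power_strict_increasing)
  moreover have "poly p x = 0" for x
    using zero[of x] by (simp add: p_def poly_sum poly_monom field_trace_def q_def)
  then have "CARD('l) \<le> degree p" using card_poly_roots_bound[OF \<open>p \<noteq> 0\<close>] by simp
  ultimately show False by (simp add: card_l q_def)
qed

lemma b_eps_add_left:
  fixes u u' v v' :: "'l^2"
  shows "b_eps CARD('k) n (u + u') v = b_eps CARD('k) n u v + b_eps CARD('k) n u' v"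
proof -
  have "(u + u') $ 1 * v $ 2 - (u + u') $ 2 * v $ 1 = (u $ 1 * v $ 2 - u $ 2 * v $ 1) + (u' $ 1 * v $ 2 - u' $ 2 * v $ 1)"
    by (simp add: algebra_simps)
  then show ?thesis unfolding b_eps_def by (simp only: field_trace_add)
qed

lemma b_eps_add_right:
  fixes u u' v v' :: "'l^2"
  shows "b_eps CARD('k) n u (v + v') = b_eps CARD('k) n u v + b_eps CARD('k) n u v'"
proof -
  have "u $ 1 * (v + v') $ 2 - u $ 2 * (v + v') $ 1 = (u $ 1 * v $ 2 - u $ 2 * v $ 1) + (u $ 1 * v' $ 2 - u $ 2 * v' $ 1)"
    by (simp add: algebra_simps)
  then show ?thesis unfolding b_eps_def by (simp only: field_trace_add)
qed

lemma b_eps_scale_left: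
  fixes u u' v v' :: "'l^2"
  shows "b_eps CARD('k) n (kscale \<iota> k u) v = \<iota> k * b_eps CARD('k) n u v"
  by (simp add: b_eps_def kscale_def algebra_simps flip: field_trace_scale)

lemma b_eps_scale_right:
  fixes u u' v v' :: "'l^2"
  shows "b_eps CARD('k) n u (kscale \<iota> k v) = \<iota> k * b_eps CARD('k) n u v"
  by (simp add: b_eps_def kscale_def algebra_simps flip: field_trace_scale)

lemma b_eps_nondegenerate:
  fixes v :: "'l^2"
  assumes "\<And>u. b_eps CARD('k) n u v = 0"
  shows "v = 0"
proof -
  obtain t :: 'l where t: "field_trace CARD('k) n t \<noteq> 0" using field_trace_nonzero by blast
  have "v $ 2 = 0"
  proof (rule ccontr)
    assume "v $ 2 \<noteq> 0"
    then have "b_eps CARD('k) n (vector [t / v $ 2, 0]) v = field_trace CARD('k) n t" by (simp add: b_eps_def)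
    then show False using assms t by simp
  qed
  moreover have "v $ 1 = 0"
  proof (rule ccontr)
    assume "v $ 1 \<noteq> 0"
    then have "b_eps CARD('k) n (vector [0, - t / v $ 1]) v = field_trace CARD('k) n t" by (simp add: b_eps_def)
    then show False using assms t by simp
  qed
  ultimately show ?thesis by (simp add: vec_eq_iff forall_2)
qed

section \<open>The dual spread\<close>

text \<open>
  For the alternating form \<open>x\<cdot>y' - y\<cdot>x'\<close> on pairs, the orthogonal space of a graph is the graph of the
  transpose.
\<close>
lemma perp_graph:
  fixes A :: "'k^'n^'n"
  shows "(\<forall>p\<in>graph A. dot (fst p) y - dot (snd p) x = 0) \<longleftrightarrow> (x, y) \<in> graph (transpose A)"
proof -
  have "dot z y - dot (A *v z) x = dot (y - transpose A *v x) z" for z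
    by (simp add: dot_matrix_left dot_diff_right dot_commute[of "y - _" z] del: transpose_matrix_vector)
  moreover have "(\<forall>p\<in>graph A. dot (fst p) y - dot (snd p) x = 0)
      \<longleftrightarrow> (\<forall>z. dot z y - dot (A *v z) x = 0)"
    by (auto simp: graph_def)
  ultimately have "(\<forall>p\<in>graph A. dot (fst p) y - dot (snd p) x = 0)
      \<longleftrightarrow> (\<forall>z. dot (y - transpose A *v x) z = 0)"
    by (simp only:)
  then show ?thesis by (simp add: dot_eq_zero_iff graph_iff del: transpose_matrix_vector)
qed

lemma perp_vertical:
  fixes x y :: "'k^'n"
  shows "(\<forall>p\<in>vertical. dot (fst p) y - dot (snd p) x = 0) \<longleftrightarrow> (x, y) \<in> vertical"
proof -
  have "(\<forall>p\<in>vertical. dot (fst p) y - dot (snd p) x = 0) \<longleftrightarrow> (\<forall>z. dot x z = 0)"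
    by (auto simp: vertical_def dot_commute) (simp_all add: dot_def)
  then show ?thesis by (simp add: dot_eq_zero_iff vertical_iff)
qed

text \<open>
  Transported along \<open>h\<close>, the trace form becomes a nondegenerate bilinear form \<open>bk\<close>.  It differs from the
  form \<open>x\<cdot>y' - y\<cdot>x'\<close> by a linear bijection \<open>g\<close> in the second argument, so dualizing with \<open>bk\<close> or with the
  standard form gives equivalent spreads.
\<close>
theorem dual_spread_equivalent:
  fixes h :: "('k^'n) \<times> ('k^'n) \<Rightarrow> 'l^2" and C :: "('k^'n^'n) set"
  assumes h: "semilinear_bij id pair_scale UNIV (kscale \<iota>) UNIV h"
  shows "spreads_equivalent pair_scale UNIV (spread_of (transpose ` C))
           (kscale \<iota>) UNIV (dual_spread CARD('k) n ((\<lambda>T. h ` T) ` spread_of C))"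
proof -
  have h_bij: "bij h" and h_add: "h (p + p') = h p + h p'"
    and h_scale: "h (pair_scale k p) = kscale \<iota> k (h p)" for p p' k
    using h unfolding semilinear_bij_def id_apply by blast+
  define bk where "bk p p' = inv \<iota> (b_eps CARD('k) n (h p) (h p'))" for p p'
  have bk: "\<iota> (bk p p') = b_eps CARD('k) n (h p) (h p')" for p p'
    unfolding bk_def b_eps_def by (rule f_inv_into_f[OF field_trace_in_range])
  have bk_add: "bk (p + p') r = bk p r + bk p' r" "bk r (p + p') = bk r p + bk r p'" for p p' r
    by (rule injD[OF field_hom_inj],
        simp add: bk h_add b_eps_add_left b_eps_add_right field_hom_simps[OF \<iota>])+
  have bk_scale: "bk (pair_scale k p) r = k * bk p r" "bk r (pair_scale k p) = k * bk r p" for k p r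
    by (rule injD[OF field_hom_inj],
        simp add: bk h_scale b_eps_scale_left b_eps_scale_right field_hom_simps[OF \<iota>])+
  define g where "g r = (- (\<chi> i. bk (0, axis i 1) r), \<chi> i. bk (axis i 1, 0) r)" for r
  have g: "bk p r = dot (fst p) (snd (g r)) - dot (snd p) (fst (g r))" for p r
  proof -
    have sum: "bk (sum F S) r = (\<Sum>s\<in>S. bk (F s) r)" for F :: "'n \<Rightarrow> ('k^'n) \<times> ('k^'n)" and S
      by (rule additive_sum(2)[of "\<lambda>p. bk p r", OF bk_add(1)])
    have fsum: "(sum F S, 0) = (\<Sum>s\<in>S. (F s, 0 :: 'k^'n))" "(0 :: 'k^'n, sum F S) = (\<Sum>s\<in>S. (0, F s))"
      for F :: "'n \<Rightarrow> 'k^'n" and S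
      by (simp_all add: prod_eq_iff fst_sum snd_sum)
    have left: "bk (x, 0) r = (\<Sum>i\<in>UNIV. x $ i * bk (axis i 1, 0) r)" for x
    proof -
      have "bk (x, 0) r = bk (\<Sum>i\<in>UNIV. pair_scale (x $ i) (axis i 1, 0)) r"
        by (simp add: pair_scale_def basis_expansion flip: fsum)
      then show ?thesis by (simp add: sum bk_scale)
    qed
    have right: "bk (0, y) r = (\<Sum>i\<in>UNIV. y $ i * bk (0, axis i 1) r)" for y
    proof -
      have "bk (0, y) r = bk (\<Sum>i\<in>UNIV. pair_scale (y $ i) (0, axis i 1)) r"
        by (simp add: pair_scale_def basis_expansion flip: fsum)
      then show ?thesis by (simp add: sum bk_scale)
    qed
    have "bk p r = bk (fst p, 0) r + bk (0, snd p) r" by (simp flip: bk_add(1))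
    then show ?thesis using left[of "fst p"] right[of "snd p"] by (simp add: g_def dot_def sum_negf)
  qed
  have g_add: "g (r + r') = g r + g r'" for r r' by (simp add: g_def bk_add vec_eq_iff)
  have g_scale: "g (pair_scale k r) = pair_scale k (g r)" for k r
    by (simp add: g_def pair_scale_def[of k "(_, _)"] bk_scale vec_eq_iff)
  have "inj g"
  proof (rule injI)
    fix r r' assume eq: "g r = g r'"
    have "h (r - r') = 0"
    proof (rule b_eps_nondegenerate)
      fix u
      obtain p where p: "u = h p" using h_bij by (metis bij_pointE)
      have "g (r - r') + g r' = g r" by (simp flip: g_add)
      then have "g (r - r') = 0" using eq by simp
      then have "bk p (r - r') = 0" by (simp add: g dot_def)
      then show "b_eps CARD('k) n u (h (r - r')) = 0" using bk[of p "r - r'"] by (simp add: p field_hom_simps[OF \<iota>])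
    qed
    moreover have "h 0 = 0" by (rule additive_sum(1)[OF h_add])
    ultimately have "r - r' = 0" using h_bij by (metis bij_pointE)
    then show "r = r'" by simp
  qed
  then have g_bij: "bij g" by (simp add: bij_def finite_UNIV_inj_surj)
  have g_semi: "semilinear_bij id pair_scale UNIV pair_scale UNIV g"
    using g_bij by (simp add: semilinear_bij_def g_add g_scale)
  have semi: "semilinear_bij (id \<circ> inv id) pair_scale UNIV (kscale \<iota>) UNIV (h \<circ> inv g)"
    by (rule semilinear_bij_comp[OF semilinear_bij_inverse[OF g_semi] h]) simp_all
  have perp: "{v. \<forall>u\<in>h ` T. b_eps CARD('k) n u v = 0} = (h \<circ> inv g) ` T'"
    if T': "\<And>x y. (x, y) \<in> T' \<longleftrightarrow> (\<forall>p\<in>T. dot (fst p) y - dot (snd p) x = 0)" for T T'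
  proof -
    have iff: "(\<forall>u\<in>h ` T. b_eps CARD('k) n u (h r) = 0) \<longleftrightarrow> g r \<in> T'" for r
    proof -
      have "b_eps CARD('k) n (h p) (h r) = 0 \<longleftrightarrow> bk p r = 0" for p
        by (simp add: field_hom_simps[OF \<iota>] flip: bk)
      then show ?thesis using T'[of "fst (g r)" "snd (g r)"] by (simp add: g)
    qed
    show ?thesis
    proof (intro equalityI subsetI)
      fix v assume v: "v \<in> {v. \<forall>u\<in>h ` T. b_eps CARD('k) n u v = 0}"
      obtain r where r: "v = h r" using h_bij by (metis bij_pointE)
      have "v = (h \<circ> inv g) (g r)" using g_bij by (simp add: r bij_is_inj)
      moreover have "g r \<in> T'" using v iff r by blast
      ultimately show "v \<in> (h \<circ> inv g) ` T'" by (rule image_eqI)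
    next
      fix v assume "v \<in> (h \<circ> inv g) ` T'"
      then obtain p where p: "p \<in> T'" "v = h (inv g p)" by auto
      have "g (inv g p) \<in> T'" using g_bij p by (simp add: bij_is_surj surj_f_inv_f)
      then show "v \<in> {v. \<forall>u\<in>h ` T. b_eps CARD('k) n u v = 0}" using iff p by blast
    qed
  qed
  have "{v. \<forall>u\<in>h ` vertical. b_eps CARD('k) n u v = 0} = (h \<circ> inv g) ` vertical"
    by (rule perp) (rule perp_vertical[symmetric])
  moreover have "{v. \<forall>u\<in>h ` graph A. b_eps CARD('k) n u v = 0} = (h \<circ> inv g) ` graph (transpose A)" for A
    by (rule perp) (rule perp_graph[symmetric])
  ultimately have "(\<lambda>T. (h \<circ> inv g) ` T) ` spread_of (transpose ` C)
      = dual_spread CARD('k) n ((\<lambda>T. h ` T) ` spread_of C)"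
    by (simp only: spread_of_def dual_spread_def image_insert image_image)
  moreover have "id \<circ> inv id = (id :: 'k \<Rightarrow> 'k)" by simp
  with semi have "semilinear_bij id pair_scale UNIV (kscale \<iota>) UNIV (h \<circ> inv g)" by (simp only:)
  ultimately show ?thesis
    unfolding spreads_equivalent_def using field_aut_id by blast
qed

end

section \<open>Coordinates on finite vector spaces\<close>

context
  fixes s :: "'k::{field,finite} \<Rightarrow> 'v::{ab_group_add,finite} \<Rightarrow> 'v"
  assumes vs: "vector_space s"
begin

interpretation V: vector_space s by (fact vs)

text \<open>
  Adding a vector \<open>b\<close> outside a subspace multiplies the number of elements by that of the field, since
  \<open>(k, x) \<mapsto> k b + x\<close> is injective.
\<close>
lemma card_span_independent:
  assumes "\<not> V.dependent S"
  shows "card (V.span S) = CARD('k) ^ card S"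
proof -
  have "finite S" by simp
  then show ?thesis using assms
  proof (induction S rule: finite_induct)
    case empty
    then show ?case by simp
  next
    case (insert b S)
    have b: "b \<notin> V.span S" "\<not> V.dependent S"
      using insert.prems insert.hyps V.independent_insert[of b S] by auto
    define h where "h = (\<lambda>(k, x). s k b + x)"
    have "inj_on h (UNIV \<times> V.span S)"
    proof (rule inj_onI)
      fix p p' assume "p \<in> UNIV \<times> V.span S" "p' \<in> UNIV \<times> V.span S" and eq: "h p = h p'"
      then obtain k x k' x' where p: "p = (k, x)" "p' = (k', x')" "x \<in> V.span S" "x' \<in> V.span S"
        by auto
      have diff: "s (k - k') b = x' - x"
        using eq by (simp add: h_def p V.scale_left_diff_distrib algebra_simps)
      have "k = k'"
      proof (rule ccontr)
        assume "k \<noteq> k'"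
        then have "b = s (inverse (k - k')) (x' - x)" by (simp flip: diff)
        moreover have "s (inverse (k - k')) (x' - x) \<in> V.span S"
          using p by (intro V.span_scale V.span_diff)
        ultimately show False using b by simp
      qed
      then show "p = p'" using eq by (simp add: h_def p)
    qed
    moreover have "h ` (UNIV \<times> V.span S) = V.span (insert b S)"
    proof (intro equalityI subsetI)
      fix y assume "y \<in> h ` (UNIV \<times> V.span S)"
      then obtain k x where "y = s k b + x" "x \<in> V.span S" by (auto simp: h_def)
      then show "y \<in> V.span (insert b S)"
        unfolding V.span_breakdown_eq by (intro exI[of _ k]) simp
    next
      fix y assume "y \<in> V.span (insert b S)"
      then obtain k where "y - s k b \<in> V.span S" unfolding V.span_breakdown_eq by blast
      then have "h (k, y - s k b) \<in> h ` (UNIV \<times> V.span S)" by (intro imageI) simp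
      then show "y \<in> h ` (UNIV \<times> V.span S)" by (simp add: h_def)
    qed
    ultimately have "card (V.span (insert b S)) = card ((UNIV :: 'k set) \<times> V.span S)"
      using card_image by metis
    then show ?case using insert b by (simp add: card_cartesian_product)
  qed
qed

lemma card_subspace:
  assumes "V.subspace W"
  shows "card W = CARD('k) ^ V.dim W"
proof -
  obtain S where S: "S \<subseteq> W" "\<not> V.dependent S" "W \<subseteq> V.span S" "card S = V.dim W"
    using V.basis_exists[of W] by metis
  then have "V.span S = W" using assms V.span_minimal by blast
  then show ?thesis using card_span_independent[OF S(2)] S(4) by simp
qed

text \<open>
  Extend a basis of \<open>W\<close> to a basis of the whole space and take the coordinates with respect to the
  added vectors.  The hypothesis on cardinalities says that there are \<open>CARD('n)\<close> of them.
\<close>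
lemma exists_coordinates_modulo_subspace:
  assumes W: "V.subspace W" and card: "card W * CARD('k) ^ CARD('n) = CARD('v)"
  shows "\<exists>w :: 'v \<Rightarrow> 'k^'n::finite. (\<forall>x y. w (x + y) = w x + w y) \<and> (\<forall>k x. w (s k x) = k *s w x) \<and>
           (\<forall>x. w x = 0 \<longleftrightarrow> x \<in> W) \<and> surj w"
proof -
  obtain S where S: "S \<subseteq> W" "\<not> V.dependent S" "W \<subseteq> V.span S"
    using V.basis_exists[of W] by metis
  have W_span: "V.span S = W" using assms S V.span_minimal by blast
  obtain E where E: "S \<subseteq> E" "\<not> V.dependent E" "UNIV \<subseteq> V.span E"
    using V.maximal_independent_subset_extend[of S UNIV] S(2) by auto
  have span: "x \<in> V.span E" for x using E(3) by blast
  have q: "CARD('k) > 1" by (rule one_less_card_field)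
  have "V.span E = UNIV" using E(3) by blast
  then have "CARD('k) ^ (card S + CARD('n)) = CARD('k) ^ card E"
    using card card_span_independent[OF E(2)] card_span_independent[OF S(2)] W_span
    by (simp add: power_add)
  then have "card S + CARD('n) = card E" using q power_inject_exp by blast
  then have "card (E - S) = CARD('n)" using E(1) by (simp add: card_Diff_subset)
  then obtain b :: "'n \<Rightarrow> 'v" where b: "bij_betw b UNIV (E - S)"
    using finite_same_card_bij[of "UNIV :: 'n set" "E - S"] by auto
  define rep where "rep = V.representation E"
  define w :: "'v \<Rightarrow> 'k^'n" where "w x = (\<chi> i. rep x (b i))" for x
  have w_add: "w (x + y) = w x + w y" for x y
    by (simp add: w_def rep_def vec_eq_iff V.representation_add[OF E(2) span span])
  have w_scale: "w (s k x) = k *s w x" for k x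
    by (simp add: w_def rep_def vec_eq_iff V.representation_scale[OF E(2) span])
  have "w x = 0 \<longleftrightarrow> x \<in> W" for x
  proof
    assume "x \<in> W"
    then have "rep x = V.representation S x"
      unfolding rep_def using V.representation_extend[OF E(2) _ E(1)] W_span by blast
    moreover have "b i \<notin> S" for i using b by (auto simp: bij_betw_def)
    ultimately show "w x = 0"
      using V.representation_ne_zero[of S x] by (auto simp: w_def vec_eq_iff)
  next
    assume "w x = 0"
    then have zero: "rep x (b i) = 0" for i by (simp add: w_def vec_eq_iff)
    have in_S: "e \<in> S" if "rep x e \<noteq> 0" for e
    proof (rule ccontr)
      assume "e \<notin> S"
      moreover have "e \<in> E" using that unfolding rep_def by (rule V.representation_ne_zero)
      ultimately obtain i where "e = b i" using b by (auto simp: bij_betw_def)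
      then show False using that zero by simp
    qed
    have "x = (\<Sum>e | rep x e \<noteq> 0. s (rep x e) e)"
      unfolding rep_def using V.sum_nonzero_representation_eq[OF E(2) span] by simp
    also have "\<dots> \<in> V.span S"
      by (intro V.span_sum V.span_scale V.span_base) (use in_S in auto)
    finally show "x \<in> W" by (simp add: W_span)
  qed
  moreover have "surj w"
  proof (rule surjI)
    fix y :: "'k^'n"
    have inj_b: "b i = b j \<longleftrightarrow> i = j" for i j using b by (auto simp: bij_betw_def inj_eq)
    have "b i \<in> E" for i using b by (auto simp: bij_betw_def)
    then have "w (b i) = axis i 1" for i
      by (auto simp: w_def rep_def vec_eq_iff V.representation_basis[OF E(2)] axis_def inj_b)
    then show "w (\<Sum>i\<in>UNIV. s (y $ i) (b i)) = y"
      by (simp add: additive_sum(2)[of w, OF w_add] w_scale basis_expansion)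
  qed
  ultimately show ?thesis using w_add w_scale by blast
qed

end

section \<open>The Desarguesian spread\<close>

lemma desarg_spread_line:
  fixes z :: "'l::field^'r"
  assumes "z \<noteq> 0"
  shows "range (\<lambda>l. l *s z) \<in> desarg_spread"
proof -
  have "vec.dim (vec.span {z}) = 1" using assms by simp
  then show ?thesis using vec.subspace_span[of "{z}"] by (simp add: desarg_spread_def vec.span_singleton)
qed

lemma desarg_spread_unique:
  fixes z :: "'l::field^'r"
  assumes T: "T \<in> desarg_spread" and z: "z \<in> T" "z \<noteq> 0"
  shows "T = range (\<lambda>l. l *s z)"
proof -
  have T': "vec.subspace T" "vec.dim T = 1" using T by (simp_all add: desarg_spread_def)
  have "vec.span {z} = T"
  proof (rule vec.subspace_dim_equal)
    show "vec.span {z} \<subseteq> T" using T'(1) z by (simp add: vec.span_minimal)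
  qed (use T' z in simp_all)
  then show ?thesis by (simp add: vec.span_singleton)
qed

lemma spread_elem_eq:
  fixes z :: "'l::field^'r"
  assumes "z \<noteq> 0"
  shows "spread_elem z = range (\<lambda>l. l *s z)"
proof -
  have "z \<in> range (\<lambda>l. l *s z)" by (rule range_eqI[of _ _ 1]) simp
  then show ?thesis
    unfolding spread_elem_def using desarg_spread_line[OF assms] desarg_spread_unique assms
    by (intro the_equality) blast+
qed

lemma B_tilde_iff:
  fixes x :: "'l::field^'r"
  shows "x \<in> B_tilde A \<longleftrightarrow> x \<noteq> 0 \<and> (\<exists>l. l \<noteq> 0 \<and> l *s x \<in> A)"
proof
  assume "x \<in> B_tilde A"
  then obtain T y where x: "x \<noteq> 0" "x \<in> T" and T: "T \<in> desarg_spread" and y: "y \<in> A" "y \<noteq> 0" "y \<in> T"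
    by (auto simp: B_tilde_def B_def)
  have "T = range (\<lambda>l. l *s x)" using desarg_spread_unique[OF T x(2,1)] .
  then obtain l where "y = l *s x" using y by auto
  then show "x \<noteq> 0 \<and> (\<exists>l. l \<noteq> 0 \<and> l *s x \<in> A)" using x y by auto
next
  assume "x \<noteq> 0 \<and> (\<exists>l. l \<noteq> 0 \<and> l *s x \<in> A)"
  then obtain l where l: "x \<noteq> 0" "l \<noteq> 0" "l *s x \<in> A" by blast
  have "x \<in> range (\<lambda>l. l *s x)" by (rule range_eqI[of _ _ 1]) simp
  then show "x \<in> B_tilde A" using l desarg_spread_line[OF l(1)]
    unfolding B_tilde_def B_def by (auto intro!: exI[of _ "range (\<lambda>l. l *s x)"] bexI[of _ "l *s x"])
qed

lemma B_disjoint_iff: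
  fixes U W :: "('l::field^'r) set"
  shows "B U \<inter> B W = {} \<longleftrightarrow> U \<inter> B_tilde W = {}"
proof -
  have iff: "T \<in> B W \<longleftrightarrow> u \<in> B_tilde W" if "u \<noteq> 0" "u \<in> T" "T \<in> desarg_spread" for T u
  proof -
    have T: "T = range (\<lambda>l. l *s u)" using desarg_spread_unique[OF that(3,2,1)] .
    show ?thesis
    proof
      assume "T \<in> B W"
      then obtain y where "y \<in> W" "y \<noteq> 0" "y \<in> T" by (auto simp: B_def)
      then obtain l where "l *s u \<in> W" "l *s u \<noteq> 0" using T by auto
      then show "u \<in> B_tilde W" using that unfolding B_tilde_iff by auto
    next
      assume "u \<in> B_tilde W"
      then obtain l where "l \<noteq> 0" "l *s u \<in> W" unfolding B_tilde_iff by blast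
      moreover have "l *s u \<in> T" using T by blast
      moreover have "l *s u \<noteq> 0" using \<open>l \<noteq> 0\<close> that(1) by simp
      ultimately have "\<exists>y\<in>W. y \<noteq> 0 \<and> y \<in> T" by (intro bexI[of _ "l *s u"] conjI)
      then show "T \<in> B W" using that(3) by (simp add: B_def)
    qed
  qed
  show ?thesis
  proof (intro iffI equals0I)
    fix u assume disjoint: "B U \<inter> B W = {}" and u: "u \<in> U \<inter> B_tilde W"
    define T where "T = range (\<lambda>l. l *s u)"
    have u0: "u \<noteq> 0" using u by (simp add: B_tilde_def)
    have T: "T \<in> desarg_spread" using desarg_spread_line[OF u0] by (simp add: T_def)
    have uT: "u \<in> T" unfolding T_def by (rule range_eqI[of _ _ 1]) simp
    have "T \<in> B U" using u u0 T uT by (auto simp: B_def)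
    moreover have "T \<in> B W" using iff[OF u0 uT T] u by simp
    ultimately show False using disjoint by blast
  next
    fix T assume disjoint: "U \<inter> B_tilde W = {}" and T: "T \<in> B U \<inter> B W"
    then obtain u where u: "u \<in> U" "u \<noteq> 0" "u \<in> T" "T \<in> desarg_spread" by (auto simp: B_def)
    then have "u \<in> B_tilde W" using iff[OF u(2-4)] T by simp
    then show False using disjoint u by blast
  qed
qed

section \<open>The quotient space\<close>

text \<open>
  A surjective linear map \<open>L\<close> with kernel \<open>K\<close> identifies the space of cosets of \<open>K\<close> with its target.
\<close>
context
  fixes \<iota> :: "'k::field \<Rightarrow> 'l::field" and L :: "'l^'r \<Rightarrow> 'u::ab_group_add"
    and t :: "'k \<Rightarrow> 'u \<Rightarrow> 'u" and K :: "('l^'r) set"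
  assumes add: "\<And>x y. L (x + y) = L x + L y"
    and scale: "\<And>k x. L (kscale \<iota> k x) = t k (L x)"
    and t_zero: "\<And>k. t k 0 = 0"
    and kernel: "\<And>x. L x = 0 \<longleftrightarrow> x \<in> K"
    and surj: "surj L"
begin

lemma coset_image: "L ` (x +o K) = {L x}"
proof -
  have "L 0 = 0" by (rule additive_sum(1)[OF add])
  then have "0 \<in> K" by (simp add: kernel)
  moreover have "L (x + y) = L x" if "y \<in> K" for y using that by (simp add: add flip: kernel)
  ultimately show ?thesis by (auto simp: elt_set_plus_def)
qed

lemma coset_eq_iff: "x +o K = y +o K \<longleftrightarrow> L x = L y"
proof
  assume "x +o K = y +o K"
  then show "L x = L y" using coset_image by (metis singleton_inject)
next
  have sub: "x +o K \<subseteq> y +o K" if "L x = L y" for x y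
  proof
    fix z assume "z \<in> x +o K"
    then obtain u where u: "u \<in> K" "z = x + u" by (auto simp: elt_set_plus_def)
    have "L (x + u - y) + L y = L x + L u" by (simp flip: add)
    then have "L (x + u - y) = 0" using that u kernel by simp
    then have "x + u - y \<in> K" by (simp add: kernel)
    then have "y + (x + u - y) \<in> y +o K" by (rule set_plus_intro2)
    then show "z \<in> y +o K" by (simp add: u)
  qed
  assume "L x = L y"
  then show "x +o K = y +o K" using sub by (metis subset_antisym)
qed

lemma kernel_plus_kernel: "K + K = K"
proof -
  have "L 0 = 0" by (rule additive_sum(1)[OF add])
  then have "0 \<in> K" by (simp add: kernel)
  moreover have "x + y \<in> K" if "x \<in> K" "y \<in> K" for x y using that by (simp add: add flip: kernel)
  ultimately show ?thesis by (force simp: set_plus_def)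
qed

lemma coset_add: "(x +o K) + (y +o K) = (x + y) +o K"
  by (simp add: set_plus_rearrange kernel_plus_kernel)

lemma coset_scale: "quot_scale \<iota> K k (x +o K) = kscale \<iota> k x +o K"
proof -
  have "kscale \<iota> k ` (x +o K) + K = kscale \<iota> k x +o K"
  proof (intro equalityI subsetI)
    fix z assume "z \<in> kscale \<iota> k ` (x +o K) + K"
    then obtain u u' where u: "u \<in> K" "u' \<in> K" "z = kscale \<iota> k (x + u) + u'"
      by (auto simp: set_plus_def elt_set_plus_def)
    have "z = kscale \<iota> k x + (kscale \<iota> k u + u')"
      by (simp add: u kscale_def vec.scale_right_distrib add.assoc)
    moreover have "kscale \<iota> k u + u' \<in> K"
      using u by (simp add: add scale t_zero flip: kernel)
    ultimately show "z \<in> kscale \<iota> k x +o K" by (simp add: set_plus_intro2)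
  next
    fix z assume "z \<in> kscale \<iota> k x +o K"
    then obtain u where u: "u \<in> K" "z = kscale \<iota> k x + u" by (auto simp: elt_set_plus_def)
    have "L 0 = 0" by (rule additive_sum(1)[OF add])
    then have "0 \<in> K" by (simp add: kernel)
    then have "x + 0 \<in> x +o K" by (rule set_plus_intro2)
    then have "kscale \<iota> k x \<in> kscale \<iota> k ` (x +o K)" by simp
    then show "z \<in> kscale \<iota> k ` (x +o K) + K" unfolding u(2) using u(1) by (rule set_plus_intro)
  qed
  then show ?thesis by (simp add: quot_scale_def)
qed

lemma quot_space_closed:
  assumes "X \<in> quot_space K" "Y \<in> quot_space K"
  shows "X + Y \<in> quot_space K" "quot_scale \<iota> K k X \<in> quot_space K"
  using assms by (auto simp: quot_space_def coset_add coset_scale)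

lemma quotient_isomorphism:
  "semilinear_bij id (quot_scale \<iota> K) (quot_space K) t UNIV (\<lambda>X. the_elem (L ` X))"
proof -
  have "bij_betw (\<lambda>X. the_elem (L ` X)) (quot_space K) UNIV"
  proof (rule bij_betw_imageI)
    show "inj_on (\<lambda>X. the_elem (L ` X)) (quot_space K)"
    proof (rule inj_onI)
      fix X Y assume "X \<in> quot_space K" "Y \<in> quot_space K" "the_elem (L ` X) = the_elem (L ` Y)"
      then obtain x y where "X = x +o K" "Y = y +o K" "L x = L y"
        by (auto simp: quot_space_def coset_image)
      then show "X = Y" using coset_eq_iff by blast
    qed
    show "(\<lambda>X. the_elem (L ` X)) ` quot_space K = UNIV"
      using surj by (simp add: quot_space_def image_image coset_image)
  qed
  then show ?thesis
    by (auto simp: semilinear_bij_def quot_space_def coset_add coset_scale coset_image add scale)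
qed

lemma quotient_isomorphism_image:
  "(\<lambda>X. the_elem (L ` X)) ` (\<lambda>x. x +o K) ` S = L ` S"
  by (simp add: image_image coset_image)

end

section \<open>The matrix model of a BEL configuration\<close>

lemma pair_scale_zero: "pair_scale k 0 = 0"
  by (simp add: pair_scale_def zero_prod_def)

lemma exists_field_coordinates:
  fixes \<iota> :: "'k::{field,finite} \<Rightarrow> 'l::{field,finite}"
  assumes \<iota>: "field_hom \<iota>" and card: "CARD('l) = CARD('k) ^ CARD('n::finite)"
  shows "\<exists>c :: 'k^'n \<Rightarrow> 'l. (\<forall>x y. c (x + y) = c x + c y) \<and> (\<forall>k x. c (k *s x) = \<iota> k * c x) \<and> bij c"
proof -
  define s where "s k x = \<iota> k * x" for k x
  have vs: "vector_space s"
    by unfold_locales (simp_all add: s_def field_hom_simps[OF \<iota>] algebra_simps)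
  interpret V: vector_space s by (fact vs)
  have "card {0 :: 'l} * CARD('k) ^ CARD('n) = CARD('l)" by (simp add: card)
  then have "\<exists>d :: 'l \<Rightarrow> 'k^'n. (\<forall>x y. d (x + y) = d x + d y) \<and> (\<forall>k x. d (s k x) = k *s d x) \<and>
      (\<forall>x. d x = 0 \<longleftrightarrow> x \<in> {0}) \<and> surj d"
    by (rule exists_coordinates_modulo_subspace[OF vs V.subspace_single_0])
  then obtain d :: "'l \<Rightarrow> 'k^'n" where d_add: "\<And>x y. d (x + y) = d x + d y"
    and d_scale: "\<And>k x. d (s k x) = k *s d x" and ker: "\<And>x. d x = 0 \<longleftrightarrow> x \<in> {0}" and "surj d"
    by blast
  have "inj d"
  proof (rule injI)
    fix x y assume "d x = d y"
    then have "d (x - y) = 0" using d_add[of "x - y" y] by simp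
    then show "x = y" by (simp add: ker)
  qed
  then have bij: "bij d" using \<open>surj d\<close> by (simp add: bij_def)
  have d_inv: "d (inv d y) = y" for y using bij by (simp add: bij_is_surj surj_f_inv_f)
  have "inv d (x + y) = inv d x + inv d y" for x y
    by (rule inv_f_eq[OF \<open>inj d\<close>]) (simp add: d_add d_inv)
  moreover have "inv d (k *s x) = \<iota> k * inv d x" for k x
    by (rule inv_f_eq[OF \<open>inj d\<close>]) (simp add: d_inv d_scale flip: s_def)
  ultimately show ?thesis using bij_imp_bij_inv[OF bij] by blast
qed

text \<open>
  \<open>c\<close> identifies the large field, and \<open>w\<close> the quotient of \<open>'l^'n\<close> by \<open>W\<close>, with the column space \<open>'k^'n\<close>.
\<close>
locale BEL_coordinates =
  fixes \<iota> :: "'k::{field,finite} \<Rightarrow> 'l::{field,finite}" and W :: "('l^'n::finite) set"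
    and c :: "'k^'n \<Rightarrow> 'l" and w :: "'l^'n \<Rightarrow> 'k^'n"
  assumes \<iota>: "field_hom \<iota>" and card_l: "CARD('l) = CARD('k) ^ CARD('n)"
    and c_add: "c (a + a') = c a + c a'" and c_scale: "c (k *s a) = \<iota> k * c a" and c_bij: "bij c"
    and w_add: "w (x + y) = w x + w y" and w_scale: "w (kscale \<iota> k x) = k *s w x"
    and w_kernel: "w x = 0 \<longleftrightarrow> x \<in> W" and w_surj: "surj w"
    and no_element: "\<not> (\<exists>T \<in> desarg_spread. T \<subseteq> W)"
begin

sublocale K: vector_space "kscale \<iota> :: 'k \<Rightarrow> 'l^'n \<Rightarrow> 'l^'n"
  by (rule vector_space_kscale[OF \<iota>])

sublocale K': vector_space "kscale \<iota> :: 'k \<Rightarrow> 'l^('n option) \<Rightarrow> 'l^('n option)"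
  by (rule vector_space_kscale[OF \<iota>])

lemma c_inverse: "c (inv c l) = l" "inv c (c a) = a"
  using c_bij by (simp_all add: bij_is_surj surj_f_inv_f bij_is_inj)

lemma c_zero_iff: "c a = 0 \<longleftrightarrow> a = 0"
  using additive_sum(1)[of c, OF c_add] c_inverse(2) by metis

text \<open>
  The matrix of the map \<open>l \<mapsto> l x + W\<close> from the large field to the quotient by \<open>W\<close>.
\<close>
definition mat_of :: "'l^'n \<Rightarrow> 'k^'n^'n" where
  "mat_of x = (SOME A. \<forall>a. A *v a = w (c a *s x))"

lemma mat_of: "mat_of x *v a = w (c a *s x)"
proof -
  have add: "w (c (a + a') *s x) = w (c a *s x) + w (c a' *s x)" for a a'
    by (simp add: c_add vec.scale_left_distrib w_add)
  have scale: "w (c (k *s a) *s x) = id k *s w (c a *s x)" for k a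
  proof -
    have "c (k *s a) *s x = kscale \<iota> k (c a *s x)" by (simp add: c_scale kscale_def)
    then show ?thesis by (simp add: w_scale)
  qed
  obtain A where A: "\<And>a. w (c a *s x) = A *v map_vector id a"
    using semilinear_matrix[OF field_aut_id, of "\<lambda>a. w (c a *s x)", OF add scale] by blast
  have "map_vector id a = a" for a :: "'k^'n" by (simp add: vec_eq_iff)
  then have "\<forall>a. A *v a = w (c a *s x)" by (simp add: A)
  then have "\<forall>a. mat_of x *v a = w (c a *s x)" unfolding mat_of_def by (rule someI)
  then show ?thesis by blast
qed

lemma mat_of_add: "mat_of (x + y) = mat_of x + mat_of y"
  unfolding matrix_eq by (simp add: mat_of matrix_vector_mult_add_rdistrib vec.scale_right_distrib w_add)

lemma mat_of_scale: "mat_of (kscale \<iota> k x) = matrix_scale k (mat_of x)"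
proof -
  have "c a *s kscale \<iota> k x = kscale \<iota> k (c a *s x)" for a by (simp add: kscale_def mult.commute)
  moreover have "matrix_scale k A *v a = k *s (A *v a)" for A :: "'k^'n^'n" and a
    by (simp add: vec_eq_iff matrix_vector_mult_def sum_distrib_left mult.assoc)
  ultimately show ?thesis unfolding matrix_eq by (simp add: mat_of w_scale)
qed

lemma mat_of_diff: "mat_of (x - y) = mat_of x - mat_of y"
  using mat_of_add[of "x - y" y] by simp

lemma mat_of_zero_iff: "mat_of x = 0 \<longleftrightarrow> x = 0"
proof
  assume zero: "mat_of x = 0"
  show "x = 0"
  proof (rule ccontr)
    assume "x \<noteq> 0"
    have "l *s x \<in> W" for l
      using mat_of[of x "inv c l"] by (simp add: zero c_inverse flip: w_kernel)
    then have "range (\<lambda>l. l *s x) \<subseteq> W" by blast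
    then show False using desarg_spread_line[OF \<open>x \<noteq> 0\<close>] no_element by blast
  qed
qed (use additive_sum(1)[of mat_of, OF mat_of_add] in simp)

text \<open>
  A vector with zero matrix spans an element of the spread inside \<open>W\<close>, so the map is injective.  Both spaces
  have \<open>q\<^bsup>n * n\<^esup>\<close> elements.
\<close>
lemma mat_of_bij: "bij mat_of"
proof -
  have "inj mat_of"
  proof (rule injI)
    fix x y assume "mat_of x = mat_of y"
    then have "mat_of (x - y) = 0" by (simp add: mat_of_diff)
    then show "x = y" by (simp add: mat_of_zero_iff)
  qed
  moreover have "card (range mat_of) = CARD('k^'n^'n)"
    using \<open>inj mat_of\<close> by (simp add: card_image card_l power_mult)
  then have "surj mat_of" by (intro card_subset_eq) simp_all
  ultimately show ?thesis by (simp add: bij_def)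
qed

lemma mat_of_inverse: "mat_of (inv mat_of X) = X" "inv mat_of (mat_of x) = x"
  using mat_of_bij by (simp_all add: bij_is_surj surj_f_inv_f bij_is_inj)

text \<open>
  The matrix of \<open>x\<close> has a kernel exactly if a nonzero multiple of \<open>x\<close> lies in \<open>W\<close>.
\<close>
lemma invertible_mat_of_iff: "invertible (mat_of x) \<longleftrightarrow> x \<noteq> 0 \<and> x \<notin> B_tilde W"
proof -
  have "invertible (mat_of x) \<longleftrightarrow> (\<forall>a. w (c a *s x) = 0 \<longrightarrow> a = 0)"
    by (simp add: invertible_iff_kernel mat_of)
  also have "\<dots> \<longleftrightarrow> (\<forall>l. l *s x \<in> W \<longrightarrow> l = 0)"
    unfolding w_kernel using c_inverse c_zero_iff by metis
  also have "\<dots> \<longleftrightarrow> x \<noteq> 0 \<and> x \<notin> B_tilde W"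
  proof -
    have "0 \<in> W" using additive_sum(1)[of w, OF w_add] w_kernel by blast
    then have "x \<noteq> 0" if "\<forall>l. l *s x \<in> W \<longrightarrow> l = 0" using that[rule_format, of 1] by auto
    then show ?thesis unfolding B_tilde_iff by blast
  qed
  finally show ?thesis .
qed

lemma B_tilde_mat_of: "x \<in> B_tilde W \<longleftrightarrow> x \<noteq> 0 \<and> \<not> invertible (mat_of x)"
  using invertible_mat_of_iff[of x] by (auto simp: B_tilde_def)

text \<open>
  Every vector of \<open>'l^('n option)\<close> is \<open>l v + y\<close> for unique \<open>l\<close> and \<open>y\<close> with \<open>y\<close> in \<open>'l^'n\<close>.  Reading off \<open>l\<close> and
  \<open>y + W\<close> gives linear coordinates on the quotient by \<open>W\<close>.
\<close>
context
  fixes v :: "'l^('n option)"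
  assumes v: "v \<notin> range emb"
begin

lemma v_None: "v $ None \<noteq> 0"
proof
  assume "v $ None = 0"
  then have "v = emb (\<chi> j. v $ Some j)"
    by (simp add: vec_eq_iff emb_def split: option.split)
  then show False using v by blast
qed

lemma emb_simps:
  "emb (x + y) = emb x + (emb y :: 'l^('n option))"
  "emb (l *s x) = l *s (emb x :: 'l^('n option))"
  "emb x $ None = 0" "emb x $ Some j = x $ j"
  by (simp_all add: vec_eq_iff emb_def split: option.split)

definition quot_coords :: "'l^('n option) \<Rightarrow> ('k^'n) \<times> ('k^'n)" where
  "quot_coords z = (inv c (z $ None / v $ None), w (\<chi> j. z $ Some j - z $ None / v $ None * v $ Some j))"

lemma quot_coords: "quot_coords (l *s v + emb y) = (inv c l, w y)"
proof -
  have "(\<chi> j. (l *s v + emb y) $ Some j - (l *s v + emb y) $ None / v $ None * v $ Some j) = y"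
    using v_None by (simp add: vec_eq_iff emb_simps)
  then show ?thesis using v_None by (simp add: quot_coords_def emb_simps)
qed

lemma decompose: "\<exists>l y. z = l *s v + emb y"
proof -
  have "z = (z $ None / v $ None) *s v + emb (\<chi> j. z $ Some j - z $ None / v $ None * v $ Some j)"
    using v_None by (simp add: vec_eq_iff emb_def split: option.split)
  then show ?thesis by blast
qed

lemma quot_coords_add: "quot_coords (z + z') = quot_coords z + quot_coords z'"
proof -
  obtain l y l' y' where z: "z = l *s v + emb y" "z' = l' *s v + emb y'" using decompose by metis
  have "z + z' = (l + l') *s v + emb (y + y')"
    by (simp add: z emb_simps vec.scale_left_distrib)
  moreover have "inv c (l + l') = inv c l + inv c l'"
    by (rule inv_f_eq) (simp_all add: c_bij bij_is_inj c_add c_inverse)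
  ultimately show ?thesis by (simp only: z quot_coords) (simp add: w_add)
qed

lemma quot_coords_scale: "quot_coords (kscale \<iota> k z) = pair_scale k (quot_coords z)"
proof -
  obtain l y where z: "z = l *s v + emb y" using decompose by metis
  have "kscale \<iota> k z = (\<iota> k * l) *s v + emb (kscale \<iota> k y)"
    by (simp add: z emb_simps kscale_def vec.scale_right_distrib)
  moreover have "inv c (\<iota> k * l) = k *s inv c l"
    by (rule inv_f_eq) (simp_all add: c_bij bij_is_inj c_scale c_inverse)
  ultimately show ?thesis by (simp only: z quot_coords w_scale) (simp add: pair_scale_def)
qed

lemma quot_coords_kernel: "quot_coords z = 0 \<longleftrightarrow> z \<in> emb ` W"
proof -
  obtain l y where z: "z = l *s v + emb y" using decompose by metis
  have "inv c l = 0 \<longleftrightarrow> l = 0" using c_inverse c_zero_iff by metis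
  then have "quot_coords z = 0 \<longleftrightarrow> l = 0 \<and> y \<in> W"
    by (simp add: z quot_coords zero_prod_def w_kernel)
  also have "\<dots> \<longleftrightarrow> z \<in> emb ` W"
  proof
    assume "z \<in> emb ` W"
    then obtain y' where y': "z = emb y'" "y' \<in> W" by blast
    have "z $ None = l * v $ None" by (simp add: z emb_simps)
    then have "l = 0" using v_None by (simp add: y' emb_simps)
    moreover have "y = y'"
    proof -
      have "emb y = (emb y' :: 'l^('n option))" using z y' \<open>l = 0\<close> by simp
      then show ?thesis by (metis emb_simps(4) vec_eq_iff)
    qed
    ultimately show "l = 0 \<and> y \<in> W" using y' by simp
  qed (auto simp: z)
  finally show ?thesis .
qed

lemma quot_coords_surj: "surj quot_coords"
proof (rule surjI)
  fix p :: "('k^'n) \<times> ('k^'n)"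
  have "w (inv w (snd p)) = snd p" using w_surj by (simp add: surj_f_inv_f)
  then show "quot_coords (c (fst p) *s v + emb (inv w (snd p))) = p"
    by (simp add: quot_coords c_inverse)
qed

lemmas quot_coords_props =
  quot_coords_add quot_coords_scale pair_scale_zero quot_coords_kernel quot_coords_surj

definition quot_iso :: "('l^('n option)) set \<Rightarrow> ('k^'n) \<times> ('k^'n)" where
  "quot_iso X = the_elem (quot_coords ` X)"

lemma quot_iso_semilinear:
  "semilinear_bij id (quot_scale \<iota> (emb ` W)) (quot_space (emb ` W)) pair_scale UNIV quot_iso"
  unfolding quot_iso_def by (rule quotient_isomorphism[OF quot_coords_props])

text \<open>
  Both the line and \<open>W\<close> are subspaces over the small field, so the span is their sum, and \<open>W\<close> is mapped to
  zero.
\<close>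
lemma quot_coords_line_plus_W:
  assumes "z \<noteq> 0"
  shows "quot_coords ` kspan \<iota> (spread_elem z \<union> emb ` W) = quot_coords ` range (\<lambda>l. l *s z)"
proof -
  have line: "K'.subspace (range (\<lambda>l. l *s z))"
  proof (rule K'.subspaceI)
    show "0 \<in> range (\<lambda>l. l *s z)" by (rule range_eqI[of _ _ 0]) simp
    show "x + y \<in> range (\<lambda>l. l *s z)" if xy: "x \<in> range (\<lambda>l. l *s z)" "y \<in> range (\<lambda>l. l *s z)" for x y
    proof -
      obtain l l' where "x = l *s z" "y = l' *s z" using xy by blast
      then show ?thesis by (intro range_eqI[of _ _ "l + l'"]) (simp add: vec.scale_left_distrib)
    qed
    show "kscale \<iota> k x \<in> range (\<lambda>l. l *s z)" if x: "x \<in> range (\<lambda>l. l *s z)" for k x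
    proof -
      obtain l where "x = l *s z" using x by blast
      then show ?thesis by (intro range_eqI[of _ _ "\<iota> k * l"]) (simp add: kscale_def)
    qed
  qed
  have zero: "quot_coords 0 = 0" by (rule additive_sum(1)[OF quot_coords_add])
  have W: "K'.subspace (emb ` W)"
    by (rule K'.subspaceI)
       (simp_all add: quot_coords_add quot_coords_scale zero pair_scale_zero flip: quot_coords_kernel)
  have "K'.span (spread_elem z \<union> emb ` W) = {x + y | x y. x \<in> range (\<lambda>l. l *s z) \<and> y \<in> emb ` W}"
    using K'.span_eq_iff[THEN iffD2, OF line] K'.span_eq_iff[THEN iffD2, OF W]
    by (simp only: K'.span_Un spread_elem_eq[OF assms])
  moreover have "quot_coords ` {x + y | x y. x \<in> range (\<lambda>l. l *s z) \<and> y \<in> emb ` W}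
      = quot_coords ` range (\<lambda>l. l *s z)"
  proof (intro equalityI subsetI)
    fix p assume "p \<in> quot_coords ` {x + y | x y. x \<in> range (\<lambda>l. l *s z) \<and> y \<in> emb ` W}"
    then obtain x y where "x \<in> range (\<lambda>l. l *s z)" "y \<in> emb ` W" "p = quot_coords (x + y)" by blast
    then show "p \<in> quot_coords ` range (\<lambda>l. l *s z)"
      using quot_coords_kernel[of y] by (simp add: quot_coords_add)
  next
    fix p assume "p \<in> quot_coords ` range (\<lambda>l. l *s z)"
    then obtain x where x: "x \<in> range (\<lambda>l. l *s z)" "p = quot_coords (x + 0)" by auto
    have "0 \<in> emb ` W" using zero quot_coords_kernel by blast
    with x show "p \<in> quot_coords ` {x + y | x y. x \<in> range (\<lambda>l. l *s z) \<and> y \<in> emb ` W}" by blast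
  qed
  ultimately show ?thesis by simp
qed

lemma quot_coords_graph: "quot_coords ` range (\<lambda>l. l *s (v + emb u)) = graph (mat_of u)"
proof -
  have "quot_coords (c a *s (v + emb u)) = (a, mat_of u *v a)" for a
    by (simp add: vec.scale_right_distrib quot_coords c_inverse mat_of flip: emb_simps(2))
  then have "quot_coords ` (\<lambda>l. l *s (v + emb u)) ` range c = graph (mat_of u)"
    by (simp add: graph_def image_image)
  then show ?thesis using c_bij by (simp add: bij_is_surj)
qed

lemma quot_coords_vertical:
  assumes "invertible (mat_of u)"
  shows "quot_coords ` range (\<lambda>l. l *s emb u) = vertical"
proof -
  have c0: "inv c 0 = 0" using c_inverse c_zero_iff by metis
  have "quot_coords (c a *s emb u) = (0, mat_of u *v a)" for a
    using quot_coords[of 0 "c a *s u"] by (simp add: emb_simps(2) mat_of c0)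
  then have "quot_coords ` (\<lambda>l. l *s emb u) ` range c = (\<lambda>y. (0, y)) ` range ((*v) (mat_of u))"
    by (simp add: image_image)
  moreover have "surj ((*v) (mat_of u))"
    using assms by (metis invertible_right_inverse matrix_right_invertible_surjective)
  ultimately show ?thesis using c_bij by (simp add: bij_is_surj vertical_def)
qed

text \<open>
  A nonzero vector of \<open>\<langle>v, U\<rangle>\<close> is a vector \<open>u\<close> of \<open>U\<close> or, up to a scalar of the small field, \<open>v + u\<close>.  The
  first gives the element at infinity, as the matrix of \<open>u\<close> is nonsingular, and the second the graph of that
  matrix.
\<close>
lemma quot_iso_BEL_spread:
  assumes U: "K.subspace U" "U \<noteq> {0}" and nonsing: "\<And>u. u \<in> U \<Longrightarrow> u \<noteq> 0 \<Longrightarrow> invertible (mat_of u)"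
  shows "(\<lambda>T. quot_iso ` T) ` BEL_spread \<iota> U W v = spread_of (mat_of ` U)"
proof -
  define Z where "Z = {z. z \<noteq> 0 \<and> z \<in> K'.span (insert v (emb ` U))}"
  define l where "l z = quot_coords ` range (\<lambda>l. l *s z)" for z
  have "BEL_spread \<iota> U W v = (\<lambda>z. (\<lambda>x. x +o emb ` W) ` kspan \<iota> (spread_elem z \<union> emb ` W)) ` Z"
    by (auto simp: BEL_spread_def Z_def)
  then have "(\<lambda>T. quot_iso ` T) ` BEL_spread \<iota> U W v
      = (\<lambda>z. quot_iso ` (\<lambda>x. x +o emb ` W) ` kspan \<iota> (spread_elem z \<union> emb ` W)) ` Z"
    by (simp only: image_image)
  also have "\<dots> = (\<lambda>z. quot_coords ` kspan \<iota> (spread_elem z \<union> emb ` W)) ` Z"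
    unfolding quot_iso_def by (simp only: quotient_isomorphism_image[OF quot_coords_props])
  also have "\<dots> = l ` Z" unfolding l_def
    by (rule image_cong) (simp_all add: Z_def quot_coords_line_plus_W)
  also have "l ` Z = spread_of (mat_of ` U)"
  proof -
    have embU: "K'.subspace (emb ` U)"
    proof (rule K'.subspaceI)
      have "emb 0 = (0 :: 'l^('n option))" by (simp add: vec_eq_iff emb_def split: option.split)
      then show "0 \<in> emb ` U" using K.subspace_0[OF U(1)] by (metis imageI)
      show "x + y \<in> emb ` U" if "x \<in> emb ` U" "y \<in> emb ` U" for x y
        using that K.subspace_add[OF U(1)] by (auto simp flip: emb_simps(1))
      show "kscale \<iota> k x \<in> emb ` U" if "x \<in> emb ` U" for k x
        using that K.subspace_scale[OF U(1), of _ k] unfolding kscale_def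
        by (auto simp flip: emb_simps(2))
    qed
    have Z_iff: "z \<in> Z \<longleftrightarrow> z \<noteq> 0 \<and> (\<exists>k. \<exists>u\<in>U. z = \<iota> k *s v + emb u)" for z
    proof -
      have "z \<in> K'.span (insert v (emb ` U)) \<longleftrightarrow> (\<exists>k. z - kscale \<iota> k v \<in> emb ` U)"
        unfolding K'.span_breakdown_eq K'.span_eq_iff[THEN iffD2, OF embU] ..
      also have "\<dots> \<longleftrightarrow> (\<exists>k. \<exists>u\<in>U. z = \<iota> k *s v + emb u)"
        by (auto simp: image_iff kscale_def diff_eq_eq add.commute)
      finally show ?thesis by (simp add: Z_def)
    qed
    have "l z \<in> spread_of (mat_of ` U)" if z: "z \<in> Z" for z
    proof -
      obtain k u where ku: "z \<noteq> 0" "u \<in> U" "z = \<iota> k *s v + emb u" using z Z_iff by blast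
      show ?thesis
      proof (cases "k = 0")
        case True
        then have zu: "z = emb u" by (simp add: ku field_hom_simps[OF \<iota>])
        then have "u \<noteq> 0" using ku(1) by (auto simp: vec_eq_iff emb_def split: option.splits)
        then have "l z = vertical" unfolding l_def zu
          using nonsing[OF ku(2)] by (intro quot_coords_vertical)
        then show ?thesis by (simp add: spread_of_def)
      next
        case False
        define u' where "u' = kscale \<iota> (inverse k) u"
        have "\<iota> k * \<iota> (inverse k) = 1"
          using False by (simp add: field_hom_simps(2)[OF \<iota>] flip: field_hom_simps(4)[OF \<iota>])
        then have "z = \<iota> k *s (v + emb u')"
          by (simp add: ku u'_def kscale_def emb_simps vec.scale_right_distrib)
        then have "range (\<lambda>l. l *s z) = range (\<lambda>l. l *s (v + emb u'))"
        proof -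
          assume z: "z = \<iota> k *s (v + emb u')"
          have "\<iota> k \<noteq> 0" using False by (simp add: field_hom_simps[OF \<iota>])
          then have surj: "surj (\<lambda>l. l * \<iota> k)" by (intro surjI[of _ "\<lambda>l. l / \<iota> k"]) simp
          have "range (\<lambda>l. l *s z) = (\<lambda>l. l *s (v + emb u')) ` range (\<lambda>l. l * \<iota> k)"
            by (simp add: z image_image)
          then show ?thesis by (simp add: surj)
        qed
        then have "l z = graph (mat_of u')" unfolding l_def by (simp only: quot_coords_graph)
        moreover have "u' \<in> U" using K.subspace_scale[OF U(1) ku(2)] by (simp add: u'_def)
        ultimately show ?thesis by (simp add: spread_of_def)
      qed
    qed
    moreover have "graph (mat_of u) \<in> l ` Z" if "u \<in> U" for u
    proof -
      have "(v + emb u) $ None \<noteq> 0" using v_None by (simp add: emb_simps)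
      then have "v + emb u \<noteq> 0" by (metis zero_index)
      moreover have "v + emb u = \<iota> 1 *s v + emb u" by (simp add: field_hom_simps[OF \<iota>])
      ultimately have "v + emb u \<in> Z" using that Z_iff by blast
      then show ?thesis unfolding quot_coords_graph[symmetric] l_def by blast
    qed
    moreover have "vertical \<in> l ` Z"
    proof -
      obtain u where u: "u \<in> U" "u \<noteq> 0" using U K.subspace_0[OF U(1)] by blast
      have "emb u \<noteq> (0 :: 'l^('n option))"
        using u(2) by (metis emb_simps(4) vec_eq_iff zero_index)
      moreover have "emb u = \<iota> 0 *s v + emb u" by (simp add: field_hom_simps[OF \<iota>])
      ultimately have "emb u \<in> Z" using u Z_iff by blast
      then show ?thesis unfolding quot_coords_vertical[OF nonsing[OF u], symmetric] l_def by blast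
    qed
    ultimately show ?thesis unfolding spread_of_def by blast
  qed
  finally show ?thesis .
qed

end

end

section \<open>Spreads and stabilizer in the matrix model\<close>

context BEL_coordinates
begin

lemma BEL_configuration_spread_set:
  assumes U: "BEL_configuration \<iota> U W"
  shows "K.subspace U" "U \<noteq> {0}" "\<And>u. u \<in> U \<Longrightarrow> u \<noteq> 0 \<Longrightarrow> invertible (mat_of u)"
    "difference_closed (mat_of ` U)" "mat_of ` U \<noteq> {0}"
proof -
  show sub: "K.subspace U" using U by (simp add: BEL_configuration_def)
  have "K.dim U = CARD('n)" using U by (simp add: BEL_configuration_def)
  moreover have "K.dim {0} = 0"
    using K.dim_span[of "{}"] K.dim_eq_card_independent[OF K.independent_empty] by simp
  ultimately show nz: "U \<noteq> {0}" by auto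
  have "B U \<inter> B W = {}" using U by (simp add: BEL_configuration_def)
  then have disjoint: "U \<inter> B_tilde W = {}" by (simp add: B_disjoint_iff)
  show "invertible (mat_of u)" if "u \<in> U" "u \<noteq> 0" for u
    using that disjoint by (auto simp: invertible_mat_of_iff)
  show "difference_closed (mat_of ` U)"
    unfolding difference_closed_def
  proof (intro conjI ballI)
    have "mat_of 0 \<in> mat_of ` U" by (rule imageI) (rule K.subspace_0[OF sub])
    then show "0 \<in> mat_of ` U" by (simp add: mat_of_zero_iff[THEN iffD2])
    fix X Y assume "X \<in> mat_of ` U" "Y \<in> mat_of ` U"
    then obtain x y where "x \<in> U" "y \<in> U" "X = mat_of x" "Y = mat_of y" by blast
    then have "X - Y = mat_of (x - y)" "x - y \<in> U"
      using K.subspace_diff[OF sub] by (simp_all add: mat_of_diff)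
    then show "X - Y \<in> mat_of ` U" by blast
  qed
  obtain u where "u \<in> U" "u \<noteq> 0" using nz K.subspace_0[OF sub] by blast
  then have "mat_of u \<in> mat_of ` U" "mat_of u \<noteq> 0" by (simp_all add: mat_of_zero_iff)
  then show "mat_of ` U \<noteq> {0}" by blast
qed

abbreviation (input) quot :: "('l^('n option)) set set" where "quot \<equiv> quot_space (emb ` W)"
abbreviation (input) qscale where "qscale \<equiv> quot_scale \<iota> (emb ` W) :: 'k \<Rightarrow> ('l^('n option)) set \<Rightarrow> _"

lemma quot_closed:
  fixes v :: "'l^('n option)"
  assumes v: "v \<notin> range emb" and "X \<in> quot" "Y \<in> quot"
  shows "X + Y \<in> quot" "qscale k X \<in> quot"
  using quot_space_closed[OF quot_coords_add[OF v] quot_coords_scale[OF v] pair_scale_zero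
      quot_coords_kernel[OF v] quot_coords_surj[OF v] assms(2,3)] by blast+

lemma BEL_spread_subset: "T \<in> BEL_spread \<iota> U W v \<Longrightarrow> T \<subseteq> quot"
  by (auto simp: BEL_spread_def quot_space_def)

lemma BEL_spread_equivalent_model:
  assumes v: "v \<notin> range emb" and U: "BEL_configuration \<iota> U W"
  shows "spreads_equivalent qscale quot (BEL_spread \<iota> U W v) pair_scale UNIV (spread_of (mat_of ` U))"
    and "spreads_equivalent pair_scale UNIV (spread_of (mat_of ` U)) qscale quot (BEL_spread \<iota> U W v)"
proof -
  show eq: "spreads_equivalent qscale quot (BEL_spread \<iota> U W v) pair_scale UNIV (spread_of (mat_of ` U))"
    unfolding spreads_equivalent_def
    using field_aut_id quot_iso_semilinear[OF v]
      quot_iso_BEL_spread[OF v BEL_configuration_spread_set(1-3)[OF U]] by blast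
  show "spreads_equivalent pair_scale UNIV (spread_of (mat_of ` U)) qscale quot (BEL_spread \<iota> U W v)"
    by (rule spreads_equivalent_sym[OF eq]) (auto intro: quot_closed[OF v] dest: BEL_spread_subset)
qed

lemma dual_BEL_spread_equivalent_model:
  fixes \<theta> :: "('l^('n option)) set \<Rightarrow> 'l^2"
  assumes v: "v \<notin> range emb" and U: "BEL_configuration \<iota> U W"
    and \<theta>: "semilinear_bij id qscale quot (kscale \<iota>) UNIV \<theta>"
  shows "spreads_equivalent pair_scale UNIV (spread_of (transpose ` mat_of ` U)) (kscale \<iota>) UNIV
           (dual_spread CARD('k) CARD('n) ((\<lambda>T. \<theta> ` T) ` BEL_spread \<iota> U W v))"
proof -
  note iso = quot_iso_semilinear[OF v]
  define g where "g = inv_into quot (quot_iso v)"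
  have "semilinear_bij (id \<circ> inv id) pair_scale UNIV (kscale \<iota>) UNIV (\<theta> \<circ> g)"
    unfolding g_def
    by (rule semilinear_bij_comp[OF semilinear_bij_inverse[OF iso] \<theta>]) (auto intro: quot_closed[OF v])
  moreover have "id \<circ> inv id = (id :: 'k \<Rightarrow> 'k)" by simp
  ultimately have h: "semilinear_bij id pair_scale UNIV (kscale \<iota>) UNIV (\<theta> \<circ> g)" by (simp only:)
  have inj: "inj_on (quot_iso v) quot" using iso by (simp add: semilinear_bij_def bij_betw_def)
  have eq: "spread_of (mat_of ` U) = (\<lambda>T. quot_iso v ` T) ` BEL_spread \<iota> U W v"
    by (rule quot_iso_BEL_spread[OF v BEL_configuration_spread_set(1-3)[OF U], symmetric])
  have "(\<lambda>T. (\<theta> \<circ> g) ` T) ` spread_of (mat_of ` U)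
      = (\<lambda>T. \<theta> ` g ` quot_iso v ` T) ` BEL_spread \<iota> U W v"
    unfolding eq by (simp only: image_image o_apply)
  also have "\<dots> = (\<lambda>T. \<theta> ` T) ` BEL_spread \<iota> U W v"
    by (rule image_cong[OF refl])
       (simp only: g_def inv_into_image_cancel[OF inj BEL_spread_subset])
  finally show ?thesis using dual_spread_equivalent[OF \<iota> card_l h, of "mat_of ` U"] by (simp only:)
qed

lemma stabilizer_of_preserver:
  assumes \<sigma>: "field_aut \<sigma>" and add: "\<And>X Y. f (X + Y) = f X + f Y"
    and scale: "\<And>k X. f (matrix_scale k X) = matrix_scale (\<sigma> k) (f X)"
    and bij: "bij f" and nonsing: "\<And>X. invertible (f X) \<longleftrightarrow> invertible X"
  shows "inv mat_of \<circ> f \<circ> mat_of \<in> Stab \<iota> (B_tilde W)"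
proof -
  define \<phi> where "\<phi> = inv mat_of \<circ> f \<circ> mat_of"
  have \<phi>: "mat_of (\<phi> x) = f (mat_of x)" for x by (simp add: \<phi>_def mat_of_inverse)
  have mat_eq: "x = y" if "mat_of x = mat_of y" for x y
    using that mat_of_bij by (meson bij_is_inj injD)
  have "bij \<phi>" unfolding \<phi>_def by (intro bij_comp bij_imp_bij_inv mat_of_bij bij)
  moreover have "\<phi> (x + y) = \<phi> x + \<phi> y" for x y
    by (rule mat_eq) (simp add: \<phi> mat_of_add add)
  moreover have "\<phi> (kscale \<iota> k x) = kscale \<iota> (\<sigma> k) (\<phi> x)" for k x
    by (rule mat_eq) (simp add: \<phi> mat_of_scale scale)
  ultimately have "\<phi> \<in> Gamma_L \<iota>" using \<sigma> by (auto simp: Gamma_L_def semilinear_bij_def)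
  moreover have "\<phi> x = 0 \<longleftrightarrow> x = 0" for x
  proof -
    have "f X = 0 \<longleftrightarrow> X = 0" for X
      using additive_sum(1)[of f, OF add] bij by (metis bij_is_inj injD)
    then show ?thesis by (simp add: \<phi> flip: mat_of_zero_iff)
  qed
  then have iff: "\<phi> x \<in> B_tilde W \<longleftrightarrow> x \<in> B_tilde W" for x
    by (simp add: B_tilde_mat_of \<phi> nonsing)
  have "\<phi> ` B_tilde W = B_tilde W"
  proof (intro equalityI subsetI)
    fix y assume y: "y \<in> B_tilde W"
    obtain x where "y = \<phi> x" using \<open>bij \<phi>\<close> by (metis bij_pointE)
    then show "y \<in> \<phi> ` B_tilde W" using y iff by blast
  qed (use iff in blast)
  ultimately show ?thesis by (simp add: Stab_def \<phi>_def)
qed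

lemma matrix_scale_sandwich: "P ** matrix_scale k X ** Q = matrix_scale k (P ** X ** Q)"
  for X :: "'k^'n^'n"
  by (simp add: vec_eq_iff matrix_matrix_mult_def sum_distrib_left sum_distrib_right mult_ac)

lemma sandwich_preserver:
  fixes P Q :: "'k^'n^'n" and T :: "'k^'n^'n \<Rightarrow> 'k^'n^'n"
  assumes \<sigma>: "field_aut \<sigma>" and inv: "invertible P" "invertible Q" and T: "T = id \<or> T = transpose"
  shows "inv mat_of \<circ> (\<lambda>X. P ** T (map_matrix \<sigma> X) ** Q) \<circ> mat_of \<in> Stab \<iota> (B_tilde W)"
proof (rule stabilizer_of_preserver[OF \<sigma>])
  define f where "f X = P ** T (map_matrix \<sigma> X) ** Q" for X
  obtain P' where P': "P' ** P = mat 1" "P ** P' = mat 1" using inv(1) by (auto simp: invertible_def)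
  obtain Q' where Q': "Q' ** Q = mat 1" "Q ** Q' = mat 1" using inv(2) by (auto simp: invertible_def)
  have T_add: "T (X + Y) = T X + T Y" and T_T: "T (T X) = X" and T_inv: "invertible (T X) \<longleftrightarrow> invertible X"
    and T_scale: "T (matrix_scale k X) = matrix_scale k (T X)" for X Y k
    using T invertible_transpose[of X] invertible_transpose[of "transpose X"]
    by (auto simp: vec_eq_iff transpose_def transpose_transpose)
  show "f (X + Y) = f X + f Y" for X Y
    by (simp add: f_def map_matrix_add[OF \<sigma>] T_add sandwich_add)
  have "map_matrix \<sigma> (matrix_scale k X) = matrix_scale (\<sigma> k) (map_matrix \<sigma> X)"
    for k and X :: "'k^'n^'n"
    by (simp add: vec_eq_iff field_aut_simps[OF \<sigma>])
  then show "f (matrix_scale k X) = matrix_scale (\<sigma> k) (f X)" for k X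
    by (simp add: f_def T_scale matrix_scale_sandwich)
  define g where "g Y = map_matrix (inv \<sigma>) (T (P' ** Y ** Q'))" for Y
  have undo: "P' ** (P ** Y ** Q) ** Q' = Y" for Y
  proof -
    have "P' ** (P ** Y ** Q) ** Q' = (P' ** P) ** Y ** (Q ** Q')" by (simp add: matrix_mul_assoc)
    then show ?thesis by (simp add: P' Q')
  qed
  have gf: "g (f X) = X" for X
    by (simp add: f_def g_def undo T_T map_matrix_inverse[OF \<sigma>])
  have "inj f" using gf by (metis injI)
  then show "bij f" by (simp add: bij_def finite_UNIV_inj_surj)
  show "invertible (f X) \<longleftrightarrow> invertible X" for X
  proof
    assume "invertible X"
    then show "invertible (f X)"
      using inv T_inv by (simp add: f_def invertible_mult invertible_map_matrix[OF \<sigma>])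
  next
    assume f: "invertible (f X)"
    have "invertible P'" "invertible Q'" using P' Q' by (auto simp: invertible_def)
    then have "invertible (g (f X))"
      using f T_inv unfolding g_def by (intro invertible_map_matrix[OF field_aut_inv[OF \<sigma>]]) (simp add: invertible_mult)
    then show "invertible X" by (simp add: gf)
  qed
qed

text \<open>
  Under \<open>mat_of\<close> the stabilizer becomes the group of semilinear bijections of the matrix space that preserve
  nonsingularity, which are \<open>X \<mapsto> P X\<^sup>\<sigma> Q\<close> and their composites with transposition.
\<close>
lemma stabilizer_iff_spread_set_equivalent:
  "(\<exists>\<phi> \<in> Stab \<iota> (B_tilde W). U' = \<phi> ` U) \<longleftrightarrow>
     spread_set_equivalent (mat_of ` U) (mat_of ` U') \<or>
     spread_set_equivalent (transpose ` mat_of ` U) (mat_of ` U')"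
proof
  assume "\<exists>\<phi> \<in> Stab \<iota> (B_tilde W). U' = \<phi> ` U"
  then obtain \<phi> where stab: "\<phi> \<in> Stab \<iota> (B_tilde W)" and U': "U' = \<phi> ` U" by blast
  then obtain \<sigma> where \<sigma>: "field_aut \<sigma>" and semi: "semilinear_bij \<sigma> (kscale \<iota>) UNIV (kscale \<iota>) UNIV \<phi>"
    and img: "\<phi> ` B_tilde W = B_tilde W"
    by (auto simp: Stab_def Gamma_L_def)
  have bij: "bij \<phi>" and add: "\<phi> (x + y) = \<phi> x + \<phi> y" and scale: "\<phi> (kscale \<iota> k x) = kscale \<iota> (\<sigma> k) (\<phi> x)" for x y k
    using semi by (simp_all add: semilinear_bij_def)
  define f where "f = mat_of \<circ> \<phi> \<circ> inv mat_of"
  have f: "f (mat_of x) = mat_of (\<phi> x)" for x by (simp add: f_def mat_of_inverse)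
  have pre: "\<exists>x. X = mat_of x" for X using mat_of_inverse(1) by metis
  have "f (X + Y) = f X + f Y" for X Y
  proof -
    obtain x y where "X = mat_of x" "Y = mat_of y" using pre by metis
    then show ?thesis by (simp add: f add flip: mat_of_add)
  qed
  moreover have "f (matrix_scale k X) = matrix_scale (\<sigma> k) (f X)" for k X
  proof -
    obtain x where "X = mat_of x" using pre by metis
    then show ?thesis by (simp add: f scale flip: mat_of_scale)
  qed
  moreover have "bij f" unfolding f_def by (intro bij_comp bij_imp_bij_inv mat_of_bij bij)
  moreover have "invertible (f X) \<longleftrightarrow> invertible X" for X
  proof -
    obtain x where x: "X = mat_of x" using pre by metis
    have "\<phi> x = 0 \<longleftrightarrow> x = 0"
      using additive_sum(1)[of \<phi>, OF add] bij by (metis bij_is_inj injD)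
    moreover have "\<phi> x \<in> B_tilde W \<longleftrightarrow> x \<in> B_tilde W"
      using img bij by (metis bij_is_inj inj_image_mem_iff)
    ultimately show ?thesis by (simp add: x f invertible_mat_of_iff)
  qed
  ultimately obtain P Q where inv: "invertible P" "invertible Q" and
    "(\<forall>X. f X = P ** map_matrix \<sigma> X ** Q) \<or> (\<forall>X. f X = P ** transpose (map_matrix \<sigma> X) ** Q)"
    using semilinear_nonsingularity_preserver[OF \<sigma>, of f] by blast
  moreover have fU: "mat_of ` U' = f ` mat_of ` U" by (simp add: U' image_image f)
  ultimately consider "\<forall>X. f X = P ** map_matrix \<sigma> X ** Q" | "\<forall>X. f X = P ** map_matrix \<sigma> (transpose X) ** Q"
    by (auto simp: map_matrix_transpose[OF \<sigma>])
  then show "spread_set_equivalent (mat_of ` U) (mat_of ` U') \<or>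
      spread_set_equivalent (transpose ` mat_of ` U) (mat_of ` U')"
  proof cases
    case 1
    then have "mat_of ` U' = (\<lambda>X. P ** map_matrix \<sigma> X ** Q) ` mat_of ` U" by (simp add: fU)
    then show ?thesis using \<sigma> inv unfolding spread_set_equivalent_def by blast
  next
    case 2
    then have "mat_of ` U' = (\<lambda>X. P ** map_matrix \<sigma> X ** Q) ` transpose ` mat_of ` U"
      by (simp add: fU image_image)
    then show ?thesis using \<sigma> inv unfolding spread_set_equivalent_def by blast
  qed
next
  assume "spread_set_equivalent (mat_of ` U) (mat_of ` U') \<or>
     spread_set_equivalent (transpose ` mat_of ` U) (mat_of ` U')"
  then have "\<exists>T. (T = id \<or> T = transpose) \<and> spread_set_equivalent (T ` mat_of ` U) (mat_of ` U')"
    by (elim disjE) (auto simp: image_id)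
  then obtain T :: "'k^'n^'n \<Rightarrow> 'k^'n^'n" where T: "T = id \<or> T = transpose"
    and equiv: "spread_set_equivalent (T ` mat_of ` U) (mat_of ` U')" by blast
  then obtain \<sigma> P Q where \<sigma>: "field_aut \<sigma>" and inv: "invertible P" "invertible Q"
    and img: "mat_of ` U' = (\<lambda>X. P ** map_matrix \<sigma> X ** Q) ` T ` mat_of ` U"
    by (auto simp: spread_set_equivalent_def)
  have T_map: "map_matrix \<sigma> (T X) = T (map_matrix \<sigma> X)" for X
    using T by (auto simp: map_matrix_transpose[OF \<sigma>])
  define \<phi> where "\<phi> = inv mat_of \<circ> (\<lambda>X. P ** T (map_matrix \<sigma> X) ** Q) \<circ> mat_of"
  have "\<phi> ` U = inv mat_of ` mat_of ` U'"
    by (simp add: img \<phi>_def image_image T_map)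
  also have "\<dots> = U'" by (simp add: image_image mat_of_inverse)
  finally have "U' = \<phi> ` U" by simp
  moreover have "\<phi> \<in> Stab \<iota> (B_tilde W)" unfolding \<phi>_def by (rule sandwich_preserver[OF \<sigma> inv T])
  ultimately show "\<exists>\<phi> \<in> Stab \<iota> (B_tilde W). U' = \<phi> ` U" by blast
qed

end

section \<open>Equivalence of BEL spreads\<close>

theorem theorem9:
  fixes \<iota> :: "'k::{field,finite} \<Rightarrow> 'l::{field,finite}"
    and U U' W :: "('l ^ 'n::finite) set"
    and v v' :: "'l ^ ('n option)"
    and \<theta> :: "('l ^ ('n option)) set \<Rightarrow> 'l ^ 2"
  assumes "field_hom \<iota>"
    and "CARD('l) = CARD('k) ^ CARD('n)"
    and "ksubspace \<iota> W" and "kdim \<iota> W = CARD('n)^2 - CARD('n)"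
    and "\<not> (\<exists>T \<in> desarg_spread. T \<subseteq> W)"
    and "BEL_configuration \<iota> U W"
    and "BEL_configuration \<iota> U' W"
    and "v \<notin> range emb" and "v' \<notin> range emb"
    and "semilinear_bij id (quot_scale \<iota> (emb ` W)) (quot_space (emb ` W)) (kscale \<iota>) UNIV \<theta>"
  shows "(spreads_equivalent
            (quot_scale \<iota> (emb ` W)) (quot_space (emb ` W)) (BEL_spread \<iota> U' W v')
            (quot_scale \<iota> (emb ` W)) (quot_space (emb ` W)) (BEL_spread \<iota> U W v)
          \<or> spreads_equivalent
            (quot_scale \<iota> (emb ` W)) (quot_space (emb ` W)) (BEL_spread \<iota> U' W v')
            (kscale \<iota>) UNIV
            (dual_spread CARD('k) CARD('n) ((\<lambda>T. \<theta> ` T) ` BEL_spread \<iota> U W v)))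
        \<longleftrightarrow> (\<exists>\<phi> \<in> Stab \<iota> (B_tilde W). U' = \<phi> ` U)"
proof -
  have vs: "vector_space (kscale \<iota> :: 'k \<Rightarrow> 'l^'n \<Rightarrow> 'l^'n)"
    by (rule vector_space_kscale[OF assms(1)])
  have "card W * CARD('k) ^ CARD('n) = CARD('l^'n)"
  proof -
    have "CARD('n) \<le> CARD('n)^2" by (simp add: power2_eq_square)
    then have "card W * CARD('k) ^ CARD('n) = CARD('k) ^ (CARD('n)^2)"
      using card_subspace[OF vs assms(3)] assms(4) by (simp flip: power_add)
    then show ?thesis by (simp add: assms(2) power_mult power2_eq_square)
  qed
  then have "\<exists>w :: 'l^'n \<Rightarrow> 'k^'n. (\<forall>x y. w (x + y) = w x + w y) \<and> (\<forall>k x. w (kscale \<iota> k x) = k *s w x) \<and>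
      (\<forall>x. w x = 0 \<longleftrightarrow> x \<in> W) \<and> surj w"
    by (rule exists_coordinates_modulo_subspace[OF vs assms(3)])
  then obtain w :: "'l^'n \<Rightarrow> 'k^'n" where w: "\<And>x y. w (x + y) = w x + w y"
    "\<And>k x. w (kscale \<iota> k x) = k *s w x" "\<And>x. w x = 0 \<longleftrightarrow> x \<in> W" "surj w" by blast
  obtain c :: "'k^'n \<Rightarrow> 'l" where c: "\<And>x y. c (x + y) = c x + c y"
    "\<And>k x. c (k *s x) = \<iota> k * c x" "bij c"
    using exists_field_coordinates[OF assms(1,2)] by blast
  interpret BEL_coordinates \<iota> W c w
    by (unfold_locales) (fact assms(1,2,5) c w)+
  define C C' where "C = mat_of ` U" and "C' = mat_of ` U'"
  note U = assms(6) and U' = assms(7) and v = assms(8) and v' = assms(9)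
  note C = BEL_configuration_spread_set(4,5)[OF U, folded C_def]
  note C' = BEL_configuration_spread_set(4,5)[OF U', folded C'_def]
  have T: "difference_closed (transpose ` C)" "transpose ` C \<noteq> {0}"
  proof -
    have diff: "transpose X - transpose Y = transpose (X - Y)" for X Y :: "'k^'n^'n"
      by (simp add: vec_eq_iff transpose_def)
    have zero: "transpose X = 0 \<longleftrightarrow> X = 0" for X :: "'k^'n^'n"
      by (auto simp: vec_eq_iff transpose_def)
    show "difference_closed (transpose ` C)"
      unfolding difference_closed_def
    proof (intro conjI ballI)
      have "0 \<in> C" using C(1) by (simp add: difference_closed_def)
      then have "transpose 0 \<in> transpose ` C" by (rule imageI)
      then show "0 \<in> transpose ` C" by (simp add: zero[THEN iffD2])
      fix X Y assume "X \<in> transpose ` C" "Y \<in> transpose ` C"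
      then obtain X' Y' where "X' \<in> C" "Y' \<in> C" "X = transpose X'" "Y = transpose Y'" by blast
      moreover from this have "X' - Y' \<in> C" using C(1) unfolding difference_closed_def by blast
      ultimately show "X - Y \<in> transpose ` C" by (simp add: diff)
    qed
    show "transpose ` C \<noteq> {0}"
    proof
      assume eq: "transpose ` C = {0}"
      have "X = 0" if "X \<in> C" for X using that eq zero[of X] by blast
      then have "C \<subseteq> {0}" by blast
      moreover have "0 \<in> C" using C(1) by (simp add: difference_closed_def)
      ultimately show False using C(2) by blast
    qed
  qed
  note mU = BEL_spread_equivalent_model[OF v U, folded C_def]
  note mU' = BEL_spread_equivalent_model[OF v' U', folded C'_def]
  note mD = dual_BEL_spread_equivalent_model[OF v U assms(10), folded C_def]
  have mD': "spreads_equivalent (kscale \<iota>) UNIV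
      (dual_spread CARD('k) CARD('n) ((\<lambda>T. \<theta> ` T) ` BEL_spread \<iota> U W v))
      pair_scale UNIV (spread_of (transpose ` C))"
    by (rule spreads_equivalent_sym[OF mD]) simp_all
  have model: "spreads_equivalent pair_scale UNIV (spread_of C') pair_scale UNIV (spread_of D)
      \<longleftrightarrow> spread_set_equivalent D C'" if "difference_closed D" "D \<noteq> {0}" for D
    using spreads_equivalent_imp_spread_set_equivalent[OF _ that C'(1)]
      spread_set_equivalent_imp_spreads_equivalent spread_set_equivalent_sym by blast
  have "spreads_equivalent (quot_scale \<iota> (emb ` W)) (quot_space (emb ` W)) (BEL_spread \<iota> U' W v')
          (quot_scale \<iota> (emb ` W)) (quot_space (emb ` W)) (BEL_spread \<iota> U W v)
      \<longleftrightarrow> spreads_equivalent pair_scale UNIV (spread_of C') pair_scale UNIV (spread_of C)"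
    using spreads_equivalent_trans[OF spreads_equivalent_trans[OF mU'(2)] mU(1)]
      spreads_equivalent_trans[OF spreads_equivalent_trans[OF mU'(1)] mU(2)] by blast
  moreover have "spreads_equivalent (quot_scale \<iota> (emb ` W)) (quot_space (emb ` W)) (BEL_spread \<iota> U' W v')
          (kscale \<iota>) UNIV (dual_spread CARD('k) CARD('n) ((\<lambda>T. \<theta> ` T) ` BEL_spread \<iota> U W v))
      \<longleftrightarrow> spreads_equivalent pair_scale UNIV (spread_of C') pair_scale UNIV (spread_of (transpose ` C))"
    using spreads_equivalent_trans[OF spreads_equivalent_trans[OF mU'(2)] mD']
      spreads_equivalent_trans[OF spreads_equivalent_trans[OF mU'(1)] mD] by blast
  ultimately show ?thesis
    using model[OF C] model[OF T]
    unfolding stabilizer_iff_spread_set_equivalent C_def C'_def by simp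
qed

end
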